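(* Let $X$ and $Y$ be non-trivial complex Banach spaces, let $1\le p<\infty$ and let $q\in(1,\infty]$ be defined by $1/p+1/q=1$. Let $(R(t))_{t>0}\subseteq L(X,Y)$ satisfy $$\|R(t)\|_{L(X,Y)}\le M\frac{t^{\beta-1}}{1+t^{\gamma}},\quad t>0,$$ for some finite constants $\gamma>1$, $\beta\in(0,1]$, $M>0$. Let $g:\mathbb{R}\to X$ be Besicovitch-Doss $p$-almost periodic and Stepanov $p$-bounded, and assume that $q(\beta-1)>-1$ if $p>1$, resp. $\beta=1$ if $p=1$. Suppose, additionally, that for every $\lambda\in\mathbb{R}$ and $\epsilon>0$ there exists $l_0>0$ such that $$\frac{1}{l}\Big\|\Big(\int_0^l-\int_{-v}^{l-v}\Big)e^{i\lambda s}g(s)\,ds\Big\|^p<\epsilon,\quad l\ge l_0,\ v\ge 0.$$ Then the function $G:\mathbb{R}\to Y$, $G(t):=\int_{-\infty}^{t}R(t-s)g(s)\,ds$, $t\in\mathbb{R}$, is bounded, continuous and Besicovitch-Doss $p$-almost periodic.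
   Context: $L(X,Y)$ denotes the bounded linear operators $X\to Y$. For $f\in L^p_{loc}(\mathbb{R}:X)$ set $\|f\|_{\mathcal{M}^p}:=\limsup_{t\to+\infty}\big[\frac{1}{2t}\int_{-t}^{t}\|f(s)\|^p\,ds\big]^{1/p}$. $f$ is Stepanov $p$-bounded iff $\sup_{t\in\mathbb{R}}\left(\int_t^{t+1}\|f(s)\|^p\,ds\right)^{1/p}<\infty$. $f$ is Besicovitch-Doss $p$-almost periodic iff all of the following hold: (i) $\|f\|_{\mathcal{M}^p}<\infty$; (ii) $\lim_{\tau\to0}\limsup_{t\to+\infty}\big[\frac{1}{2t}\int_{-t}^{t}\|f(s+\tau)-f(s)\|^p\,ds\big]^{1/p}=0$; (iii) for every $\epsilon>0$ the set of $\tau\in\mathbb{R}$ with $\limsup_{t\to+\infty}\big[\frac{1}{2t}\int_{-t}^{t}\|f(s+\tau)-f(s)\|^p\,ds\big]^{1/p}<\epsilon$ is relatively dense in $\mathbb{R}$ (there is $l>0$ such that every interval of length $l$ contains such a $\tau$); (iv) for every $\lambda\in\mathbb{R}$, $$\lim_{l\to+\infty}\limsup_{t\to+\infty}\frac{1}{l}\Big[\frac{1}{2t}\int_{-t}^{t}\Big\|\Big(\int_x^{x+l}-\int_0^l\Big)e^{i\lambda s}f(s)\,ds\Big\|^p\,dx\Big]^{1/p}=0.$$ The same definitions apply to $Y$-valued functions.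
   Formalization: The formal theorem additionally assumes that t ↦ R(t)x is strongly measurable on (0,∞) for every x in X; without some measurability of R the integral defining G need not exist. *)

theory Defs
  imports "HOL-Analysis.Analysis"
begin

text \<open>Complex Banach spaces are modelled as real Banach spaces (type class banach)
  equipped with a complex structure J (multiplication by the imaginary unit):
  J is real-linear, J (J x) = -x, and the norm is invariant under multiplication by
  unimodular complex numbers cos th + i sin th. Complex scalar multiplication is
  then (a + i b) x = a x + b J x, and the norm is complex-homogeneous.\<close>

definition complex_structure :: "('a::real_normed_vector \<Rightarrow> 'a) \<Rightarrow> bool" where
  "complex_structure J \<longleftrightarrow> linear J \<and> (\<forall>x. J (J x) = - x) \<and>
     (\<forall>th x. norm (cos th *\<^sub>R x + sin th *\<^sub>R J x) = norm x)"

definition scaleJ :: "('a::real_normed_vector \<Rightarrow> 'a) \<Rightarrow> complex \<Rightarrow> 'a \<Rightarrow> 'a" where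
  "scaleJ J c x = Re c *\<^sub>R x + Im c *\<^sub>R J x"

definition bounded_clinear_op ::
  "('a::real_normed_vector \<Rightarrow> 'a) \<Rightarrow> ('b::real_normed_vector \<Rightarrow> 'b) \<Rightarrow> ('a \<Rightarrow> 'b) \<Rightarrow> bool" where
  "bounded_clinear_op JX JY T \<longleftrightarrow> bounded_linear T \<and> (\<forall>x. T (JX x) = JY (T x))"

definition locLp :: "real \<Rightarrow> (real \<Rightarrow> 'a::real_normed_vector) \<Rightarrow> bool" where
  "locLp p f \<longleftrightarrow> f measurable_on UNIV \<and>
     (\<forall>a b. (\<lambda>s. norm (f s) powr p) integrable_on {a..b})"

definition mean_p :: "real \<Rightarrow> (real \<Rightarrow> real) \<Rightarrow> real \<Rightarrow> real" where
  "mean_p p h t = ((1 / (2 * t)) * integral {-t..t} h) powr (1 / p)"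

definition Mp_norm :: "real \<Rightarrow> (real \<Rightarrow> 'a::real_normed_vector) \<Rightarrow> ereal" where
  "Mp_norm p f = Limsup at_top (\<lambda>t. ereal (mean_p p (\<lambda>s. norm (f s) powr p) t))"

definition relatively_dense :: "real set \<Rightarrow> bool" where
  "relatively_dense S \<longleftrightarrow> (\<exists>l>0. \<forall>a. \<exists>\<tau>\<in>S. a \<le> \<tau> \<and> \<tau> \<le> a + l)"

definition stepanov_bounded :: "real \<Rightarrow> (real \<Rightarrow> 'a::real_normed_vector) \<Rightarrow> bool" where
  "stepanov_bounded p f \<longleftrightarrow>
     (\<exists>C. \<forall>t. (integral {t..t+1} (\<lambda>s. norm (f s) powr p)) powr (1 / p) \<le> C)"

definition BD_almost_periodic ::
  "('a::real_normed_vector \<Rightarrow> 'a) \<Rightarrow> real \<Rightarrow> (real \<Rightarrow> 'a) \<Rightarrow> bool" where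
  "BD_almost_periodic J p f \<longleftrightarrow>
     locLp p f \<and>
     Mp_norm p f < \<infinity> \<and>
     ((\<lambda>\<tau>. Mp_norm p (\<lambda>s. f (s + \<tau>) - f s)) \<longlongrightarrow> 0) (at 0) \<and>
     (\<forall>\<epsilon>>0. relatively_dense {\<tau>. Mp_norm p (\<lambda>s. f (s + \<tau>) - f s) < ereal \<epsilon>}) \<and>
     (\<forall>lam::real.
        ((\<lambda>l. Limsup at_top (\<lambda>t. ereal ((1 / l) *
            mean_p p (\<lambda>x. norm (integral {x..x+l} (\<lambda>s. scaleJ J (cis (lam * s)) (f s))
                               - integral {0..l} (\<lambda>s. scaleJ J (cis (lam * s)) (f s))) powr p) t)))
         \<longlongrightarrow> 0) at_top)"

end

theory Submission
  imports Defs
begin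

text \<open>
  Bound the kernel by a scalar weight \<open>\<rho>(r) = M r\<^sup>\<beta>\<^sup>-\<^sup>1 / (1 + r\<^sup>\<gamma>)\<close>. By Young's inequality
  \<open>\<rho> u \<le> \<eta> \<kappa> + C\<^sub>\<eta> \<sigma> u\<^sup>p\<close> with \<open>\<kappa>\<close> integrable and \<open>\<sigma>\<close> summable over unit intervals; this
  single inequality, with \<open>\<eta>\<close> free, replaces all uses of the inequalities of Hoelder and Minkowski.
  It shows that the convolution \<open>G\<close> is bounded, is continuous because translation is
  continuous in local \<open>L\<^sup>p\<close>, and, after averaging over \<open>[-t, t]\<close> and Tonelli, that
  smallness of the Besicovitch mean of \<open>u\<close> passes to every function dominated by \<open>\<rho> * u\<close>.
  Applied to \<open>u = \<parallel>g(\<cdot> + \<tau>) - g\<parallel>\<close> this yields conditions (ii) and (iii). For (iv), the rotated function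
  \<open>h(s) = e\<^sup>i\<^sup>\<lambda>\<^sup>s g(s)\<close> satisfies \<open>e\<^sup>i\<^sup>\<lambda>\<^sup>s G(s) = (R\<^sub>\<lambda> * h)(s)\<close> with \<open>R\<^sub>\<lambda>(r) = R(r) e\<^sup>i\<^sup>\<lambda>\<^sup>r\<close>; window integrals commute
  with the convolution, and the additional hypothesis on \<open>g\<close> replaces the shifted base point
  \<open>-r\<close> of the window of \<open>h\<close> by \<open>0\<close>, up to an error uniform in \<open>r\<close>.

  The Bochner integral of the library requires a second countable range, so integrals of functions with
  values in a Banach space are Henstock-Kurzweil integrals throughout, obtained as
  \<open>L\<^sup>1\<close> limits of integrable functions; only their norms are handled by Lebesgue integration.
\<close>

section \<open>Integration of Banach-valued functions\<close>

text \<open>Two difficulties shape the proof. A Besicovitch mean sees only \<open>[-t, t]\<close>,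
  whereas \<open>\<rho> * u\<close> reads the whole past of \<open>u\<close>. Delays are therefore
  cut at some \<open>n\<close>: those with \<open>r \<le> n\<close> enlarge \<open>[-t, t]\<close>
  by a bounded length, whose mass is negligible after division by \<open>2 * t\<close>, while those
  with \<open>r > n\<close> carry the small weight \<open>A n\<close> and meet only the
  unit-interval bound. This is where Stepanov boundedness enters. Secondly, (iv) involves another
  function \<open>window h l\<close> for every \<open>l\<close>, and (ii), (iii) another translate
  for every \<open>\<tau>\<close>; hence each transfer lemma fixes its threshold from the Stepanov
  bound and the target accuracy before it sees the function, and windows are divided by
  \<open>l\<close> to share one bound for all \<open>l \<ge> 1\<close>. The kernel is only strongly
  measurable: \<open>r \<mapsto> R r x\<close> is measurable for each fixed \<open>x\<close>.
  Integrability of \<open>r \<mapsto> R r (f r)\<close> is built up from constant \<open>f\<close>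
  through step functions and continuous functions to local \<open>L^p\<close>.\<close>

lemma nn_integral_HK_integrable:
  fixes w :: "real \<Rightarrow> real"
  assumes w: "w \<in> borel_measurable lebesgue" "\<And>x. 0 \<le> w x" and S: "S \<in> sets lebesgue"
    and fin: "(\<integral>\<^sup>+x\<in>S. ennreal (w x) \<partial>lebesgue) < \<infinity>"
  shows "w integrable_on S" "ennreal (integral S w) = (\<integral>\<^sup>+x\<in>S. ennreal (w x) \<partial>lebesgue)"
proof -
  define f where "f = (\<lambda>x. if x \<in> S then w x else 0)"
  have f0: "0 \<le> f x" for x
    using w(2) by (simp add: f_def)
  have fm: "f \<in> borel_measurable lebesgue"
    unfolding f_def using w(1) S by (simp add: borel_measurable_if_I)
  have eq: "(\<integral>\<^sup>+x\<in>S. ennreal (w x) \<partial>lebesgue) = (\<integral>\<^sup>+x. ennreal (f x) \<partial>lebesgue)"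
    by (intro nn_integral_cong) (auto simp: f_def)
  obtain r where r: "0 \<le> r" "(\<integral>\<^sup>+x. ennreal (f x) \<partial>lebesgue) = ennreal r"
    using fin eq by (metis ennreal_cases infinity_ennreal_def order_less_irrefl)
  have "(f has_integral r) UNIV"
    by (subst has_integral_iff_nn_integral_lebesgue) (use f0 fm r in auto)
  then have "(w has_integral r) S"
    unfolding f_def by (simp add: has_integral_restrict_UNIV)
  then show "w integrable_on S" "ennreal (integral S w) = (\<integral>\<^sup>+x\<in>S. ennreal (w x) \<partial>lebesgue)"
    using r eq by (auto simp: integrable_on_def integral_unique)
qed

lemma norm_integral_le_nn_integral:
  fixes f :: "real \<Rightarrow> 'a::banach"
  assumes f: "f integrable_on S" and S: "S \<in> sets lebesgue"
    and w: "w \<in> borel_measurable lebesgue" "\<And>x. 0 \<le> w x"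
    and le: "\<And>x. x \<in> S \<Longrightarrow> norm (f x) \<le> w x"
  shows "ennreal (norm (integral S f)) \<le> (\<integral>\<^sup>+x\<in>S. ennreal (w x) \<partial>lebesgue)"
proof (cases "(\<integral>\<^sup>+x\<in>S. ennreal (w x) \<partial>lebesgue) < \<infinity>")
  case True
  note w' = nn_integral_HK_integrable[OF w S True]
  have "norm (integral S f) \<le> integral S w"
    by (rule integral_norm_bound_integral[OF f w'(1) le])
  then show ?thesis
    using w'(2) ennreal_leI by fastforce
next
  case False
  then show ?thesis
    by (simp add: not_less top_unique)
qed

lemma norm_diff_less_quarters:
  fixes x y x' y' :: "'a::real_normed_vector"
  assumes "norm (x - x') < e / 4" "norm (y - y') < e / 4" "norm (x' - y') < e / 4"
  shows "norm (x - y) < e"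
proof -
  have "norm (x - y) \<le> norm (x - x') + norm (x' - y') + norm (y - y')"
    using norm_triangle_ineq4[of "(x - x') + (x' - y')" "y - y'"] norm_triangle_ineq[of "x - x'" "x' - y'"]
    by simp
  moreover have "0 < e / 4"
    using assms(1) norm_ge_zero[of "x - x'"] by linarith
  ultimately show ?thesis
    using assms by linarith
qed

text \<open>On a fine tagged division the Riemann sums of \<open>f\<close> and \<open>u\<close>
  differ by at most the Riemann sum of \<open>h\<close>, which is near its small integral. The
  Cauchy criterion thus passes from \<open>u\<close> to \<open>f\<close>. The bound by
  \<open>h\<close> is asked at every point because any point can be a tag.\<close>

lemma integrable_on_cbox_L1_approx:
  fixes f :: "'n::euclidean_space \<Rightarrow> 'a::banach"
  assumes "\<And>e. e > 0 \<Longrightarrow> \<exists>u h. u integrable_on cbox a b \<and> h integrable_on cbox a b \<and>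
      (\<forall>x\<in>cbox a b. norm (f x - u x) \<le> h x) \<and> integral (cbox a b) h < e"
  shows "f integrable_on cbox a b"
  unfolding integrable_Cauchy
proof (intro allI impI)
  fix e :: real
  assume "e > 0"
  then have e8: "e / 8 > 0" "e / 4 > 0"
    by auto
  obtain u h where u: "u integrable_on cbox a b" and h: "h integrable_on cbox a b"
    and le: "\<And>x. x \<in> cbox a b \<Longrightarrow> norm (f x - u x) \<le> h x" and I: "integral (cbox a b) h < e / 8"
    using assms[OF e8(1)] by blast
  obtain g1 where g1: "gauge g1" and
    u1: "\<And>D1 D2. \<lbrakk>D1 tagged_division_of cbox a b; g1 fine D1; D2 tagged_division_of cbox a b; g1 fine D2\<rbrakk> \<Longrightarrow>
          norm ((\<Sum>(x,K)\<in>D1. measure lborel K *\<^sub>R u x) - (\<Sum>(x,K)\<in>D2. measure lborel K *\<^sub>R u x)) < e / 4"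
    using u[unfolded integrable_Cauchy] e8 by meson
  obtain g2 where g2: "gauge g2" and
    h2: "\<And>D. \<lbrakk>D tagged_division_of cbox a b; g2 fine D\<rbrakk> \<Longrightarrow>
          norm ((\<Sum>(x,K)\<in>D. measure lborel K *\<^sub>R h x) - integral (cbox a b) h) < e / 8"
    using integrable_integral[OF h, unfolded has_integral] e8 by meson
  have diff: "norm ((\<Sum>(x,K)\<in>D. measure lborel K *\<^sub>R f x) - (\<Sum>(x,K)\<in>D. measure lborel K *\<^sub>R u x)) < e / 4"
    if D: "D tagged_division_of cbox a b" "g2 fine D" for D
  proof -
    have "norm ((\<Sum>(x,K)\<in>D. measure lborel K *\<^sub>R f x) - (\<Sum>(x,K)\<in>D. measure lborel K *\<^sub>R u x))
        = norm (\<Sum>(x,K)\<in>D. measure lborel K *\<^sub>R (f x - u x))"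
      by (simp add: sum_subtractf[symmetric] split_def scaleR_diff_right)
    also have "\<dots> \<le> (\<Sum>(x,K)\<in>D. measure lborel K *\<^sub>R h x)"
    proof (rule sum_norm_le, clarify)
      fix x K assume "(x, K) \<in> D"
      then have "x \<in> cbox a b"
        using D(1) by (meson subsetD tagged_division_ofD(2,3))
      then show "norm (measure lborel K *\<^sub>R (f x - u x)) \<le> measure lborel K *\<^sub>R h x"
        using le by (simp add: mult_left_mono)
    qed
    \<comment> \<open>\<open>e / 8\<close> from the gauge of \<open>h\<close> plus
      \<open>e / 8\<close> from its integral.\<close>
    also have "\<dots> < e / 4"
      using h2[OF D] I by (auto simp: abs_if split: if_splits)
    finally show ?thesis .
  qed
  show "\<exists>\<gamma>. gauge \<gamma> \<and> (\<forall>D1 D2. D1 tagged_division_of cbox a b \<and> \<gamma> fine D1 \<and>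
            D2 tagged_division_of cbox a b \<and> \<gamma> fine D2 \<longrightarrow>
            norm ((\<Sum>(x,K)\<in>D1. measure lborel K *\<^sub>R f x) - (\<Sum>(x,K)\<in>D2. measure lborel K *\<^sub>R f x)) < e)"
  proof (intro exI[of _ "\<lambda>x. g1 x \<inter> g2 x"] conjI allI impI)
    show "gauge (\<lambda>x. g1 x \<inter> g2 x)"
      using g1 g2 by (rule gauge_Int)
    fix D1 D2
    assume A: "D1 tagged_division_of cbox a b \<and> (\<lambda>x. g1 x \<inter> g2 x) fine D1 \<and>
            D2 tagged_division_of cbox a b \<and> (\<lambda>x. g1 x \<inter> g2 x) fine D2"
    show "norm ((\<Sum>(x,K)\<in>D1. measure lborel K *\<^sub>R f x) - (\<Sum>(x,K)\<in>D2. measure lborel K *\<^sub>R f x)) < e"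
      by (rule norm_diff_less_quarters[OF diff diff u1]) (use A in \<open>auto simp: fine_Int\<close>)
  qed
qed

text \<open>Beyond the box case, the integrals over large boxes must be Cauchy. As \<open>h\<close>
  is nonnegative, its integral over any box is at most that over the whole space, so the integrals
  of \<open>F\<close> and \<open>u\<close> stay close uniformly in the box.\<close>

lemma integrable_on_L1_approx:
  fixes f :: "'n::euclidean_space \<Rightarrow> 'a::banach"
  assumes approx: "\<And>e. e > 0 \<Longrightarrow> \<exists>u h. u integrable_on S \<and> h integrable_on S \<and>
      (\<forall>x\<in>S. norm (f x - u x) \<le> h x) \<and> integral S h < e"
  shows "f integrable_on S"
proof -
  define F where "F = (\<lambda>x. if x \<in> S then f x else 0)"
  have ap: "\<exists>u h. u integrable_on UNIV \<and> h integrable_on UNIV \<and> (\<forall>x. norm (F x - u x) \<le> h x) \<and> integral UNIV h < e"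
    if e: "e > 0" for e
  proof -
    obtain u h where *: "u integrable_on S" "h integrable_on S"
      "\<forall>x\<in>S. norm (f x - u x) \<le> h x" "integral S h < e"
      using approx[OF e] by blast
    show ?thesis
      using * by (intro exI[of _ "\<lambda>x. if x \<in> S then u x else 0"] exI[of _ "\<lambda>x. if x \<in> S then h x else 0"])
        (auto simp: integrable_restrict_UNIV integral_restrict_UNIV F_def)
  qed
  have le: "integral (cbox a b) h \<le> integral UNIV h"
    if "h integrable_on UNIV" "\<And>x. 0 \<le> h x" for a b and h :: "'n \<Rightarrow> real"
    by (rule integral_subset_le) (use that integrable_on_subcbox[OF that(1)] in auto)
  have box: "F integrable_on cbox a b" for a b
  proof (rule integrable_on_cbox_L1_approx)
    fix e :: real assume "e > 0"
    then obtain u h where uh: "u integrable_on UNIV" "h integrable_on UNIV"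
      "\<And>x. norm (F x - u x) \<le> h x" "integral UNIV h < e"
      using ap by blast
    then have "0 \<le> h x" for x
      using norm_ge_zero order_trans by blast
    then have "integral (cbox a b) h < e"
      using le[of h a b] uh by fastforce
    then show "\<exists>u h. u integrable_on cbox a b \<and> h integrable_on cbox a b \<and>
      (\<forall>x\<in>cbox a b. norm (F x - u x) \<le> h x) \<and> integral (cbox a b) h < e"
      using uh integrable_on_subcbox[OF uh(1) subset_UNIV] integrable_on_subcbox[OF uh(2) subset_UNIV]
      by (intro exI[of _ u] exI[of _ h]) auto
  qed
  have "F integrable_on UNIV"
  proof (subst integrable_alt, simp only: UNIV_I if_True, intro conjI allI impI)
    show "F integrable_on cbox a b" for a b
      by (rule box)
    fix e :: real assume e: "e > 0"
    then obtain u h where uh: "u integrable_on UNIV" "h integrable_on UNIV"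
      "\<And>x. norm (F x - u x) \<le> h x" "integral UNIV h < e / 4"
      using ap[of "e / 4"] by auto
    have h0: "0 \<le> h x" for x
      using uh(3) norm_ge_zero order_trans by blast
    have d: "norm (integral (cbox a b) F - integral (cbox a b) u) < e / 4" for a b
    proof -
      have ui: "u integrable_on cbox a b" "h integrable_on cbox a b"
        using integrable_on_subcbox[OF uh(1) subset_UNIV] integrable_on_subcbox[OF uh(2) subset_UNIV] by auto
      have "norm (integral (cbox a b) F - integral (cbox a b) u) = norm (integral (cbox a b) (\<lambda>x. F x - u x))"
        using box ui by (simp add: integral_diff)
      also have "\<dots> \<le> integral (cbox a b) h"
        by (rule integral_norm_bound_integral) (use ui uh box in \<open>auto intro: integrable_diff\<close>)
      finally show ?thesis
        using le[OF uh(2) h0, of a b] uh(4) by linarith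
    qed
    obtain B where B: "B > 0" "\<And>a b c d. \<lbrakk>ball 0 B \<subseteq> cbox a b; ball 0 B \<subseteq> cbox c d\<rbrakk> \<Longrightarrow>
        norm (integral (cbox a b) u - integral (cbox c d) u) < e / 4"
      using integrable_altD(2)[OF uh(1), of "e / 4"] e by (auto simp: if_P[OF UNIV_I])
    show "\<exists>B>0. \<forall>a b c d. ball 0 B \<subseteq> cbox a b \<and> ball 0 B \<subseteq> cbox c d \<longrightarrow>
        norm (integral (cbox a b) F - integral (cbox c d) F) < e"
      by (intro exI[of _ B] conjI allI impI norm_diff_less_quarters[OF d d] B) auto
  qed
  then show ?thesis
    unfolding F_def by (simp add: integrable_restrict_UNIV)
qed

section \<open>Measurability and approximation in local L^p\<close>

lemma powr_add_le:
  fixes a b p :: real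
  assumes "0 \<le> a" "0 \<le> b" "0 \<le> p"
  shows "(a + b) powr p \<le> 2 powr p * (a powr p + b powr p)"
proof -
  have "(a + b) powr p \<le> (2 * max a b) powr p"
    using assms by (intro powr_mono2) auto
  also have "\<dots> = 2 powr p * max a b powr p"
    using assms by (simp add: powr_mult)
  also have "\<dots> \<le> 2 powr p * (a powr p + b powr p)"
    by (intro mult_left_mono) (auto simp: max_def)
  finally show ?thesis .
qed

lemma measurable_on_norm_borel:
  fixes f :: "real \<Rightarrow> 'a::real_normed_vector"
  assumes "f measurable_on UNIV"
  shows "(\<lambda>x. norm (f x)) \<in> borel_measurable lebesgue"
proof -
  have "(norm \<circ> f) measurable_on UNIV"
    by (rule measurable_on_compose_continuous[OF assms]) (intro continuous_intros)
  then show ?thesis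
    using measurable_on_imp_borel_measurable_lebesgue_UNIV by (fastforce simp: o_def)
qed

lemma null_sets_lebesgue_affine:
  fixes c t :: real
  assumes N: "N \<in> null_sets lebesgue" and c: "c \<noteq> 0"
  shows "{x. t + c * x \<in> N} \<in> null_sets lebesgue"
proof -
  have Ns: "N \<in> sets lebesgue"
    using N by auto
  have "(\<lambda>x. t + c * x) \<in> lebesgue \<rightarrow>\<^sub>M lebesgue"
    using lebesgue_affine_measurable[where c= "\<lambda>x::real. c"] c by simp
  from measurable_sets[OF this Ns] have s: "{x. t + c * x \<in> N} \<in> sets lebesgue"
    by (simp add: vimage_def)
  have "(\<integral>\<^sup>+x. indicator N x \<partial>lebesgue) = ennreal \<bar>c\<bar> * (\<integral>\<^sup>+x. indicator N (t + c * x) \<partial>lebesgue)"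
    by (rule nn_integral_real_affine_lebesgue) (use Ns c in auto)
  moreover have "(\<integral>\<^sup>+x. indicator N (t + c * x) \<partial>lebesgue) = (\<integral>\<^sup>+x. indicator {x. t + c * x \<in> N} x \<partial>lebesgue)"
    by (intro nn_integral_cong) (auto simp: indicator_def)
  ultimately have "emeasure lebesgue {x. t + c * x \<in> N} = 0"
    using N Ns s c by (auto simp: null_sets_def)
  then show ?thesis
    using s by auto
qed

text \<open>\<open>measurable_on\<close> means almost everywhere limit of continuous functions.
  These compose with the affine map, and the exceptional set pulls back to a null set because
  \<open>c \<noteq> 0\<close>.\<close>

lemma measurable_on_affine:
  fixes f :: "real \<Rightarrow> 'a::real_normed_vector"
  assumes "f measurable_on UNIV" "c \<noteq> 0"
  shows "(\<lambda>x. f (t + c * x)) measurable_on UNIV"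
proof -
  obtain N g where N: "negligible N" and g: "\<And>n. continuous_on UNIV (g n)"
    and lim: "\<And>x. x \<notin> N \<Longrightarrow> (\<lambda>n. g n x) \<longlonglongrightarrow> f x"
    using assms(1) by (auto simp: measurable_on_def)
  have "negligible {x. t + c * x \<in> N}"
    using null_sets_lebesgue_affine N assms(2) by (simp add: negligible_iff_null_sets)
  moreover have "continuous_on UNIV (\<lambda>x. g n (t + c * x))" for n
    by (rule continuous_on_compose2[OF g]) (auto intro!: continuous_intros)
  ultimately show ?thesis
    unfolding measurable_on_def using lim
    by (intro exI[of _ "{x. t + c * x \<in> N}"] exI[of _ "\<lambda>n x. g n (t + c * x)"]) auto
qed

lemma measurable_on_reflect: "f measurable_on UNIV \<Longrightarrow> (\<lambda>r::real. f (x - r)) measurable_on UNIV"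
  using measurable_on_affine[of f "-1" x] by simp

lemma measurable_on_shift: "f measurable_on UNIV \<Longrightarrow> (\<lambda>r::real. f (r + x)) measurable_on UNIV"
  using measurable_on_affine[of f 1 x] by (simp add: add.commute)

lemma borel_measurable_times_indicator_lebesgue:
  fixes g :: "real \<Rightarrow> real"
  assumes "g \<in> borel_measurable lebesgue" "S \<in> sets lebesgue"
  shows "(\<lambda>x. ennreal (g x) * indicator S x) \<in> borel_measurable lebesgue"
    "(\<lambda>x. ennreal (g x powr p) * indicator S x) \<in> borel_measurable lebesgue"
proof -
  note assms(1)[measurable]
  show "(\<lambda>x. ennreal (g x) * indicator S x) \<in> borel_measurable lebesgue"
    "(\<lambda>x. ennreal (g x powr p) * indicator S x) \<in> borel_measurable lebesgue"
    using assms(2) by (intro borel_measurable_times_ennreal borel_measurable_indicator; measurable)+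
qed

abbreviation Lp_mass :: "real \<Rightarrow> real set \<Rightarrow> (real \<Rightarrow> 'x::real_normed_vector) \<Rightarrow> ennreal" where
  "Lp_mass p T f \<equiv> \<integral>\<^sup>+x\<in>T. ennreal (norm (f x) powr p) \<partial>lebesgue"

lemma nn_integral_powr_diff_le:
  fixes \<phi> \<psi> :: "real \<Rightarrow> 'a::real_normed_vector"
  assumes m: "\<phi> measurable_on UNIV" "\<psi> measurable_on UNIV" and T: "T \<in> sets lebesgue" and p: "0 \<le> p"
  shows "(\<integral>\<^sup>+x\<in>T. ennreal (norm (\<phi> x - \<psi> x) powr p) \<partial>lebesgue) \<le>
    ennreal (2 powr p) * (Lp_mass p T \<phi> + Lp_mass p T \<psi>)"
proof -
  let ?F = "\<lambda>x. ennreal (norm (\<phi> x) powr p) * indicator T x" and ?G = "\<lambda>x. ennreal (norm (\<psi> x) powr p) * indicator T x"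
  have mF: "?F \<in> borel_measurable lebesgue" and mG: "?G \<in> borel_measurable lebesgue"
    by (intro borel_measurable_times_indicator_lebesgue measurable_on_norm_borel m T)+
  have "(\<integral>\<^sup>+x\<in>T. ennreal (norm (\<phi> x - \<psi> x) powr p) \<partial>lebesgue) \<le> (\<integral>\<^sup>+x. ennreal (2 powr p) * (?F x + ?G x) \<partial>lebesgue)"
  proof (rule nn_integral_mono)
    fix x
    have "norm (\<phi> x - \<psi> x) powr p \<le> (norm (\<phi> x) + norm (\<psi> x)) powr p"
      using p by (intro powr_mono2 norm_triangle_ineq4) auto
    also have "\<dots> \<le> 2 powr p * (norm (\<phi> x) powr p + norm (\<psi> x) powr p)"
      using p by (intro powr_add_le) auto
    finally show "ennreal (norm (\<phi> x - \<psi> x) powr p) * indicator T x \<le> ennreal (2 powr p) * (?F x + ?G x)"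
      by (auto simp: indicator_def ennreal_plus[symmetric] ennreal_mult[symmetric] ennreal_leI simp del: ennreal_plus)
  qed
  also have "\<dots> = ennreal (2 powr p) * ((\<integral>\<^sup>+x. ?F x \<partial>lebesgue) + (\<integral>\<^sup>+x. ?G x \<partial>lebesgue))"
    by (simp only: nn_integral_cmult nn_integral_add mF mG borel_measurable_add)
  finally show ?thesis .
qed

text \<open>\<open>measurable_on\<close> already supplies continuous functions \<open>g k\<close>
  converging to \<open>f\<close> almost everywhere; what they miss is a common majorant. Truncating
  \<open>f\<close> and \<open>g k\<close> to norm at most \<open>n + 1\<close> provides it.
  Dominated convergence is used twice: in \<open>n\<close> with majorant
  \<open>norm (f x) powr p\<close>, then in \<open>k\<close> with a constant majorant on the bounded
  interval.\<close>

lemma Lp_dense_continuous: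
  fixes f :: "real \<Rightarrow> 'a::banach"
  assumes f: "f measurable_on UNIV" and p: "0 < p"
    and fin: "Lp_mass p {a..b} f < \<infinity>" and e: "e > 0"
  shows "\<exists>c. continuous_on UNIV c \<and> (\<integral>\<^sup>+x\<in>{a..b}. ennreal (norm (f x - c x) powr p) \<partial>lebesgue) < ennreal e"
proof -
  obtain N g where N: "negligible N" and g: "\<And>n. continuous_on UNIV (g n)"
    and lim: "\<And>x. x \<notin> N \<Longrightarrow> (\<lambda>n. g n x) \<longlonglongrightarrow> f x"
    using f by (auto simp: measurable_on_def)
  have AEN: "AE x in lebesgue. x \<notin> N"
    using N by (intro AE_not_in) (simp add: negligible_iff_null_sets)
  \<comment> \<open>Radial retraction onto the ball of radius \<open>n + 1\<close>;
    \<open>Suc n\<close> keeps the denominator positive, so the map is continuous.\<close>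
  define T where "T = (\<lambda>n y::'a. (real (Suc n) / max (real (Suc n)) (norm y)) *\<^sub>R y)"
  have T_cont: "continuous_on UNIV (T n)" for n
    unfolding T_def by (intro continuous_intros) (auto simp: max_def)
  have T_norm: "norm (T n y) \<le> real (Suc n)" for n y
  proof -
    have "norm (T n y) = real (Suc n) / max (real (Suc n)) (norm y) * norm y"
      by (simp add: T_def)
    also have "\<dots> \<le> real (Suc n)"
      by (subst times_divide_eq_left, subst pos_divide_le_eq) (auto intro!: mult_left_mono)
    finally show ?thesis .
  qed
  have T_diff: "norm (y - T n y) \<le> norm y" for n y
  proof -
    let ?t = "real (Suc n) / max (real (Suc n)) (norm y)"
    have "y - T n y = (1 - ?t) *\<^sub>R y"
      by (simp add: T_def algebra_simps)
    moreover have "0 \<le> ?t" "?t \<le> 1"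
      by (auto simp: divide_le_eq_1 max_def)
    ultimately show ?thesis
      by (simp add: mult_left_le_one_le)
  qed
  have T_eq: "T n y = y" if "norm y \<le> real (Suc n)" for n y
    using that by (simp add: T_def max_def)
  have Tf: "(\<lambda>x. T n (f x)) measurable_on UNIV" for n
    using measurable_on_compose_continuous[OF f T_cont[of n]] by (simp add: o_def)
  \<comment> \<open>Chosen so that \<open>2 powr p * (e' + e') = e\<close> at the end.\<close>
  define e' where "e' = e / (2 * 2 powr p)"
  have e': "e' > 0"
    using e by (simp add: e'_def)
  have "(\<lambda>n. \<integral>\<^sup>+x\<in>{a..b}. ennreal (norm (f x - T n (f x)) powr p) \<partial>lebesgue) \<longlonglongrightarrow> (\<integral>\<^sup>+x. 0 \<partial>(lebesgue :: real measure))"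
  proof (rule nn_integral_dominated_convergence[OF _ _ _ _ fin])
    show "(\<lambda>x. ennreal (norm (f x - T n (f x)) powr p) * indicator {a..b} x) \<in> borel_measurable lebesgue" for n
      by (rule borel_measurable_times_indicator_lebesgue[OF measurable_on_norm_borel[OF measurable_on_diff[OF f Tf]]]) simp
    show "(\<lambda>x. ennreal (norm (f x) powr p) * indicator {a..b} x) \<in> borel_measurable lebesgue"
      by (rule borel_measurable_times_indicator_lebesgue[OF measurable_on_norm_borel[OF f]]) simp
    show "AE x in lebesgue. ennreal (norm (f x - T n (f x)) powr p) * indicator {a..b} x
           \<le> ennreal (norm (f x) powr p) * indicator {a..b} x" for n
      using p by (intro AE_I2 mult_right_mono ennreal_leI powr_mono2 T_diff) auto
    show "AE x in lebesgue. (\<lambda>n. ennreal (norm (f x - T n (f x)) powr p) * indicator {a..b} x) \<longlonglongrightarrow> 0"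
    proof (intro AE_I2 tendsto_eventually)
      fix x
      obtain n0 where n0: "norm (f x) \<le> real n0"
        using real_arch_simple by blast
      show "\<forall>\<^sub>F n in sequentially. ennreal (norm (f x - T n (f x)) powr p) * indicator {a..b} x = 0"
        using eventually_ge_at_top[of n0]
      proof eventually_elim
        case (elim n)
        then have "T n (f x) = f x"
          using n0 by (intro T_eq) linarith
        then show ?case by simp
      qed
    qed
  qed auto
  then have "\<forall>\<^sub>F n in sequentially. (\<integral>\<^sup>+x\<in>{a..b}. ennreal (norm (f x - T n (f x)) powr p) \<partial>lebesgue) < ennreal e'"
    using e' by (intro order_tendstoD) auto
  then obtain n where n: "(\<integral>\<^sup>+x\<in>{a..b}. ennreal (norm (f x - T n (f x)) powr p) \<partial>lebesgue) < ennreal e'"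
    by (meson eventually_happens' sequentially_bot)
  have Tg: "continuous_on UNIV (\<lambda>x. T n (g k x))" for k
    by (rule continuous_on_compose2[OF T_cont g]) auto
  have "(\<lambda>k. \<integral>\<^sup>+x\<in>{a..b}. ennreal (norm (T n (f x) - T n (g k x)) powr p) \<partial>lebesgue) \<longlonglongrightarrow> (\<integral>\<^sup>+x. 0 \<partial>(lebesgue :: real measure))"
  proof (rule nn_integral_dominated_convergence)
    show "(\<lambda>x. ennreal (norm (T n (f x) - T n (g k x)) powr p) * indicator {a..b} x) \<in> borel_measurable lebesgue" for k
      by (rule borel_measurable_times_indicator_lebesgue[OF measurable_on_norm_borel[OF measurable_on_diff[OF Tf[of n] continuous_imp_measurable_on[OF Tg[of k]]]]]) simp
    show "(\<lambda>x. ennreal ((2 * real (Suc n)) powr p) * indicator {a..b} x) \<in> borel_measurable (lebesgue :: real measure)"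
      by (intro borel_measurable_times_indicator_lebesgue) auto
    show "AE x in lebesgue. ennreal (norm (T n (f x) - T n (g k x)) powr p) * indicator {a..b} x
           \<le> ennreal ((2 * real (Suc n)) powr p) * indicator {a..b} x" for k
    proof (intro AE_I2 mult_right_mono ennreal_leI powr_mono2)
      show "norm (T n (f x) - T n (g k x)) \<le> 2 * real (Suc n)" for x
        by (rule order_trans[OF norm_triangle_ineq4]) (use add_mono[OF T_norm[of n "f x"] T_norm[of n "g k x"]] in simp)
    qed (use p in auto)
    show "(\<integral>\<^sup>+x\<in>{a..b}. ennreal ((2 * real (Suc n)) powr p) \<partial>lebesgue) < \<infinity>"
      by (subst nn_integral_cmult_indicator) (auto simp: ennreal_mult_less_top emeasure_lborel_Icc_eq)
    show "AE x in lebesgue. (\<lambda>k. ennreal (norm (T n (f x) - T n (g k x)) powr p) * indicator {a..b} x) \<longlonglongrightarrow> 0"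
      using AEN
    proof eventually_elim
      case (elim x)
      have "(\<lambda>k. T n (g k x)) \<longlonglongrightarrow> T n (f x)"
        by (rule continuous_on_tendsto_compose[OF T_cont lim[OF elim]]) auto
      then have "(\<lambda>k. norm (T n (f x) - T n (g k x)) powr p) \<longlonglongrightarrow> norm (T n (f x) - T n (f x)) powr p"
        by (intro tendsto_powr2 tendsto_intros) (use p in auto)
      then have "(\<lambda>k. ennreal (norm (T n (f x) - T n (g k x)) powr p)) \<longlonglongrightarrow> ennreal 0"
        using p by (intro tendsto_ennrealI) auto
      then show ?case
        by (cases "x \<in> {a..b}") auto
    qed
  qed auto
  then have "\<forall>\<^sub>F k in sequentially. (\<integral>\<^sup>+x\<in>{a..b}. ennreal (norm (T n (f x) - T n (g k x)) powr p) \<partial>lebesgue) < ennreal e'"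
    using e' by (intro order_tendstoD) auto
  then obtain k where k: "(\<integral>\<^sup>+x\<in>{a..b}. ennreal (norm (T n (f x) - T n (g k x)) powr p) \<partial>lebesgue) < ennreal e'"
    by (meson eventually_happens' sequentially_bot)
  define c where "c = (\<lambda>x. T n (g k x))"
  have cm: "c measurable_on UNIV"
    unfolding c_def by (rule continuous_imp_measurable_on[OF Tg])
  have "(\<integral>\<^sup>+x\<in>{a..b}. ennreal (norm (f x - c x) powr p) \<partial>lebesgue) =
      (\<integral>\<^sup>+x\<in>{a..b}. ennreal (norm ((f x - T n (f x)) - (c x - T n (f x))) powr p) \<partial>lebesgue)"
    by simp
  also have "\<dots> \<le> ennreal (2 powr p) * ((\<integral>\<^sup>+x\<in>{a..b}. ennreal (norm (f x - T n (f x)) powr p) \<partial>lebesgue)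
       + (\<integral>\<^sup>+x\<in>{a..b}. ennreal (norm (c x - T n (f x)) powr p) \<partial>lebesgue))"
    using p by (intro nn_integral_powr_diff_le measurable_on_diff f Tf cm) auto
  also have "(\<integral>\<^sup>+x\<in>{a..b}. ennreal (norm (c x - T n (f x)) powr p) \<partial>lebesgue) = (\<integral>\<^sup>+x\<in>{a..b}. ennreal (norm (T n (f x) - c x) powr p) \<partial>lebesgue)"
    by (simp only: norm_minus_commute)
  also have "ennreal (2 powr p) * ((\<integral>\<^sup>+x\<in>{a..b}. ennreal (norm (f x - T n (f x)) powr p) \<partial>lebesgue) + \<dots>)
      < ennreal (2 powr p) * (ennreal e' + ennreal e')"
    using n k unfolding c_def by (intro ennreal_mult_strict_left_mono add_strict_mono) auto
  also have "\<dots> = ennreal e"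
    using e e' by (simp add: e'_def ennreal_plus[symmetric] ennreal_mult[symmetric] del: ennreal_plus)
  finally show ?thesis
    using Tg unfolding c_def by blast
qed

lemma nn_integral_tail_small:
  fixes w :: "real \<Rightarrow> ennreal"
  assumes w: "w \<in> borel_measurable lebesgue" and fin: "(\<integral>\<^sup>+x. w x \<partial>lebesgue) < \<infinity>" and e: "0 < e"
  shows "\<exists>n::nat. (\<integral>\<^sup>+x\<in>- {- real n..real n}. w x \<partial>lebesgue) < ennreal e"
proof -
  have "(\<lambda>n. \<integral>\<^sup>+x\<in>- {- real n..real n}. w x \<partial>lebesgue) \<longlonglongrightarrow> (\<integral>\<^sup>+x. 0 \<partial>(lebesgue :: real measure))"
  proof (rule nn_integral_dominated_convergence[OF _ _ w _ fin])
    show "(\<lambda>x. w x * indicator (- {- real n..real n}) x) \<in> borel_measurable lebesgue" for n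
      by (intro borel_measurable_times_ennreal borel_measurable_indicator w) auto
    show "AE x in lebesgue. (\<lambda>n. w x * indicator (- {- real n..real n}) x) \<longlonglongrightarrow> 0"
    proof (intro AE_I2 tendsto_eventually)
      fix x :: real
      obtain n0 where n0: "\<bar>x\<bar> \<le> real n0"
        using real_arch_simple by blast
      show "\<forall>\<^sub>F n in sequentially. w x * indicator (- {- real n..real n}) x = 0"
        using eventually_ge_at_top[of n0] by eventually_elim (use n0 in \<open>auto simp: indicator_def abs_le_iff\<close>)
    qed
  qed (auto simp: indicator_def)
  then have "\<forall>\<^sub>F n in sequentially. (\<integral>\<^sup>+x\<in>- {- real n..real n}. w x \<partial>lebesgue) < ennreal e"
    using e by (intro order_tendstoD) auto
  then show ?thesis
    by (meson eventually_happens' sequentially_bot)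
qed

text \<open>Cutting \<open>F\<close> to \<open>[-n, n]\<close> costs the tail of its norm, and on
  that interval \<open>Lp_dense_continuous\<close> with exponent 1 provides a continuous function.
  The function so obtained is integrable and close to \<open>F\<close> in
  \<open>L^1\<close>.\<close>

lemma measurable_bounded_by_integrable_banach:
  fixes f :: "real \<Rightarrow> 'a::banach"
  assumes f: "f measurable_on S" and S: "S \<in> sets lebesgue"
    and w: "w \<in> borel_measurable lebesgue" "\<And>x. 0 \<le> w x"
    and le: "\<And>x. x \<in> S \<Longrightarrow> norm (f x) \<le> w x" and fin: "(\<integral>\<^sup>+x\<in>S. ennreal (w x) \<partial>lebesgue) < \<infinity>"
  shows "f integrable_on S"
proof -
  define F where "F = (\<lambda>x. if x \<in> S then f x else 0)"
  have F: "F measurable_on UNIV"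
    using f unfolding F_def by (simp add: measurable_on_UNIV)
  note Fn = measurable_on_norm_borel[OF F]
  have finF: "(\<integral>\<^sup>+x. ennreal (norm (F x)) \<partial>lebesgue) < \<infinity>"
  proof (rule le_less_trans[OF nn_integral_mono fin])
    show "ennreal (norm (F x)) \<le> ennreal (w x) * indicator S x" for x
      using le by (auto simp: F_def ennreal_leI)
  qed
  have "F integrable_on UNIV"
  proof (rule integrable_on_L1_approx)
    fix e :: real assume e: "e > 0"
    have "(\<lambda>x. ennreal (norm (F x))) \<in> borel_measurable lebesgue"
      using Fn by measurable
    then obtain n :: nat where n: "(\<integral>\<^sup>+x\<in>- {- real n..real n}. ennreal (norm (F x)) \<partial>lebesgue) < ennreal (e / 2)"
      using nn_integral_tail_small[OF _ finF, of "e / 2"] e by auto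
    have "(\<integral>\<^sup>+x\<in>{- real n..real n}. ennreal (norm (F x) powr 1) \<partial>lebesgue) < \<infinity>"
      by (rule le_less_trans[OF nn_integral_mono finF]) (auto simp: indicator_def)
    then obtain c where c: "continuous_on UNIV c"
      "(\<integral>\<^sup>+x\<in>{- real n..real n}. ennreal (norm (F x - c x)) \<partial>lebesgue) < ennreal (e / 2)"
      using Lp_dense_continuous[OF F, of 1 "- real n" "real n" "e / 2"] e by auto
    define u where "u = (\<lambda>x. if x \<in> {- real n..real n} then c x else 0)"
    have "c integrable_on {- real n..real n}"
      by (rule integrable_continuous_interval) (use c continuous_on_subset in blast)
    then have u: "u integrable_on UNIV"
      unfolding u_def by (simp only: integrable_restrict_UNIV)
    have mm: "u measurable_on UNIV"
      unfolding u_def by (rule measurable_on_restrict[OF continuous_imp_measurable_on[OF c(1)]]) auto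
    note Fu = measurable_on_norm_borel[OF measurable_on_diff[OF F mm]]
    have Fc: "(\<lambda>x. norm (F x - c x)) \<in> borel_measurable lebesgue"
      by (rule measurable_on_norm_borel[OF measurable_on_diff[OF F continuous_imp_measurable_on[OF c(1)]]])
    have "(\<integral>\<^sup>+x\<in>UNIV. ennreal (norm (F x - u x)) \<partial>lebesgue) =
      (\<integral>\<^sup>+x. ennreal (norm (F x)) * indicator (- {- real n..real n}) x + ennreal (norm (F x - c x)) * indicator {- real n..real n} x \<partial>lebesgue)"
      by (intro nn_integral_cong) (auto simp: u_def indicator_def)
    also have "\<dots> = (\<integral>\<^sup>+x\<in>- {- real n..real n}. ennreal (norm (F x)) \<partial>lebesgue) + (\<integral>\<^sup>+x\<in>{- real n..real n}. ennreal (norm (F x - c x)) \<partial>lebesgue)"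
      by (intro nn_integral_add) (auto intro!: borel_measurable_times_indicator_lebesgue Fn Fc)
    also have "\<dots> < ennreal (e / 2) + ennreal (e / 2)"
      using n c(2) by (rule add_strict_mono)
    also have "\<dots> = ennreal e"
      using e by (simp add: ennreal_plus[symmetric] del: ennreal_plus)
    finally have lt: "(\<integral>\<^sup>+x\<in>UNIV. ennreal (norm (F x - u x)) \<partial>lebesgue) < ennreal e" .
    note h = nn_integral_HK_integrable[OF Fu, of UNIV, OF _ _ less_trans[OF lt]]
    have "integral UNIV (\<lambda>x. norm (F x - u x)) < e"
      using h(2) lt by (simp flip: ennreal_less_iff[OF integral_nonneg[OF h(1)]])
    then show "\<exists>u h. u integrable_on UNIV \<and> h integrable_on UNIV \<and> (\<forall>x\<in>UNIV. norm (F x - u x) \<le> h x) \<and> integral UNIV h < e"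
      using u h(1) by (intro exI[of _ u] exI[of _ "\<lambda>x. norm (F x - u x)"]) auto
  qed
  then show ?thesis
    unfolding F_def by (simp add: integrable_restrict_UNIV)
qed

section \<open>Changes of variable, Tonelli's theorem, continuity of translation\<close>

lemma nn_integral_lebesgue_shift:
  fixes w :: "real \<Rightarrow> ennreal"
  assumes "w \<in> borel_measurable lebesgue"
  shows "(\<integral>\<^sup>+x. w (x + v) \<partial>lebesgue) = (\<integral>\<^sup>+x. w x \<partial>lebesgue)"
  using nn_integral_real_affine_lebesgue[OF assms, of 1 v] by (simp add: add.commute)

lemma nn_integral_lebesgue_reflect:
  fixes w :: "real \<Rightarrow> ennreal"
  assumes "w \<in> borel_measurable lebesgue"
  shows "(\<integral>\<^sup>+x. w (v - x) \<partial>lebesgue) = (\<integral>\<^sup>+x. w x \<partial>lebesgue)"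
  using nn_integral_real_affine_lebesgue[OF assms, of "-1" v] by simp

lemma borel_measurable_lebesgue_affine:
  assumes "w \<in> borel_measurable lebesgue" "c \<noteq> 0"
  shows "(\<lambda>x::real. w (t + c * x)) \<in> borel_measurable lebesgue"
proof -
  have "(\<lambda>x. t + c * x) \<in> lebesgue \<rightarrow>\<^sub>M lebesgue"
    using lebesgue_affine_measurable[where c= "\<lambda>x::real. c"] assms(2) by simp
  from measurable_compose[OF this assms(1)] show ?thesis .
qed

lemma borel_measurable_lebesgue_shift:
  "w \<in> borel_measurable lebesgue \<Longrightarrow> (\<lambda>x::real. w (x + v)) \<in> borel_measurable lebesgue"
  using borel_measurable_lebesgue_affine[of w 1 v] by (simp add: add.commute)

lemma borel_measurable_lebesgue_reflect:
  "w \<in> borel_measurable lebesgue \<Longrightarrow> (\<lambda>x::real. w (v - x)) \<in> borel_measurable lebesgue"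
  using borel_measurable_lebesgue_affine[of w "-1" v] by simp

text \<open>
  Only an almost everywhere limit of Borel functions is assumed, because \<open>(v, r) \<mapsto> \<parallel>h(v - r) - h(-r)\<parallel>\<close>
  with \<open>h\<close> Lebesgue measurable need not be Borel on the plane; the proof replaces \<open>k\<close> by a \<open>liminf\<close>.
\<close>
lemma nn_integral_Tonelli_AE_limit:
  fixes k :: "real \<Rightarrow> real \<Rightarrow> ennreal" and kn :: "nat \<Rightarrow> real \<Rightarrow> real \<Rightarrow> ennreal"
  assumes meas: "\<And>n. (\<lambda>(x, r). kn n x r) \<in> borel_measurable (borel \<Otimes>\<^sub>M borel)"
    and lim1: "\<And>x. AE r in lebesgue. (\<lambda>n. kn n x r) \<longlonglongrightarrow> k x r"
    and lim2: "AE r in lebesgue. AE x in lebesgue. (\<lambda>n. kn n x r) \<longlonglongrightarrow> k x r"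
  shows "(\<integral>\<^sup>+x. \<integral>\<^sup>+r. k x r \<partial>lebesgue \<partial>lebesgue) = (\<integral>\<^sup>+r. \<integral>\<^sup>+x. k x r \<partial>lebesgue \<partial>lebesgue)"
proof -
  define W where "W = (\<lambda>x r. liminf (\<lambda>n. kn n x r))"
  have "borel_measurable (lborel \<Otimes>\<^sub>M lborel) = (borel_measurable (borel \<Otimes>\<^sub>M borel) :: (real \<times> real \<Rightarrow> ennreal) set)"
    by (intro measurable_cong_sets sets_pair_measure_cong) auto
  then have [measurable]: "(\<lambda>(x, r). kn n x r) \<in> borel_measurable (lborel \<Otimes>\<^sub>M lborel)" for n
    using meas by blast
  have W: "case_prod W \<in> borel_measurable (lborel \<Otimes>\<^sub>M lborel)"
    unfolding W_def by measurable
  have eq: "W x r = k x r" if "(\<lambda>n. kn n x r) \<longlonglongrightarrow> k x r" for x r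
    unfolding W_def using that by (intro lim_imp_Liminf) auto
  have "(\<integral>\<^sup>+x. \<integral>\<^sup>+r. k x r \<partial>lebesgue \<partial>lebesgue) = (\<integral>\<^sup>+x. \<integral>\<^sup>+r. W x r \<partial>lebesgue \<partial>lebesgue)"
  proof (rule nn_integral_cong, rule nn_integral_cong_AE)
    show "AE r in lebesgue. k x r = W x r" for x
      using lim1[of x] by eventually_elim (use eq in auto)
  qed
  also have "\<dots> = (\<integral>\<^sup>+x. \<integral>\<^sup>+r. W x r \<partial>lborel \<partial>lborel)"
    by (simp add: nn_integral_completion)
  also have "\<dots> = (\<integral>\<^sup>+r. \<integral>\<^sup>+x. W x r \<partial>lborel \<partial>lborel)"
    by (rule lborel_pair.Fubini'[OF W, symmetric])
  also have "\<dots> = (\<integral>\<^sup>+r. \<integral>\<^sup>+x. W x r \<partial>lebesgue \<partial>lebesgue)"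
    by (simp add: nn_integral_completion)
  also have "\<dots> = (\<integral>\<^sup>+r. \<integral>\<^sup>+x. k x r \<partial>lebesgue \<partial>lebesgue)"
  proof (rule nn_integral_cong_AE)
    show "AE r in lebesgue. (\<integral>\<^sup>+x. W x r \<partial>lebesgue) = (\<integral>\<^sup>+x. k x r \<partial>lebesgue)"
      using lim2
    proof eventually_elim
      case (elim r)
      then show ?case
        by (intro nn_integral_cong_AE, eventually_elim) (use eq in auto)
    qed
  qed
  finally show ?thesis .
qed

lemma ennreal_pos_real_below:
  assumes "0 < (y::ennreal)"
  shows "\<exists>e>0. ennreal e < y"
proof -
  obtain z where z: "0 < z" "z < y"
    using assms dense by blast
  then have "z < top"
    using less_top_ennreal order.strict_trans2 top_greatest by blast
  then obtain e where "z = ennreal e" "0 \<le> e"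
    by (cases z) auto
  then show ?thesis
    using z by (intro exI[of _ e]) auto
qed

lemma nn_integral_Icc_shift:
  fixes w :: "real \<Rightarrow> ennreal"
  assumes "w \<in> borel_measurable lebesgue"
  shows "(\<integral>\<^sup>+x\<in>{a..b}. w (x + v) \<partial>lebesgue) = (\<integral>\<^sup>+x\<in>{a + v..b + v}. w x \<partial>lebesgue)"
proof -
  have m: "(\<lambda>x. w x * indicator {a + v..b + v} x) \<in> borel_measurable lebesgue"
    by (intro borel_measurable_times_ennreal borel_measurable_indicator assms) simp
  have "(\<integral>\<^sup>+x\<in>{a..b}. w (x + v) \<partial>lebesgue) = (\<integral>\<^sup>+x. w (x + v) * indicator {a + v..b + v} (x + v) \<partial>lebesgue)"
    by (intro nn_integral_cong) (auto simp: indicator_def)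
  also have "\<dots> = (\<integral>\<^sup>+x\<in>{a + v..b + v}. w x \<partial>lebesgue)"
    by (rule nn_integral_lebesgue_shift[OF m])
  finally show ?thesis .
qed

lemma nn_integral_Icc_reflect:
  fixes w :: "real \<Rightarrow> ennreal"
  assumes "w \<in> borel_measurable lebesgue"
  shows "(\<integral>\<^sup>+x\<in>{a..b}. w (v - x) \<partial>lebesgue) = (\<integral>\<^sup>+x\<in>{v - b..v - a}. w x \<partial>lebesgue)"
proof -
  have m: "(\<lambda>x. w x * indicator {v - b..v - a} x) \<in> borel_measurable lebesgue"
    by (intro borel_measurable_times_ennreal borel_measurable_indicator assms) simp
  have "(\<integral>\<^sup>+x\<in>{a..b}. w (v - x) \<partial>lebesgue) = (\<integral>\<^sup>+x. w (v - x) * indicator {v - b..v - a} (v - x) \<partial>lebesgue)"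
    by (intro nn_integral_cong) (auto simp: indicator_def)
  also have "\<dots> = (\<integral>\<^sup>+x\<in>{v - b..v - a}. w x \<partial>lebesgue)"
    by (rule nn_integral_lebesgue_reflect[OF m])
  finally show ?thesis .
qed

text \<open>A continuous \<open>c\<close> close to \<open>f\<close> in \<open>L^p\<close> is
  uniformly continuous on a compact interval. That interval is \<open>[a, b]\<close> enlarged by 1
  on both sides, so that for \<open>v\<close> of modulus below 1 the shifted point
  \<open>x + v\<close> remains where \<open>c\<close> approximates \<open>f\<close>.\<close>

lemma Lp_translation_continuous:
  fixes f :: "real \<Rightarrow> 'a::banach"
  assumes f: "f measurable_on UNIV" and p: "0 < p"
    and fin: "\<And>a b. Lp_mass p {a..b} f < \<infinity>"
  shows "((\<lambda>v. \<integral>\<^sup>+x\<in>{a..b}. ennreal (norm (f (x + v) - f x) powr p) \<partial>lebesgue) \<longlongrightarrow> 0) (at 0)"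
proof (rule order_tendstoI)
  fix y :: ennreal assume "0 < y"
  then obtain e where e: "0 < e" "ennreal e < y"
    using ennreal_pos_real_below by blast
  define e' where "e' = e / (4 * 3 powr p)"
  have e': "e' > 0"
    using e by (simp add: e'_def)
  obtain c where c: "continuous_on UNIV c" and
    ce: "(\<integral>\<^sup>+x\<in>{a - 1..b + 1}. ennreal (norm (f x - c x) powr p) \<partial>lebesgue) < ennreal e'"
    using Lp_dense_continuous[OF f p fin e'] by blast
  \<comment> \<open>The pointwise tolerance whose \<open>p\<close>-th power, integrated over
    \<open>[a, b]\<close>, gives at most \<open>e'\<close>; the summand 1 keeps the divisor positive
    for a degenerate interval.\<close>
  define d where "d = (e' / (\<bar>b - a\<bar> + 1)) powr (1 / p)"
  have d: "d > 0" "d powr p = e' / (\<bar>b - a\<bar> + 1)"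
    using e' p by (auto simp: d_def powr_powr)
  have "uniformly_continuous_on {a - 1..b + 1} c"
    by (rule compact_uniformly_continuous) (use c continuous_on_subset in auto)
  then obtain \<delta> where \<delta>: "\<delta> > 0" "\<And>x x'. \<lbrakk>x \<in> {a - 1..b + 1}; x' \<in> {a - 1..b + 1}; dist x' x < \<delta>\<rbrakk> \<Longrightarrow> dist (c x') (c x) < d"
    unfolding uniformly_continuous_on_def using d(1) by blast
  have fc: "(\<lambda>x. f x - c x) measurable_on UNIV"
    by (rule measurable_on_diff[OF f continuous_imp_measurable_on[OF c]])
  note m = measurable_on_norm_borel[OF fc]
  have small: "(\<integral>\<^sup>+x\<in>{a..b}. ennreal (norm (f (x + v) - f x) powr p) \<partial>lebesgue) < y" if v: "\<bar>v\<bar> < min 1 \<delta>" for v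
  proof -
    let ?A = "\<lambda>x. ennreal (norm (f (x + v) - c (x + v)) powr p) * indicator {a..b} x"
    let ?B = "\<lambda>x. ennreal (norm (f x - c x) powr p) * indicator {a..b} x"
    let ?C = "\<lambda>x. ennreal (d powr p) * indicator {a..b} x"
    have mA: "?A \<in> borel_measurable lebesgue"
      by (rule borel_measurable_times_indicator_lebesgue[OF borel_measurable_lebesgue_shift[OF m]]) simp
    have mB: "?B \<in> borel_measurable lebesgue"
      by (rule borel_measurable_times_indicator_lebesgue[OF m]) simp
    have mC: "?C \<in> borel_measurable lebesgue"
      by (rule borel_measurable_times_indicator_lebesgue) auto
    have "(\<integral>\<^sup>+x\<in>{a..b}. ennreal (norm (f (x + v) - f x) powr p) \<partial>lebesgue) \<le> (\<integral>\<^sup>+x. ennreal (3 powr p) * (?A x + ?B x + ?C x) \<partial>lebesgue)"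
    proof (rule nn_integral_mono)
      fix x
      show "ennreal (norm (f (x + v) - f x) powr p) * indicator {a..b} x \<le> ennreal (3 powr p) * (?A x + ?B x + ?C x)"
      proof (cases "x \<in> {a..b}")
        case True
        let ?s = "norm (f (x + v) - c (x + v))" and ?t = "norm (f x - c x)"
        have "dist (c (x + v)) (c x) < d"
          using True v by (intro \<delta>(2)) (auto simp: dist_real_def)
        then have "norm (c (x + v) - c x) \<le> d"
          by (simp add: dist_norm)
        moreover have "norm (f (x + v) - f x) \<le> ?s + norm (c (x + v) - c x) + ?t"
          using norm_triangle_ineq4[of "(f (x + v) - c (x + v)) + (c (x + v) - c x)" "f x - c x"]
            norm_triangle_ineq[of "f (x + v) - c (x + v)" "c (x + v) - c x"] by simp
        ultimately have "norm (f (x + v) - f x) \<le> 3 * max (max ?s ?t) d"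
          by linarith
        then have "norm (f (x + v) - f x) powr p \<le> (3 * max (max ?s ?t) d) powr p"
          using p by (intro powr_mono2) auto
        also have "\<dots> = 3 powr p * max (max ?s ?t) d powr p"
          using d by (simp add: powr_mult)
        also have "\<dots> \<le> 3 powr p * (?s powr p + ?t powr p + d powr p)"
          by (intro mult_left_mono) (auto simp: max_def)
        finally show ?thesis
          using True by (simp add: ennreal_plus[symmetric] ennreal_mult[symmetric] ennreal_leI del: ennreal_plus)
      qed auto
    qed
    also have "\<dots> = ennreal (3 powr p) * ((\<integral>\<^sup>+x. ?A x \<partial>lebesgue) + (\<integral>\<^sup>+x. ?B x \<partial>lebesgue) + (\<integral>\<^sup>+x. ?C x \<partial>lebesgue))"
      by (simp only: nn_integral_cmult nn_integral_add mA mB mC borel_measurable_add)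
    also have "\<dots> \<le> ennreal (3 powr p) * (ennreal e' + ennreal e' + ennreal e')"
    proof (intro mult_left_mono add_mono)
      have "(\<integral>\<^sup>+x. ?A x \<partial>lebesgue) \<le> (\<integral>\<^sup>+x. ennreal (norm (f (x + v) - c (x + v)) powr p) * indicator {a - 1..b + 1} (x + v) \<partial>lebesgue)"
        using v by (intro nn_integral_mono mult_left_mono) (auto simp: indicator_def)
      also have "\<dots> = (\<integral>\<^sup>+x\<in>{a - 1..b + 1}. ennreal (norm (f x - c x) powr p) \<partial>lebesgue)"
        by (rule nn_integral_lebesgue_shift) (rule borel_measurable_times_indicator_lebesgue[OF m], simp)
      finally show "(\<integral>\<^sup>+x. ?A x \<partial>lebesgue) \<le> ennreal e'"
        using ce by auto
      have "(\<integral>\<^sup>+x. ?B x \<partial>lebesgue) \<le> (\<integral>\<^sup>+x\<in>{a - 1..b + 1}. ennreal (norm (f x - c x) powr p) \<partial>lebesgue)"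
        by (intro nn_integral_mono mult_left_mono) (auto simp: indicator_def)
      then show "(\<integral>\<^sup>+x. ?B x \<partial>lebesgue) \<le> ennreal e'"
        using ce by auto
      have "(\<integral>\<^sup>+x. ?C x \<partial>lebesgue) = ennreal (d powr p) * emeasure lebesgue {a..b}"
        by (intro nn_integral_cmult_indicator) simp
      also have "\<dots> \<le> ennreal (d powr p) * ennreal (\<bar>b - a\<bar> + 1)"
        by (intro mult_left_mono) (auto simp: emeasure_lborel_Icc_eq)
      also have "\<dots> = ennreal e'"
        using e' by (subst ennreal_mult[symmetric]) (auto simp: d(2))
      finally show "(\<integral>\<^sup>+x. ?C x \<partial>lebesgue) \<le> ennreal e'" .
    qed auto
    also have "\<dots> = ennreal (3 powr p * (e' + e' + e'))"
      using e' by (simp add: ennreal_plus[symmetric] ennreal_mult[symmetric] del: ennreal_plus)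
    also have "\<dots> \<le> ennreal e"
      using e by (intro ennreal_leI) (simp add: e'_def field_simps)
    finally show ?thesis
      using e(2) by simp
  qed
  show "\<forall>\<^sub>F v in at 0. (\<integral>\<^sup>+x\<in>{a..b}. ennreal (norm (f (x + v) - f x) powr p) \<partial>lebesgue) < y"
    unfolding eventually_at using small \<delta>(1)
    by (intro exI[of _ "min 1 \<delta>"]) (auto simp: dist_real_def)
qed auto

text \<open>The reflection takes the box \<open>[a, b]\<close> to \<open>[t - b, t - a]\<close>;
  enlarging the radius by \<open>\<bar>t\<bar>\<close> ensures that the reflected box still contains
  the original ball. The lemma converts integrals over delays \<open>r > 0\<close> into integrals
  over times \<open>s < t\<close>.\<close>

lemma has_integral_reflect_UNIV:
  fixes f :: "real \<Rightarrow> 'a::banach"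
  assumes "(f has_integral I) UNIV"
  shows "((\<lambda>x. f (t - x)) has_integral I) UNIV"
  unfolding has_integral'[of _ _ UNIV]
proof (intro allI impI)
  fix e :: real assume "e > 0"
  then obtain B where B: "B > 0" "\<And>a b. ball 0 B \<subseteq> cbox a b \<Longrightarrow>
      \<exists>z. (f has_integral z) (cbox a b) \<and> norm (z - I) < e"
    using assms[unfolded has_integral'[of _ _ UNIV]] by auto
  show "\<exists>B>0. \<forall>a b. ball 0 B \<subseteq> cbox a b \<longrightarrow>
      (\<exists>z. ((\<lambda>x. if x \<in> UNIV then f (t - x) else 0) has_integral z) (cbox a b) \<and> norm (z - I) < e)"
  proof (intro exI[of _ "B + \<bar>t\<bar>"] conjI allI impI)
    show "0 < B + \<bar>t\<bar>"
      using B by simp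
    fix a b :: real assume ab: "ball 0 (B + \<bar>t\<bar>) \<subseteq> cbox a b"
    have "ball 0 B \<subseteq> cbox (t - b) (t - a)"
    proof
      fix x :: real assume "x \<in> ball 0 B"
      then have "t - x \<in> ball 0 (B + \<bar>t\<bar>)"
        by (auto simp: dist_real_def)
      then have "t - x \<in> cbox a b"
        using ab by blast
      then show "x \<in> cbox (t - b) (t - a)"
        by auto
    qed
    then obtain z where z: "(f has_integral z) (cbox (t - b) (t - a))" "norm (z - I) < e"
      using B(2) by blast
    have "((\<lambda>x. f (-1 *\<^sub>R x + t)) has_integral (1 / (\<bar>-1\<bar> ^ DIM(real))) *\<^sub>R z) ((\<lambda>x. (1 / -1) *\<^sub>R x + -((1 / -1) *\<^sub>R t)) ` cbox (t - b) (t - a))"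
      by (rule has_integral_affinity[OF z(1)]) simp
    moreover have "((\<lambda>x. (1 / -1) *\<^sub>R x + -((1 / -1) *\<^sub>R t)) ` cbox (t - b) (t - a)) = cbox a b"
      (is "?h ` _ = _")
    proof -
      have "?h = (\<lambda>x. t - x)"
        by auto
      then show ?thesis
        by (simp add: image_diff_atLeastAtMost)
    qed
    ultimately have "((\<lambda>x. f (t - x)) has_integral z) (cbox a b)"
      by (simp add: algebra_simps)
    then show "\<exists>z. ((\<lambda>x. if x \<in> UNIV then f (t - x) else 0) has_integral z) (cbox a b) \<and> norm (z - I) < e"
      using z(2) by auto
  qed
qed

section \<open>Convolution with a scalar weight\<close>

lemma exists_pos_mult_le:
  fixes c e :: real
  assumes "0 < e" "0 \<le> c"
  shows "\<exists>d>0. c * d \<le> e"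
  using assms by (intro exI[of _ "e / (c + 1)"]) (auto simp: field_simps)

text \<open>A form of the kernel bound in which the conjugate exponent does not occur, so that
  \<open>p = 1\<close> and \<open>p > 1\<close> are treated alike. For the kernel of the theorem,
  \<open>\<sigma> r = 1 / (1 + r powr \<gamma>)\<close>, \<open>a k = \<sigma> (real k)\<close>, and
  \<open>\<kappa> r\<close> is \<open>\<sigma> r\<close> times
  \<open>r powr (q * (\<beta> - 1))\<close>, with exponent 0 if \<open>p = 1\<close>.\<close>

locale conv_weight =
  fixes p :: real and \<rho> \<kappa> \<sigma> :: "real \<Rightarrow> real" and K :: real and a :: "nat \<Rightarrow> real"
  assumes p: "1 \<le> p"
    and \<rho>_meas: "\<rho> \<in> borel_measurable borel" and \<kappa>_meas: "\<kappa> \<in> borel_measurable borel"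
    and \<sigma>_meas: "\<sigma> \<in> borel_measurable borel"
    and \<rho>_nonneg: "\<And>r. 0 \<le> \<rho> r" and \<kappa>_nonneg: "\<And>r. 0 \<le> \<kappa> r" and \<sigma>_nonneg: "\<And>r. 0 \<le> \<sigma> r"
    and K_nonneg: "0 \<le> K" and \<kappa>_int: "(\<integral>\<^sup>+r\<in>{0<..}. ennreal (\<kappa> r) \<partial>lebesgue) \<le> ennreal K"
    and a_nonneg: "\<And>k. 0 \<le> a k" and a_summable: "summable a"
    and \<sigma>_le: "\<And>k r. \<lbrakk>0 < r; real k \<le> r; r \<le> real k + 1\<rbrakk> \<Longrightarrow> \<sigma> r \<le> a k"
    and Young: "\<And>\<eta>. 0 < \<eta> \<Longrightarrow> \<exists>C\<ge>0. \<forall>r>0. \<forall>u\<ge>0. \<rho> r * u \<le> \<eta> * \<kappa> r + C * \<sigma> r * u powr p"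
begin

text \<open>Tail sums: \<open>A n\<close> bounds the total \<open>\<sigma>\<close>-weight of delays
  beyond \<open>n\<close>, and \<open>A 0\<close> also bounds \<open>\<sigma>\<close>
  pointwise.\<close>

definition A :: "nat \<Rightarrow> real" where "A n = (\<Sum>k. a (k + n))"

lemma \<rho>_lebesgue: "\<rho> \<in> borel_measurable lebesgue"
  and \<kappa>_lebesgue: "\<kappa> \<in> borel_measurable lebesgue"
  and \<sigma>_lebesgue: "\<sigma> \<in> borel_measurable lebesgue"
  using \<rho>_meas \<kappa>_meas \<sigma>_meas by (auto intro: measurable_completion)

lemma A_nonneg: "0 \<le> A n"
  unfolding A_def using a_nonneg a_summable by (intro suminf_nonneg) (auto simp: summable_iff_shift)

lemma A_tendsto: "A \<longlonglongrightarrow> 0"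
  unfolding A_def by (rule suminf_exist_split2[OF a_summable])

lemma \<sigma>_le_A: "0 < r \<Longrightarrow> \<sigma> r \<le> A 0"
proof -
  assume r: "0 < r"
  let ?k = "nat \<lfloor>r\<rfloor>"
  have "\<sigma> r \<le> a ?k"
    using r by (intro \<sigma>_le) linarith+
  also have "\<dots> \<le> A 0"
    unfolding A_def using sum_le_suminf[OF a_summable, of "{?k}"] a_nonneg by simp
  finally show ?thesis .
qed

text \<open>On the delay interval \<open>[k + n, k + n + 1]\<close> the weight is at most
  \<open>a (k + n)\<close>, and the reflected interval has length 1, so the mass of \<open>w\<close>
  there is at most \<open>S\<close>. Summing over \<open>k\<close> produces
  \<open>A n\<close>.\<close>

lemma nn_integral_\<sigma>_tail:
  fixes w :: "real \<Rightarrow> ennreal"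
  assumes w: "w \<in> borel_measurable lebesgue" and S: "\<And>t. (\<integral>\<^sup>+x\<in>{t..t+1}. w x \<partial>lebesgue) \<le> S"
  shows "(\<integral>\<^sup>+r\<in>{real n<..}. ennreal (\<sigma> r) * w (x - r) \<partial>lebesgue) \<le> ennreal (A n) * S"
proof -
  note wr = borel_measurable_lebesgue_reflect[OF w, of x]
  have mk: "(\<lambda>r. w (x - r) * indicator {real k..real k + 1} r) \<in> borel_measurable lebesgue" for k
    by (intro borel_measurable_times_ennreal borel_measurable_indicator wr) simp
  have "(\<integral>\<^sup>+r\<in>{real n<..}. ennreal (\<sigma> r) * w (x - r) \<partial>lebesgue)
      \<le> (\<integral>\<^sup>+r. (\<Sum>k. ennreal (a (k + n)) * (w (x - r) * indicator {real (k + n)..real (k + n) + 1} r)) \<partial>lebesgue)"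
  proof (rule nn_integral_mono)
    fix r :: real
    show "ennreal (\<sigma> r) * w (x - r) * indicator {real n<..} r
      \<le> (\<Sum>k. ennreal (a (k + n)) * (w (x - r) * indicator {real (k + n)..real (k + n) + 1} r))"
    proof (cases "r \<in> {real n<..}")
      case True
      define k where "k = nat \<lfloor>r\<rfloor> - n"
      have k: "real (k + n) \<le> r" "r \<le> real (k + n) + 1"
        using True unfolding k_def by (auto simp: le_nat_iff le_floor_iff of_nat_diff)
      have "ennreal (\<sigma> r) * w (x - r) * indicator {real n<..} r \<le>
        ennreal (a (k + n)) * (w (x - r) * indicator {real (k + n)..real (k + n) + 1} r)"
        using k True by (auto intro!: mult_right_mono ennreal_leI \<sigma>_le)
      also have "\<dots> = (\<Sum>j\<in>{k}. ennreal (a (j + n)) * (w (x - r) * indicator {real (j + n)..real (j + n) + 1} r))"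
        by simp
      also have "\<dots> \<le> (\<Sum>k. ennreal (a (k + n)) * (w (x - r) * indicator {real (k + n)..real (k + n) + 1} r))"
        by (intro sum_le_suminf) auto
      finally show ?thesis .
    qed auto
  qed
  also have "\<dots> = (\<Sum>k. ennreal (a (k + n)) * (\<integral>\<^sup>+r. w (x - r) * indicator {real (k + n)..real (k + n) + 1} r \<partial>lebesgue))"
    by (simp only: nn_integral_suminf nn_integral_cmult mk borel_measurable_times_ennreal borel_measurable_const)
  also have "\<dots> \<le> (\<Sum>k. ennreal (a (k + n)) * S)"
  proof (intro suminf_le mult_left_mono)
    fix k
    let ?t = "x - (real (k + n) + 1)"
    have "(\<integral>\<^sup>+r. w (x - r) * indicator {real (k + n)..real (k + n) + 1} r \<partial>lebesgue) = (\<integral>\<^sup>+x\<in>{?t..?t + 1}. w x \<partial>lebesgue)"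
      using nn_integral_Icc_reflect[OF w, where a="real (k + n)" and b="real (k + n) + 1" and v=x] by (simp add: algebra_simps)
    also have "\<dots> \<le> S"
      by (rule S)
    finally show "(\<integral>\<^sup>+r. w (x - r) * indicator {real (k + n)..real (k + n) + 1} r \<partial>lebesgue) \<le> S" .
  qed auto
  also have "\<dots> = (\<Sum>k. ennreal (a (k + n))) * S"
    by (rule ennreal_suminf_multc)
  also have "(\<Sum>k. ennreal (a (k + n))) = ennreal (A n)"
    unfolding A_def using a_nonneg a_summable by (intro suminf_ennreal_eq summable_sums) (auto simp: summable_iff_shift)
  finally show ?thesis .
qed

lemma nn_integral_\<rho>_le:
  assumes C: "\<forall>r>0. \<forall>u\<ge>0. \<rho> r * u \<le> \<eta> * \<kappa> r + C * \<sigma> r * u powr p" "0 \<le> C" "0 \<le> \<eta>"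
    and u: "u \<in> borel_measurable lebesgue" "\<And>r. 0 \<le> u r"
  shows "(\<integral>\<^sup>+r\<in>{0<..}. ennreal (\<rho> r * u r) \<partial>lebesgue) \<le>
     ennreal (\<eta> * K) + ennreal C * (\<integral>\<^sup>+r\<in>{0<..}. ennreal (\<sigma> r) * ennreal (u r powr p) \<partial>lebesgue)"
proof -
  have u': "(\<lambda>r. u r powr p) \<in> borel_measurable lebesgue"
    using u(1) by measurable
  have m: "(\<lambda>r. ennreal (\<kappa> r) * indicator {0<..} r) \<in> borel_measurable lebesgue"
     "(\<lambda>r. ennreal (\<sigma> r) * ennreal (u r powr p) * indicator {0<..} r) \<in> borel_measurable lebesgue"
    using u' \<kappa>_lebesgue \<sigma>_lebesgue by (auto intro!: borel_measurable_times_ennreal borel_measurable_indicator)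
  have "(\<integral>\<^sup>+r\<in>{0<..}. ennreal (\<rho> r * u r) \<partial>lebesgue) \<le>
     (\<integral>\<^sup>+r. ennreal \<eta> * (ennreal (\<kappa> r) * indicator {0<..} r) + ennreal C * (ennreal (\<sigma> r) * ennreal (u r powr p) * indicator {0<..} r) \<partial>lebesgue)"
  proof (rule nn_integral_mono)
    fix r :: real
    show "ennreal (\<rho> r * u r) * indicator {0<..} r \<le>
      ennreal \<eta> * (ennreal (\<kappa> r) * indicator {0<..} r) + ennreal C * (ennreal (\<sigma> r) * ennreal (u r powr p) * indicator {0<..} r)"
      using C u(2) \<kappa>_nonneg \<sigma>_nonneg
      by (cases "0 < r") (auto simp: ennreal_plus[symmetric] ennreal_mult[symmetric] mult.assoc[symmetric] simp del: ennreal_plus intro!: ennreal_leI)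
  qed
  also have "\<dots> = ennreal \<eta> * (\<integral>\<^sup>+r\<in>{0<..}. ennreal (\<kappa> r) \<partial>lebesgue) + ennreal C * (\<integral>\<^sup>+r\<in>{0<..}. ennreal (\<sigma> r) * ennreal (u r powr p) \<partial>lebesgue)"
    by (subst nn_integral_add) (auto intro!: borel_measurable_times_ennreal m simp: nn_integral_cmult[OF m(1)] nn_integral_cmult[OF m(2)])
  also have "\<dots> \<le> ennreal \<eta> * ennreal K + ennreal C * (\<integral>\<^sup>+r\<in>{0<..}. ennreal (\<sigma> r) * ennreal (u r powr p) \<partial>lebesgue)"
    by (intro add_right_mono mult_left_mono \<kappa>_int) auto
  finally show ?thesis
    using C(3) K_nonneg by (simp add: ennreal_mult)
qed

text \<open>\<open>Young\<close> with \<open>\<eta> = 1\<close>. The bound is chosen before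
  \<open>u\<close> and \<open>x\<close>, hence uniform over all functions with the same Stepanov
  bound; the added 1 in the witness keeps it positive.\<close>

lemma nn_integral_\<rho>_bounded:
  "\<exists>B>0. \<forall>u x. u \<in> borel_measurable lebesgue \<longrightarrow> (\<forall>r. 0 \<le> u r) \<longrightarrow>
     (\<forall>t. (\<integral>\<^sup>+x\<in>{t..t+1}. ennreal (u x powr p) \<partial>lebesgue) \<le> ennreal S) \<longrightarrow>
     (\<integral>\<^sup>+r\<in>{0<..}. ennreal (\<rho> r * u (x - r)) \<partial>lebesgue) \<le> ennreal B"
proof -
  obtain C where C: "C \<ge> 0" "\<forall>r>0. \<forall>u\<ge>0. \<rho> r * u \<le> 1 * \<kappa> r + C * \<sigma> r * u powr p"
    using Young[of 1] by auto
  \<comment> \<open>\<open>ennreal\<close> sends negative reals to 0, so \<open>S\<close> may be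
    replaced by its positive part.\<close>
  define S' where "S' = max S 0"
  have S': "ennreal S = ennreal S'" "S' \<ge> 0"
    by (auto simp: S'_def max_def ennreal_neg)
  show ?thesis
  proof (intro exI[of _ "K + C * (A 0 * S') + 1"] conjI allI impI)
    show "0 < K + C * (A 0 * S') + 1"
      using K_nonneg C(1) A_nonneg[of 0] S'(2) by (simp add: add_nonneg_pos)
    fix u :: "real \<Rightarrow> real" and x :: real
    assume u: "u \<in> borel_measurable lebesgue" "\<forall>r. 0 \<le> u r"
      "\<forall>t. (\<integral>\<^sup>+x\<in>{t..t+1}. ennreal (u x powr p) \<partial>lebesgue) \<le> ennreal S"
    have up: "(\<lambda>x. ennreal (u x powr p)) \<in> borel_measurable lebesgue"
      using u(1) by measurable
    have "(\<integral>\<^sup>+r\<in>{0<..}. ennreal (\<rho> r * u (x - r)) \<partial>lebesgue) \<le>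
      ennreal (1 * K) + ennreal C * (\<integral>\<^sup>+r\<in>{0<..}. ennreal (\<sigma> r) * ennreal (u (x - r) powr p) \<partial>lebesgue)"
      by (rule nn_integral_\<rho>_le[OF C(2,1)]) (use u borel_measurable_lebesgue_reflect in auto)
    also have "\<dots> \<le> ennreal (1 * K) + ennreal C * (ennreal (A 0) * ennreal S)"
      using nn_integral_\<sigma>_tail[OF up, of "ennreal S", where n=0 and x=x] u(3) by (intro add_left_mono mult_left_mono) auto
    also have "\<dots> = ennreal (K + C * (A 0 * S'))"
      using S' C(1) A_nonneg[of 0] K_nonneg by (simp add: ennreal_mult)
    also have "\<dots> \<le> ennreal (K + C * (A 0 * S') + 1)"
      by (intro ennreal_leI) simp
    finally show "(\<integral>\<^sup>+r\<in>{0<..}. ennreal (\<rho> r * u (x - r)) \<partial>lebesgue) \<le> ennreal (K + C * (A 0 * S') + 1)" .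
  qed
qed

text \<open>Three errors share \<open>e\<close>, fixed in this order: \<open>\<eta>\<close> against
  \<open>K\<close>; then, with \<open>C\<close> determined by \<open>\<eta>\<close>, a cutoff
  \<open>n\<close> that makes long delays small through \<open>A n\<close>; then \<open>d\<close>
  for delays up to \<open>n\<close>, where translation is continuous in local
  \<open>L^p\<close>.\<close>

lemma nn_integral_\<rho>_translation:
  fixes \<phi> :: "real \<Rightarrow> 'x::banach"
  assumes \<phi>: "\<phi> measurable_on UNIV"
    and S: "\<And>t. Lp_mass p {t..t+1} \<phi> \<le> ennreal S" and S0: "0 \<le> S"
    and fin: "\<And>a b. Lp_mass p {a..b} \<phi> < \<infinity>"
  shows "((\<lambda>v. \<integral>\<^sup>+r\<in>{0<..}. ennreal (\<rho> r * norm (\<phi> (x + v - r) - \<phi> (x - r))) \<partial>lebesgue) \<longlongrightarrow> 0) (at 0)"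
proof (rule order_tendstoI)
  fix y :: ennreal assume "0 < y"
  then obtain e where e: "0 < e" "ennreal e < y"
    using ennreal_pos_real_below by blast
  obtain \<eta> where \<eta>: "\<eta> > 0" "K * \<eta> \<le> e / 3"
    using exists_pos_mult_le[of "e / 3" K] e K_nonneg by auto
  obtain C where C: "C \<ge> 0" "\<forall>r>0. \<forall>u\<ge>0. \<rho> r * u \<le> \<eta> * \<kappa> r + C * \<sigma> r * u powr p"
    using Young[OF \<eta>(1)] by auto
  \<comment> \<open>A Stepanov bound of \<open>\<phi> (s + v) - \<phi> s\<close> that does not
    depend on \<open>v\<close>.\<close>
  define S' where "S' = 2 powr p * (S + S)"
  have S': "S' \<ge> 0"
    using S0 by (simp add: S'_def)
  have "(\<lambda>n. C * (A n * S')) \<longlonglongrightarrow> C * (0 * S')"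
    by (intro tendsto_intros A_tendsto)
  then have "\<forall>\<^sub>F n in sequentially. C * (A n * S') < e / 3"
    using e(1) by (intro order_tendstoD) auto
  then obtain n where n: "C * (A n * S') < e / 3"
    by (meson eventually_happens' sequentially_bot)
  obtain d where d: "d > 0" "(C * A 0) * d \<le> e / 3"
    using exists_pos_mult_le[of "e / 3" "C * A 0"] e C(1) A_nonneg[of 0] by auto
  have p0: "0 < p" using p by simp
  have "\<forall>\<^sub>F v in at 0. (\<integral>\<^sup>+s\<in>{x - real n..x}. ennreal (norm (\<phi> (s + v) - \<phi> s) powr p) \<partial>lebesgue) < ennreal d"
    using Lp_translation_continuous[OF \<phi> p0 fin, where a="x - real n" and b=x] d(1) by (intro order_tendstoD) auto
  then show "\<forall>\<^sub>F v in at 0. (\<integral>\<^sup>+r\<in>{0<..}. ennreal (\<rho> r * norm (\<phi> (x + v - r) - \<phi> (x - r))) \<partial>lebesgue) < y"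
  proof eventually_elim
    case (elim v)
    define u where "u = (\<lambda>s. norm (\<phi> (s + v) - \<phi> s))"
    have u: "u \<in> borel_measurable lebesgue"
      unfolding u_def by (intro measurable_on_norm_borel measurable_on_diff measurable_on_shift \<phi>)
    define w where "w = (\<lambda>s. ennreal (u s powr p))"
    have w: "w \<in> borel_measurable lebesgue"
      unfolding w_def using u by measurable
    have wS: "(\<integral>\<^sup>+s\<in>{t..t+1}. w s \<partial>lebesgue) \<le> ennreal S'" for t
    proof -
      have m: "(\<lambda>s. ennreal (norm (\<phi> s) powr p)) \<in> borel_measurable lebesgue"
      proof -
        note measurable_on_norm_borel[OF \<phi>, measurable]
        show ?thesis by measurable
      qed
      have "(\<integral>\<^sup>+s\<in>{t..t+1}. w s \<partial>lebesgue) \<le>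
         ennreal (2 powr p) * ((\<integral>\<^sup>+s\<in>{t..t+1}. ennreal (norm (\<phi> (s + v)) powr p) \<partial>lebesgue) + Lp_mass p {t..t+1} \<phi>)"
        unfolding w_def u_def using p0 by (intro nn_integral_powr_diff_le measurable_on_shift[OF \<phi>] \<phi>) auto
      also have "(\<integral>\<^sup>+s\<in>{t..t+1}. ennreal (norm (\<phi> (s + v)) powr p) \<partial>lebesgue) = Lp_mass p {t+v..t+v+1} \<phi>"
        using nn_integral_Icc_shift[OF m, where a=t and b="t + 1" and v=v] by (simp add: add.commute add.left_commute)
      also have "ennreal (2 powr p) * (\<dots> + Lp_mass p {t..t+1} \<phi>) \<le> ennreal (2 powr p) * (ennreal S + ennreal S)"
        by (intro mult_left_mono add_mono S) auto
      also have "\<dots> = ennreal S'"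
        using S0 by (simp add: S'_def ennreal_plus[symmetric] ennreal_mult[symmetric] del: ennreal_plus)
      finally show ?thesis .
    qed
    have wr: "(\<lambda>r. w (x - r) * indicator {0..real n} r) \<in> borel_measurable lebesgue"
      by (intro borel_measurable_times_ennreal borel_measurable_indicator borel_measurable_lebesgue_reflect[OF w]) simp
    have wt: "(\<lambda>r. ennreal (\<sigma> r) * w (x - r) * indicator {real n<..} r) \<in> borel_measurable lebesgue"
      using \<sigma>_lebesgue by (intro borel_measurable_times_ennreal borel_measurable_indicator borel_measurable_lebesgue_reflect[OF w]) auto
    have split: "(\<integral>\<^sup>+r\<in>{0<..}. ennreal (\<sigma> r) * w (x - r) \<partial>lebesgue) \<le> ennreal (A 0) * ennreal d + ennreal (A n) * ennreal S'"
    proof -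
      have "(\<integral>\<^sup>+r\<in>{0<..}. ennreal (\<sigma> r) * w (x - r) \<partial>lebesgue) \<le>
        (\<integral>\<^sup>+r. ennreal (A 0) * (w (x - r) * indicator {0..real n} r) + ennreal (\<sigma> r) * w (x - r) * indicator {real n<..} r \<partial>lebesgue)"
      proof (rule nn_integral_mono)
        fix r :: real
        have "0 < r \<Longrightarrow> ennreal (\<sigma> r) * w (x - r) \<le> ennreal (A 0) * w (x - r)"
          by (intro mult_right_mono ennreal_leI \<sigma>_le_A) auto
        then show "ennreal (\<sigma> r) * w (x - r) * indicator {0<..} r \<le> ennreal (A 0) * (w (x - r) * indicator {0..real n} r) + ennreal (\<sigma> r) * w (x - r) * indicator {real n<..} r"
          by (auto simp: indicator_def)
      qed
      also have "\<dots> = ennreal (A 0) * (\<integral>\<^sup>+r. w (x - r) * indicator {0..real n} r \<partial>lebesgue) + (\<integral>\<^sup>+r. ennreal (\<sigma> r) * w (x - r) * indicator {real n<..} r \<partial>lebesgue)"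
        by (simp only: nn_integral_add nn_integral_cmult wr wt borel_measurable_times_ennreal borel_measurable_const)
      also have "(\<integral>\<^sup>+r. w (x - r) * indicator {0..real n} r \<partial>lebesgue) = (\<integral>\<^sup>+r. w (x - r) * indicator {x - real n..x} (x - r) \<partial>lebesgue)"
        by (intro nn_integral_cong) (auto simp: indicator_def)
      also have "\<dots> = (\<integral>\<^sup>+s\<in>{x - real n..x}. w s \<partial>lebesgue)"
        by (rule nn_integral_lebesgue_reflect) (intro borel_measurable_times_ennreal borel_measurable_indicator w, simp)
      also have "ennreal (A 0) * \<dots> + (\<integral>\<^sup>+r. ennreal (\<sigma> r) * w (x - r) * indicator {real n<..} r \<partial>lebesgue) \<le> ennreal (A 0) * ennreal d + ennreal (A n) * ennreal S'"
        using elim nn_integral_\<sigma>_tail[OF w wS, where n=n and x=x] by (intro add_mono mult_left_mono) (auto simp: w_def u_def)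
      finally show ?thesis .
    qed
    have "(\<integral>\<^sup>+r\<in>{0<..}. ennreal (\<rho> r * u (x - r)) \<partial>lebesgue) \<le>
      ennreal (\<eta> * K) + ennreal C * (\<integral>\<^sup>+r\<in>{0<..}. ennreal (\<sigma> r) * ennreal (u (x - r) powr p) \<partial>lebesgue)"
      by (rule nn_integral_\<rho>_le[OF C(2,1)]) (use u \<eta> borel_measurable_lebesgue_reflect in \<open>auto simp: u_def\<close>)
    also have "\<dots> \<le> ennreal (\<eta> * K) + ennreal C * (ennreal (A 0) * ennreal d + ennreal (A n) * ennreal S')"
      using split unfolding w_def by (intro add_left_mono mult_left_mono) auto
    also have "\<dots> = ennreal (K * \<eta> + (C * A 0 * d + C * (A n * S')))"
      using C(1) A_nonneg K_nonneg \<eta>(1) d(1) S' 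
      by (simp add: ennreal_plus[symmetric] ennreal_mult[symmetric] algebra_simps del: ennreal_plus)
    also have "\<dots> \<le> ennreal e"
      using \<eta>(2) d(2) n by (intro ennreal_leI) linarith
    also have "\<dots> < y"
      by (rule e(2))
    finally show ?case
      by (simp add: u_def algebra_simps)
  qed
qed auto

end

section \<open>Besicovitch means of scalar convolutions\<close>

lemma nn_integral_Icc_le_Stepanov:
  fixes w :: "real \<Rightarrow> ennreal"
  assumes w: "w \<in> borel_measurable lebesgue" and S: "\<And>t. (\<integral>\<^sup>+x\<in>{t..t+1}. w x \<partial>lebesgue) \<le> ennreal S"
    and S0: "0 \<le> S" and ab: "a \<le> b"
  shows "(\<integral>\<^sup>+x\<in>{a..b}. w x \<partial>lebesgue) \<le> ennreal ((b - a + 1) * S)"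
proof -
  have m: "(\<lambda>x. w x * indicator {s..t} x) \<in> borel_measurable lebesgue" for s t
    by (intro borel_measurable_times_ennreal borel_measurable_indicator w) simp
  have nat: "(\<integral>\<^sup>+x\<in>{a..a + real n}. w x \<partial>lebesgue) \<le> ennreal (real n * S)" for n
  proof (induction n)
    case 0
    have "AE x in lebesgue. x \<notin> {a}"
      by (intro AE_not_in) (simp add: negligible_iff_null_sets[symmetric])
    then have "AE x in lebesgue. w x * indicator {a..a + real 0} x = 0"
      by eventually_elim auto
    then show ?case
      using nn_integral_0_iff_AE[OF m[of a "a + real 0"]] by simp
  next
    case (Suc n)
    have "(\<integral>\<^sup>+x\<in>{a..a + real (Suc n)}. w x \<partial>lebesgue) \<le>
      (\<integral>\<^sup>+x. w x * indicator {a..a + real n} x + w x * indicator {a + real n..a + real n + 1} x \<partial>lebesgue)"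
      by (intro nn_integral_mono) (auto simp: indicator_def)
    also have "\<dots> = (\<integral>\<^sup>+x\<in>{a..a + real n}. w x \<partial>lebesgue) + (\<integral>\<^sup>+x\<in>{a + real n..a + real n + 1}. w x \<partial>lebesgue)"
      by (rule nn_integral_add[OF m m])
    also have "\<dots> \<le> ennreal (real n * S) + ennreal S"
      by (intro add_mono Suc.IH S)
    also have "\<dots> = ennreal (real (Suc n) * S)"
      using S0 by (simp add: ennreal_plus[symmetric] algebra_simps del: ennreal_plus)
    finally show ?case .
  qed
  define n where "n = nat \<lceil>b - a\<rceil>"
  have n: "b \<le> a + real n" "real n \<le> b - a + 1"
    using ab unfolding n_def by linarith+
  have "(\<integral>\<^sup>+x\<in>{a..b}. w x \<partial>lebesgue) \<le> (\<integral>\<^sup>+x\<in>{a..a + real n}. w x \<partial>lebesgue)"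
    using n(1) by (intro nn_integral_mono mult_left_mono) (auto simp: indicator_def)
  also have "\<dots> \<le> ennreal (real n * S)"
    by (rule nat)
  also have "\<dots> \<le> ennreal ((b - a + 1) * S)"
    using n S0 by (intro ennreal_leI mult_right_mono) auto
  finally show ?thesis .
qed

text \<open>Composing a Lebesgue measurable \<open>w\<close> with
  \<open>(x, r) \<mapsto> x - r\<close> need not give a Borel function on the plane. A change on a
  null set makes \<open>w\<close> Borel, and the exceptional set stays null in either variable for
  every fixed value of the other.\<close>

lemma lebesgue_measurable_Borel_representative:
  fixes w :: "real \<Rightarrow> ennreal"
  assumes w: "w \<in> borel_measurable lebesgue"
  shows "\<exists>w'\<in>borel_measurable borel. (\<forall>x. AE r in lebesgue. w (x - r) = w' (x - r)) \<and> (\<forall>r. AE x in lebesgue. w (x - r) = w' (x - r))"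
proof -
  obtain w' where w': "w' \<in> borel_measurable lborel" and eq: "AE x in lborel. w x = w' x"
    using completion_ex_borel_measurable[OF w] by blast
  have "AE x in lebesgue. w x = w' x"
    using eq by (rule AE_completion)
  then obtain N where N: "N \<in> null_sets lebesgue" "\<And>x. x \<notin> N \<Longrightarrow> w x = w' x"
    by (auto elim!: AE_E3)
  show ?thesis
  proof (intro bexI[of _ w'] conjI allI)
    show "w' \<in> borel_measurable borel"
      using w' by simp
    fix x :: real
    have "AE r in lebesgue. r \<notin> {r. x + (-1) * r \<in> N}"
      by (intro AE_not_in null_sets_lebesgue_affine N(1)) simp
    then show "AE r in lebesgue. w (x - r) = w' (x - r)"
      by eventually_elim (use N(2) in auto)
  next
    fix r :: real
    have "AE x in lebesgue. x \<notin> {x. - r + 1 * x \<in> N}"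
      by (intro AE_not_in null_sets_lebesgue_affine N(1)) simp
    then show "AE x in lebesgue. w (x - r) = w' (x - r)"
      by eventually_elim (use N(2) in auto)
  qed
qed

lemma nn_integral_Tonelli_convolution:
  fixes w f g :: "real \<Rightarrow> ennreal"
  assumes w: "w \<in> borel_measurable lebesgue" and f: "f \<in> borel_measurable borel" and g: "g \<in> borel_measurable borel"
  shows "(\<integral>\<^sup>+x. \<integral>\<^sup>+r. f x * (g r * w (x - r)) \<partial>lebesgue \<partial>lebesgue) = (\<integral>\<^sup>+r. \<integral>\<^sup>+x. f x * (g r * w (x - r)) \<partial>lebesgue \<partial>lebesgue)"
proof -
  obtain w' where w'[measurable]: "w' \<in> borel_measurable borel" and
    AE1: "\<forall>x. AE r in lebesgue. w (x - r) = w' (x - r)" and AE2: "\<forall>r. AE x in lebesgue. w (x - r) = w' (x - r)"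
    using lebesgue_measurable_Borel_representative[OF w] by blast
  note [measurable] = f g
  show ?thesis
  \<comment> \<open>A constant sequence suffices: the Borel representative already agrees with
    \<open>w\<close> almost everywhere.\<close>
  proof (rule nn_integral_Tonelli_AE_limit[where kn="\<lambda>n x r. f x * (g r * w' (x - r))"])
    show "(\<lambda>(x, r). f x * (g r * w' (x - r))) \<in> borel_measurable (borel \<Otimes>\<^sub>M borel)"
      by measurable
    show "AE r in lebesgue. (\<lambda>n. f x * (g r * w' (x - r))) \<longlonglongrightarrow> f x * (g r * w (x - r))" for x
      using AE1[rule_format, of x] by eventually_elim auto
    show "AE r in lebesgue. AE x in lebesgue. (\<lambda>n. f x * (g r * w' (x - r))) \<longlonglongrightarrow> f x * (g r * w (x - r))"
    proof (rule AE_I2)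
      show "AE x in lebesgue. (\<lambda>n. f x * (g r * w' (x - r))) \<longlonglongrightarrow> f x * (g r * w (x - r))" for r
        using AE2[rule_format, of r] by eventually_elim auto
    qed
  qed
qed

lemma borel_measurable_nn_convolution:
  fixes w g :: "real \<Rightarrow> ennreal"
  assumes w: "w \<in> borel_measurable lebesgue" and g: "g \<in> borel_measurable borel"
  shows "(\<lambda>x. \<integral>\<^sup>+r. g r * w (x - r) \<partial>lebesgue) \<in> borel_measurable lebesgue"
proof -
  obtain w' where w'[measurable]: "w' \<in> borel_measurable borel" and
    AE1: "\<forall>x. AE r in lebesgue. w (x - r) = w' (x - r)"
    using lebesgue_measurable_Borel_representative[OF w] by blast
  note [measurable] = g
  have "(\<integral>\<^sup>+r. g r * w (x - r) \<partial>lebesgue) = (\<integral>\<^sup>+r. g r * w' (x - r) \<partial>lborel)" for x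
  proof -
    have "(\<integral>\<^sup>+r. g r * w (x - r) \<partial>lebesgue) = (\<integral>\<^sup>+r. g r * w' (x - r) \<partial>lebesgue)"
      by (rule nn_integral_cong_AE) (use AE1[rule_format, of x] in eventually_elim, auto)
    then show ?thesis
      by (simp add: nn_integral_completion)
  qed
  moreover have "(\<lambda>x. \<integral>\<^sup>+r. g r * w' (x - r) \<partial>lborel) \<in> borel_measurable borel"
  proof (rule lborel.borel_measurable_nn_integral)
    show "(\<lambda>(x, r). g r * w' (x - r)) \<in> borel_measurable (borel \<Otimes>\<^sub>M lborel)"
      by measurable
  qed
  ultimately show ?thesis
    by (simp only: measurable_completion measurable_lborel2)
qed

context conv_weight
begin

text \<open>Tonelli turns the left side into an integral over delays of \<open>\<sigma> r\<close>
  times the mass \<open>J r\<close> of \<open>w\<close> on \<open>[-t - r, t - r]\<close>. For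
  \<open>r \<le> n\<close> this interval lies in \<open>[-t - n, t]\<close>, so \<open>J r\<close>
  exceeds \<open>I\<close> by at most \<open>(n + 1) * S\<close>, which is independent of
  \<open>t\<close>; for \<open>r > n\<close> the crude bound \<open>(2 * t + 1) * S\<close> is
  compensated by \<open>A n\<close>.\<close>

lemma mean_\<sigma>_convolution_le:
  fixes w :: "real \<Rightarrow> ennreal"
  assumes w: "w \<in> borel_measurable lebesgue" and S: "\<And>t. (\<integral>\<^sup>+x\<in>{t..t+1}. w x \<partial>lebesgue) \<le> ennreal S"
    and S0: "0 \<le> S" and t: "0 < t" and I: "(\<integral>\<^sup>+x\<in>{-t..t}. w x \<partial>lebesgue) \<le> ennreal I" "0 \<le> I"
  shows "(\<integral>\<^sup>+x\<in>{-t..t}. (\<integral>\<^sup>+r\<in>{0<..}. ennreal (\<sigma> r) * w (x - r) \<partial>lebesgue) \<partial>lebesgue)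
    \<le> ennreal (A 0 * (I + (real n + 1) * S) + A n * ((2 * t + 1) * S))"
proof -
  have m: "(\<lambda>x. w x * indicator {a..b} x) \<in> borel_measurable lebesgue" for a b
    by (intro borel_measurable_times_ennreal borel_measurable_indicator w) simp
  have m\<sigma>: "(\<lambda>r. ennreal (\<sigma> r) * indicator X r) \<in> borel_measurable lebesgue" if "X \<in> sets lebesgue" for X
    using \<sigma>_lebesgue that by (intro borel_measurable_times_ennreal borel_measurable_indicator) auto
  have \<sigma>_int: "(\<integral>\<^sup>+r. ennreal (\<sigma> r) * indicator {real k<..} r \<partial>lebesgue) \<le> ennreal (A k)" for k
    using nn_integral_\<sigma>_tail[of "\<lambda>_. 1" 1, where n=k] by (simp add: emeasure_lborel_Icc_eq)
  define J where "J = (\<lambda>r. \<integral>\<^sup>+x. indicator {-t..t} x * w (x - r) \<partial>lebesgue)"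
  have J: "J r = (\<integral>\<^sup>+x\<in>{-t-r..t-r}. w x \<partial>lebesgue)" for r
    using nn_integral_Icc_shift[OF w, where a="-t" and b=t and v="-r"] by (simp add: J_def mult.commute)
  have J1: "J r \<le> ennreal (I + (real n + 1) * S)" if r: "0 < r" "r \<le> real n" for r
  proof -
    have "J r \<le> (\<integral>\<^sup>+x. w x * indicator {-t..t} x + w x * indicator {-t - real n..-t} x \<partial>lebesgue)"
      unfolding J using r by (intro nn_integral_mono) (auto simp: indicator_def)
    also have "\<dots> = (\<integral>\<^sup>+x\<in>{-t..t}. w x \<partial>lebesgue) + (\<integral>\<^sup>+x\<in>{-t - real n..-t}. w x \<partial>lebesgue)"
      by (rule nn_integral_add[OF m m])
    also have "\<dots> \<le> ennreal I + ennreal ((real n + 1) * S)"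
      using nn_integral_Icc_le_Stepanov[OF w S S0, of "-t - real n" "-t"] by (intro add_mono I(1)) (simp add: algebra_simps)
    also have "\<dots> = ennreal (I + (real n + 1) * S)"
      using S0 I(2) by (intro ennreal_plus[symmetric]) auto
    finally show ?thesis .
  qed
  have J2: "J r \<le> ennreal ((2 * t + 1) * S)" for r
    using nn_integral_Icc_le_Stepanov[OF w S S0, of "-t - r" "t - r"] t unfolding J by (simp add: algebra_simps)
  let ?f = "\<lambda>x. indicator {-t..t} x :: ennreal" and ?g = "\<lambda>r. ennreal (\<sigma> r) * indicator {0<..} r"
  have "(\<integral>\<^sup>+x\<in>{-t..t}. (\<integral>\<^sup>+r\<in>{0<..}. ennreal (\<sigma> r) * w (x - r) \<partial>lebesgue) \<partial>lebesgue)
      = (\<integral>\<^sup>+x. \<integral>\<^sup>+r. ?f x * (?g r * w (x - r)) \<partial>lebesgue \<partial>lebesgue)"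
  proof (rule nn_integral_cong)
    fix x :: real
    show "(\<integral>\<^sup>+r\<in>{0<..}. ennreal (\<sigma> r) * w (x - r) \<partial>lebesgue) * indicator {-t..t} x = (\<integral>\<^sup>+r. ?f x * (?g r * w (x - r)) \<partial>lebesgue)"
      by (cases "x \<in> {-t..t}") (auto intro!: nn_integral_cong simp: mult_ac)
  qed
  also have "\<dots> = (\<integral>\<^sup>+r. \<integral>\<^sup>+x. ?f x * (?g r * w (x - r)) \<partial>lebesgue \<partial>lebesgue)"
    using \<sigma>_meas by (intro nn_integral_Tonelli_convolution w borel_measurable_times_ennreal borel_measurable_indicator) auto
  also have "\<dots> = (\<integral>\<^sup>+r. ?g r * J r \<partial>lebesgue)"
  proof (rule nn_integral_cong)
    fix r :: real
    have mm: "(\<lambda>x. ?f x * w (x - r)) \<in> borel_measurable lebesgue"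
      using borel_measurable_lebesgue_shift[OF w, of "-r"] by (intro borel_measurable_times_ennreal borel_measurable_indicator) auto
    have "(\<integral>\<^sup>+x. ?f x * (?g r * w (x - r)) \<partial>lebesgue) = (\<integral>\<^sup>+x. ?g r * (?f x * w (x - r)) \<partial>lebesgue)"
      by (simp only: mult_ac)
    then show "(\<integral>\<^sup>+x. ?f x * (?g r * w (x - r)) \<partial>lebesgue) = ?g r * J r"
      unfolding J_def using nn_integral_cmult[OF mm, of "?g r"] by simp
  qed
  also have "\<dots> \<le> (\<integral>\<^sup>+r. ennreal (I + (real n + 1) * S) * (ennreal (\<sigma> r) * indicator {0<..} r) + ennreal ((2 * t + 1) * S) * (ennreal (\<sigma> r) * indicator {real n<..} r) \<partial>lebesgue)"
  proof (rule nn_integral_mono)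
    fix r :: real
    show "?g r * J r \<le> ennreal (I + (real n + 1) * S) * (ennreal (\<sigma> r) * indicator {0<..} r) + ennreal ((2 * t + 1) * S) * (ennreal (\<sigma> r) * indicator {real n<..} r)"
    proof (cases "r \<le> real n")
      case True
      then show ?thesis
        using mult_left_mono[OF J1[of r], of "ennreal (\<sigma> r)"] by (auto simp: indicator_def mult.commute)
    next
      case False
      have "?g r * J r \<le> ennreal ((2 * t + 1) * S) * (ennreal (\<sigma> r) * indicator {real n<..} r)"
        using False mult_left_mono[OF J2[of r], of "ennreal (\<sigma> r)"] by (auto simp: indicator_def mult.commute)
      also have "\<dots> \<le> ennreal (I + (real n + 1) * S) * (ennreal (\<sigma> r) * indicator {0<..} r) + \<dots>"
        by simp
      finally show ?thesis .
    qed
  qed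
  also have "\<dots> = ennreal (I + (real n + 1) * S) * (\<integral>\<^sup>+r. ennreal (\<sigma> r) * indicator {0<..} r \<partial>lebesgue)
      + ennreal ((2 * t + 1) * S) * (\<integral>\<^sup>+r. ennreal (\<sigma> r) * indicator {real n<..} r \<partial>lebesgue)"
  proof -
    have s: "{0<..} \<in> sets (lebesgue :: real measure)" "{real n<..} \<in> sets lebesgue"
      by auto
    show ?thesis
      by (simp only: nn_integral_add nn_integral_cmult m\<sigma> s borel_measurable_times_ennreal borel_measurable_const)
  qed
  also have "\<dots> \<le> ennreal (I + (real n + 1) * S) * ennreal (A 0) + ennreal ((2 * t + 1) * S) * ennreal (A n)"
    using \<sigma>_int[of 0] \<sigma>_int[of n] by (intro add_mono mult_left_mono) auto
  also have "\<dots> = ennreal (A 0 * (I + (real n + 1) * S) + A n * ((2 * t + 1) * S))"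
  proof -
    have nn: "0 \<le> I + (real n + 1) * S" "0 \<le> (2 * t + 1) * S" "0 \<le> A 0" "0 \<le> A n"
      using S0 I(2) t A_nonneg by auto
    then have "ennreal (I + (real n + 1) * S) * ennreal (A 0) + ennreal ((2 * t + 1) * S) * ennreal (A n)
      = ennreal ((I + (real n + 1) * S) * A 0) + ennreal (((2 * t + 1) * S) * A n)"
      by (simp only: ennreal_mult)
    also have "\<dots> = ennreal ((I + (real n + 1) * S) * A 0 + ((2 * t + 1) * S) * A n)"
      using nn by (simp only: ennreal_plus mult_nonneg_nonneg)
    finally show ?thesis
      by (simp only: mult.commute)
  qed
  finally show ?thesis .
qed

text \<open>Since \<open>\<Psi> \<le> B\<close>, one has
  \<open>\<Psi> powr p \<le> B powr (p - 1) * \<Psi>\<close>. The right side is linear in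
  \<open>\<Psi>\<close>, so Young's inequality can be inserted and integrated over
  \<open>[-t, t]\<close>. The threshold \<open>d\<close> depends on \<open>S\<close> and
  \<open>e\<close> only and therefore serves whole families of functions.\<close>

lemma mean_transfer:
  assumes S0: "0 \<le> S" and e: "0 < e"
  shows "\<exists>d>0. \<forall>u \<Psi>. u \<in> borel_measurable lebesgue \<longrightarrow> (\<forall>x. 0 \<le> u x) \<longrightarrow>
     (\<forall>t. (\<integral>\<^sup>+x\<in>{t..t+1}. ennreal (u x powr p) \<partial>lebesgue) \<le> ennreal S) \<longrightarrow>
     \<Psi> \<in> borel_measurable lebesgue \<longrightarrow> (\<forall>x. 0 \<le> \<Psi> x) \<longrightarrow>
     (\<forall>x. ennreal (\<Psi> x) \<le> (\<integral>\<^sup>+r\<in>{0<..}. ennreal (\<rho> r * u (x - r)) \<partial>lebesgue)) \<longrightarrow>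
     (\<forall>\<^sub>F t in at_top. 1 / (2 * t) * integral {-t..t} (\<lambda>x. u x powr p) < d) \<longrightarrow>
     (\<forall>\<^sub>F t in at_top. 1 / (2 * t) * integral {-t..t} (\<lambda>x. \<Psi> x powr p) \<le> e)"
proof -
  obtain B where B: "B > 0" "\<And>u x. \<lbrakk>u \<in> borel_measurable lebesgue; \<forall>r. 0 \<le> u r;
     \<forall>t. (\<integral>\<^sup>+x\<in>{t..t+1}. ennreal (u x powr p) \<partial>lebesgue) \<le> ennreal S\<rbrakk> \<Longrightarrow>
     (\<integral>\<^sup>+r\<in>{0<..}. ennreal (\<rho> r * u (x - r)) \<partial>lebesgue) \<le> ennreal B"
    using nn_integral_\<rho>_bounded[of S] by auto
  define b where "b = B powr (p - 1)"
  have b: "b > 0"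
    using B(1) by (simp add: b_def)
  \<comment> \<open>A quarter of \<open>e\<close> goes to each of the \<open>\<eta>\<close>-term,
    the delays beyond \<open>n\<close>, the mean of \<open>u\<close> through \<open>d\<close>, and
    the boundary term with \<open>(n + 1) * S / (2 * t)\<close>, which is small for large
    \<open>t\<close>.\<close>
  obtain \<eta> where \<eta>: "\<eta> > 0" "(b * K) * \<eta> \<le> e / 4"
    using exists_pos_mult_le[of "e / 4" "b * K"] e b K_nonneg by auto
  obtain C where C: "C \<ge> 0" "\<forall>r>0. \<forall>u\<ge>0. \<rho> r * u \<le> \<eta> * \<kappa> r + C * \<sigma> r * u powr p"
    using Young[OF \<eta>(1)] by auto
  \<comment> \<open>The factor 2 anticipates \<open>(2 * t + 1) / (2 * t) \<le> 2\<close> for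
    \<open>t \<ge> 1\<close>.\<close>
  have "(\<lambda>n. b * (C * (A n * (2 * S)))) \<longlonglongrightarrow> b * (C * (0 * (2 * S)))"
    by (intro tendsto_intros A_tendsto)
  then have "\<forall>\<^sub>F n in sequentially. b * (C * (A n * (2 * S))) < e / 4"
    using e by (intro order_tendstoD) auto
  then obtain n where n: "b * (C * (A n * (2 * S))) < e / 4"
    by (meson eventually_happens' sequentially_bot)
  obtain d where d: "d > 0" "(b * (C * A 0)) * d \<le> e / 4"
    using exists_pos_mult_le[of "e / 4" "b * (C * A 0)"] e b C(1) A_nonneg[of 0] by auto
  have "((\<lambda>t. b * (C * (A 0 * ((real n + 1) * S))) * inverse (2 * t)) \<longlongrightarrow> b * (C * (A 0 * ((real n + 1) * S))) * 0) at_top"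
    by (intro tendsto_mult tendsto_const tendsto_inverse_0_at_top filterlim_tendsto_pos_mult_at_top[OF tendsto_const] filterlim_ident) auto
  then have large: "\<forall>\<^sub>F t in at_top. b * (C * (A 0 * ((real n + 1) * S))) * inverse (2 * t) < e / 4"
    using e by (intro order_tendstoD) auto
  show ?thesis
  proof (intro exI[of _ d] conjI allI impI)
    fix u \<Psi> :: "real \<Rightarrow> real"
    assume u: "u \<in> borel_measurable lebesgue" "\<forall>x. 0 \<le> u x"
      and uS: "\<forall>t. (\<integral>\<^sup>+x\<in>{t..t+1}. ennreal (u x powr p) \<partial>lebesgue) \<le> ennreal S"
      and \<Psi>: "\<Psi> \<in> borel_measurable lebesgue" "\<forall>x. 0 \<le> \<Psi> x"
      and \<Psi>u: "\<forall>x. ennreal (\<Psi> x) \<le> (\<integral>\<^sup>+r\<in>{0<..}. ennreal (\<rho> r * u (x - r)) \<partial>lebesgue)"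
      and ev: "\<forall>\<^sub>F t in at_top. 1 / (2 * t) * integral {-t..t} (\<lambda>x. u x powr p) < d"
    define w where "w = (\<lambda>x. ennreal (u x powr p))"
    have up: "(\<lambda>x. u x powr p) \<in> borel_measurable lebesgue" and \<Psi>p: "(\<lambda>x. \<Psi> x powr p) \<in> borel_measurable lebesgue"
      using u(1) \<Psi>(1) by measurable
    have w: "w \<in> borel_measurable lebesgue"
      unfolding w_def using up by measurable
    have wS: "(\<integral>\<^sup>+x\<in>{t..t+1}. w x \<partial>lebesgue) \<le> ennreal S" for t
      using uS by (simp add: w_def)
    have \<Psi>B: "\<Psi> x \<le> B" for x
    proof -
      have "ennreal (\<Psi> x) \<le> ennreal B"
        using \<Psi>u B(2)[OF u uS, of x] order_trans by blast
      then show ?thesis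
        using B(1) by simp
    qed
    have pw: "ennreal (\<Psi> x powr p) \<le> ennreal (b * (\<eta> * K)) + ennreal (b * C) * (\<integral>\<^sup>+r\<in>{0<..}. ennreal (\<sigma> r) * w (x - r) \<partial>lebesgue)" for x
    proof -
      have "\<Psi> x powr p \<le> b * \<Psi> x"
      proof (cases "\<Psi> x = 0")
        case False
        then have "0 < \<Psi> x"
          using \<Psi>(2) by (simp add: order_less_le)
        then have "\<Psi> x powr p = \<Psi> x powr (p - 1) * \<Psi> x"
          using powr_mult_base[of "\<Psi> x" "p - 1"] by (simp add: mult.commute)
        then show ?thesis
          unfolding b_def using \<open>0 < \<Psi> x\<close> \<Psi>B p by (auto intro!: mult_right_mono powr_mono2)
      qed (use b in auto)
      then have "ennreal (\<Psi> x powr p) \<le> ennreal b * ennreal (\<Psi> x)"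
        using b \<Psi>(2) by (simp add: ennreal_mult[symmetric] ennreal_leI)
      also have "\<dots> \<le> ennreal b * (ennreal (\<eta> * K) + ennreal C * (\<integral>\<^sup>+r\<in>{0<..}. ennreal (\<sigma> r) * ennreal (u (x - r) powr p) \<partial>lebesgue))"
      proof (intro mult_left_mono order_trans[OF \<Psi>u[rule_format]])
        show "(\<integral>\<^sup>+r\<in>{0<..}. ennreal (\<rho> r * u (x - r)) \<partial>lebesgue) \<le> ennreal (\<eta> * K) + ennreal C * (\<integral>\<^sup>+r\<in>{0<..}. ennreal (\<sigma> r) * ennreal (u (x - r) powr p) \<partial>lebesgue)"
          by (rule nn_integral_\<rho>_le[OF C(2,1)]) (use u \<eta> borel_measurable_lebesgue_reflect in auto)
      qed auto
      also have "\<dots> = ennreal (b * (\<eta> * K)) + ennreal (b * C) * (\<integral>\<^sup>+r\<in>{0<..}. ennreal (\<sigma> r) * w (x - r) \<partial>lebesgue)"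
        using b C(1) \<eta>(1) K_nonneg by (simp add: w_def distrib_left ennreal_mult mult.assoc)
      finally show ?thesis .
    qed
    from ev large eventually_ge_at_top[of 1]
    show "\<forall>\<^sub>F t in at_top. 1 / (2 * t) * integral {-t..t} (\<lambda>x. \<Psi> x powr p) \<le> e"
    proof eventually_elim
      case (elim t)
      have t: "t \<ge> 1" "t > 0"
        using elim by auto
      define I where "I = integral {-t..t} (\<lambda>x. u x powr p)"
      have "(\<integral>\<^sup>+x\<in>{-t..t}. w x \<partial>lebesgue) \<le> ennreal ((t - (-t) + 1) * S)"
        using t by (intro nn_integral_Icc_le_Stepanov[OF w wS S0]) auto
      then have fin: "(\<integral>\<^sup>+x\<in>{-t..t}. ennreal (u x powr p) \<partial>lebesgue) < \<infinity>"
        unfolding w_def by (auto intro: le_less_trans)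
      note HK = nn_integral_HK_integrable[OF up _ _ fin]
      have I: "ennreal I = (\<integral>\<^sup>+x\<in>{-t..t}. w x \<partial>lebesgue)" "0 \<le> I"
        unfolding I_def w_def using HK by (auto intro!: integral_nonneg)
      define Q where "Q = A 0 * (I + (real n + 1) * S) + A n * ((2 * t + 1) * S)"
      have Q: "0 \<le> Q"
        unfolding Q_def using S0 I(2) t A_nonneg by (intro add_nonneg_nonneg mult_nonneg_nonneg) auto
      have nQ: "(\<integral>\<^sup>+x\<in>{-t..t}. (\<integral>\<^sup>+r\<in>{0<..}. ennreal (\<sigma> r) * w (x - r) \<partial>lebesgue) \<partial>lebesgue) \<le> ennreal Q"
        unfolding Q_def by (rule mean_\<sigma>_convolution_le[OF w wS S0 t(2)]) (use I in auto)
      have "(\<integral>\<^sup>+x\<in>{-t..t}. ennreal (\<Psi> x powr p) \<partial>lebesgue) \<le> ennreal (b * (\<eta> * K) * (2 * t) + b * C * Q)"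
        (is "?L \<le> _")
      proof -
        define h where "h = (\<lambda>x. \<integral>\<^sup>+r\<in>{0<..}. ennreal (\<sigma> r) * w (x - r) \<partial>lebesgue)"
        have "?L \<le> (\<integral>\<^sup>+x. ennreal (b * (\<eta> * K)) * indicator {-t..t} x + ennreal (b * C) * (h x * indicator {-t..t} x) \<partial>lebesgue)"
          using pw by (intro nn_integral_mono) (auto simp: indicator_def h_def)
        also have "\<dots> \<le> ennreal (b * (\<eta> * K) * (2 * t)) + ennreal (b * C) * (\<integral>\<^sup>+x\<in>{-t..t}. h x \<partial>lebesgue)"
        proof -
          have "(\<lambda>r. ennreal (\<sigma> r) * indicator {0<..} r) \<in> borel_measurable borel"
            using \<sigma>_meas by (intro borel_measurable_times_ennreal borel_measurable_indicator) auto
          from borel_measurable_nn_convolution[OF w this]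
          have "h \<in> borel_measurable lebesgue"
            unfolding h_def by (simp only: mult_ac)
          then have mh: "(\<lambda>x. h x * indicator {-t..t} x) \<in> borel_measurable lebesgue"
            by (intro borel_measurable_times_ennreal borel_measurable_indicator) auto
          have mi: "(\<lambda>x::real. ennreal (b * (\<eta> * K)) * indicator {-t..t} x) \<in> borel_measurable lebesgue"
            by (intro borel_measurable_times_ennreal borel_measurable_indicator) auto
          have "(\<integral>\<^sup>+x. ennreal (b * (\<eta> * K)) * indicator {-t..t} x \<partial>lebesgue) = ennreal (b * (\<eta> * K)) * ennreal (2 * t)"
            using t by (subst nn_integral_cmult_indicator) auto
          also have "\<dots> = ennreal (b * (\<eta> * K) * (2 * t))"
            using b \<eta>(1) K_nonneg t by (simp add: ennreal_mult)
          finally have c: "(\<integral>\<^sup>+x. ennreal (b * (\<eta> * K)) * indicator {-t..t} x \<partial>lebesgue) = ennreal (b * (\<eta> * K) * (2 * t))" .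
          show ?thesis
            by (simp only: nn_integral_add nn_integral_cmult mh mi c borel_measurable_times_ennreal borel_measurable_const order_refl)
        qed
        also have "\<dots> \<le> ennreal (b * (\<eta> * K) * (2 * t)) + ennreal (b * C) * ennreal Q"
          using nQ unfolding h_def by (intro add_left_mono mult_left_mono) auto
        also have "\<dots> = ennreal (b * (\<eta> * K) * (2 * t) + b * C * Q)"
          using b C(1) \<eta>(1) K_nonneg Q t by (simp add: ennreal_plus[symmetric] ennreal_mult[symmetric] del: ennreal_plus)
        finally show ?thesis .
      qed
      note L = this
      then have finL: "?L < \<infinity>"
        by (auto intro: le_less_trans)
      have "ennreal (integral {-t..t} (\<lambda>x. \<Psi> x powr p)) \<le> ennreal (b * (\<eta> * K) * (2 * t) + b * C * Q)"
        using nn_integral_HK_integrable(2)[OF \<Psi>p _ _ finL] L by simp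
      then have "integral {-t..t} (\<lambda>x. \<Psi> x powr p) \<le> b * (\<eta> * K) * (2 * t) + b * C * Q"
        using b C(1) \<eta>(1) K_nonneg Q t by (subst (asm) ennreal_le_iff) auto
      then have "1 / (2 * t) * integral {-t..t} (\<lambda>x. \<Psi> x powr p) \<le> 1 / (2 * t) * (b * (\<eta> * K) * (2 * t) + b * C * Q)"
        using t by (intro mult_left_mono) auto
      also have "\<dots> = b * K * \<eta> + b * (C * A 0) * (1 / (2 * t) * I) + b * (C * (A 0 * ((real n + 1) * S))) * inverse (2 * t)
          + b * (C * (A n * ((2 * t + 1) / (2 * t) * S)))"
        using t unfolding Q_def by (simp add: field_simps)
      also have "\<dots> \<le> e / 4 + e / 4 + e / 4 + e / 4"
      proof (intro add_mono)
        have "b * (C * A 0) * (1 / (2 * t) * I) \<le> b * (C * A 0) * d"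
          using elim(1) b C(1) A_nonneg[of 0] unfolding I_def by (intro mult_left_mono) auto
        then show "b * (C * A 0) * (1 / (2 * t) * I) \<le> e / 4"
          using d(2) by linarith
        have "(2 * t + 1) / (2 * t) \<le> 2"
          using t by (simp add: field_simps)
        then have "b * (C * (A n * ((2 * t + 1) / (2 * t) * S))) \<le> b * (C * (A n * (2 * S)))"
          using b C(1) A_nonneg[of n] S0 by (intro mult_left_mono mult_right_mono) auto
        then show "b * (C * (A n * ((2 * t + 1) / (2 * t) * S))) \<le> e / 4"
          using n by linarith
      qed (use \<eta>(2) elim(2) in auto)
      finally show ?case by simp
    qed
  qed (use d in auto)
qed

end

section \<open>Convolution with an operator-valued kernel\<close>

locale conv_operator = conv_weight +
  fixes R :: "real \<Rightarrow> 'a::banach \<Rightarrow> 'b::banach"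
  assumes R_lin: "\<And>r. 0 < r \<Longrightarrow> bounded_linear (R r)"
    and R_norm: "\<And>r x. 0 < r \<Longrightarrow> norm (R r x) \<le> \<rho> r * norm x"
    and R_meas: "\<And>x. (\<lambda>r. R r x) measurable_on {0<..}"
begin

text \<open>Unlike \<open>stepanov_bounded\<close>, this names the bound, which is on the
  \<open>p\<close>-th power, and includes measurability. It depends on \<open>p\<close> but not on
  the kernel, so one fact serves \<open>R\<close> and its rotations.\<close>

definition stepanov :: "real \<Rightarrow> (real \<Rightarrow> 'x::real_normed_vector) \<Rightarrow> bool" where
  "stepanov S \<phi> \<longleftrightarrow> \<phi> measurable_on UNIV \<and> 0 \<le> S \<and>
     (\<forall>t. Lp_mass p {t..t+1} \<phi> \<le> ennreal S)"

text \<open>Local \<open>L^p\<close> membership permits approximation by continuous functions on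
  bounded delay intervals; finiteness of the weighted integral controls the remaining tail.\<close>

definition admissible :: "(real \<Rightarrow> 'a) \<Rightarrow> bool" where
  "admissible f \<longleftrightarrow> f measurable_on UNIV \<and>
     (\<forall>a b. Lp_mass p {a..b} f < \<infinity>) \<and>
     (\<integral>\<^sup>+r\<in>{0<..}. ennreal (\<rho> r * norm (f r)) \<partial>lebesgue) < \<infinity>"

lemma \<rho>_finite: "(\<integral>\<^sup>+r\<in>{0<..}. ennreal (\<rho> r) \<partial>lebesgue) < \<infinity>"
proof -
  obtain B where B: "\<And>u x. u \<in> borel_measurable lebesgue \<Longrightarrow> (\<forall>r. 0 \<le> u r) \<Longrightarrow>
     (\<forall>t. (\<integral>\<^sup>+x\<in>{t..t+1}. ennreal (u x powr p) \<partial>lebesgue) \<le> ennreal 1) \<Longrightarrow>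
     (\<integral>\<^sup>+r\<in>{0<..}. ennreal (\<rho> r * u (x - r)) \<partial>lebesgue) \<le> ennreal B"
    using nn_integral_\<rho>_bounded[of 1] by blast
  have "(\<integral>\<^sup>+r\<in>{0<..}. ennreal (\<rho> r) \<partial>lebesgue) \<le> ennreal B"
    using B[of "\<lambda>_. 1" 0] by (simp add: emeasure_lborel_Icc_eq)
  then show ?thesis
    by (auto intro: le_less_trans)
qed

lemma R_const_integrable:
  assumes "T \<in> sets lebesgue"
  shows "(\<lambda>r. if r \<in> T then R r x else 0) integrable_on {0<..}"
proof (rule measurable_bounded_by_integrable_banach)
  have "(\<lambda>r. if r \<in> T then (if r \<in> {0<..} then R r x else 0) else 0) measurable_on UNIV"
    using R_meas[of x] assms by (intro measurable_on_restrict[of _ T]) (simp_all only: measurable_on_UNIV)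
  moreover have "(\<lambda>r. if r \<in> T then (if r \<in> {0<..} then R r x else 0) else 0) = (\<lambda>r. if r \<in> {0<..} then (if r \<in> T then R r x else 0) else 0)"
    by auto
  ultimately show "(\<lambda>r. if r \<in> T then R r x else 0) measurable_on {0<..}"
    by (simp only: measurable_on_UNIV)
  show m: "(\<lambda>r. norm x * \<rho> r) \<in> borel_measurable lebesgue"
    using \<rho>_lebesgue by measurable
  have "(\<integral>\<^sup>+r\<in>{0<..}. ennreal (norm x * \<rho> r) \<partial>lebesgue) = ennreal (norm x) * (\<integral>\<^sup>+r\<in>{0<..}. ennreal (\<rho> r) \<partial>lebesgue)"
    using borel_measurable_times_indicator_lebesgue[OF \<rho>_lebesgue, of "{0<..}"] \<rho>_nonneg
    by (subst nn_integral_cmult[symmetric]) (auto simp: ennreal_mult mult.assoc)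
  also have "\<dots> < \<infinity>"
    using \<rho>_finite by (simp add: ennreal_mult_less_top)
  finally show "(\<integral>\<^sup>+r\<in>{0<..}. ennreal (norm x * \<rho> r) \<partial>lebesgue) < \<infinity>" .
  show "norm (if r \<in> T then R r x else 0) \<le> norm x * \<rho> r" if "r \<in> {0<..}" for r
    using R_norm[of r x] that \<rho>_nonneg by (auto simp: mult.commute)
qed (use \<rho>_nonneg in auto)

lemma R_diff: "0 < r \<Longrightarrow> R r (x - y) = R r x - R r y"
  using R_lin linear_diff bounded_linear.linear by blast

text \<open>Measurability is known only for \<open>r \<mapsto> R r x\<close> with \<open>x\<close>
  fixed. Freezing \<open>c\<close> at the left end of each cell of a grid of width
  \<open>\<tau>\<close> gives a finite sum of such terms, and uniform continuity on
  \<open>[0, n]\<close> bounds the error by \<open>d * \<rho> r\<close>.\<close>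

lemma R_continuous_integrable:
  assumes c: "continuous_on UNIV c"
  shows "(\<lambda>r. if r \<le> real n then R r (c r) else 0) integrable_on {0<..}"
proof (rule integrable_on_L1_approx)
  fix e :: real assume e: "0 < e"
  obtain P where P: "(\<integral>\<^sup>+r\<in>{0<..}. ennreal (\<rho> r) \<partial>lebesgue) = ennreal P" "0 \<le> P"
    using \<rho>_finite by (cases "\<integral>\<^sup>+r\<in>{0<..}. ennreal (\<rho> r) \<partial>lebesgue") auto
  note \<rho>_HK = nn_integral_HK_integrable[OF \<rho>_lebesgue \<rho>_nonneg _ \<rho>_finite]
  have P': "integral {0<..} \<rho> = P"
    using \<rho>_HK P \<rho>_nonneg by (simp add: integral_nonneg)
  define d where "d = e / (P + 1)"
  have d: "0 < d" "d * P < e"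
    using e P(2) by (auto simp: d_def field_simps)
  have "uniformly_continuous_on {0..real n} c"
    by (rule compact_uniformly_continuous) (use c continuous_on_subset in auto)
  then obtain \<delta> where \<delta>: "\<delta> > 0" "\<And>x x'. \<lbrakk>x \<in> {0..real n}; x' \<in> {0..real n}; dist x' x < \<delta>\<rbrakk> \<Longrightarrow> dist (c x') (c x) < d"
    unfolding uniformly_continuous_on_def using d(1) by blast
  define \<tau> where "\<tau> = \<delta> / 2"
  have \<tau>: "0 < \<tau>" "\<tau> < \<delta>"
    using \<delta>(1) by (auto simp: \<tau>_def)
  \<comment> \<open>Index of the grid cell containing \<open>r\<close>. Truncation by
    \<open>nat\<close> at negative \<open>r\<close> is harmless, since only \<open>r > 0\<close> is
    integrated.\<close>
  define k where "k = (\<lambda>r. nat \<lfloor>r / \<tau>\<rfloor>)"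
  define T where "T = (\<lambda>j. {r. k r = j \<and> r \<le> real n})"
  have T: "T j \<in> sets lebesgue" for j
  proof -
    have "T j \<in> sets borel"
      unfolding T_def k_def by measurable
    then show ?thesis by auto
  qed
  define u where "u = (\<lambda>r. \<Sum>j\<le>k (real n). if r \<in> T j then R r (c (\<tau> * real j)) else 0)"
  have u_eq: "u r = (if r \<le> real n then R r (c (\<tau> * real (k r))) else 0)" if "0 < r" for r
  proof (cases "r \<le> real n")
    case True
    then have "k r \<le> k (real n)"
      using \<tau>(1) unfolding k_def by (intro nat_mono floor_mono divide_right_mono) auto
    moreover have "u r = (\<Sum>j\<le>k (real n). if k r = j then R r (c (\<tau> * real j)) else 0)"
      using True unfolding u_def by (intro sum.cong) (auto simp: T_def)
    ultimately show ?thesis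
      using True by simp
  qed (auto simp: u_def T_def)
  have "u integrable_on {0<..}"
    unfolding u_def by (intro integrable_sum R_const_integrable T) auto
  moreover have "(\<lambda>r. d * \<rho> r) integrable_on {0<..}"
    using \<rho>_HK(1) by (intro integrable_on_mult_right) auto
  moreover have "norm ((if r \<le> real n then R r (c r) else 0) - u r) \<le> d * \<rho> r" if r: "r \<in> {0<..}" for r
  proof (cases "r \<le> real n")
    case True
    have "real (k r) \<le> r / \<tau>" "r / \<tau> < real (k r) + 1"
      using r \<tau>(1) unfolding k_def by (auto simp: of_nat_nat)
    then have k2: "\<tau> * real (k r) \<le> r" "r < \<tau> * real (k r) + \<tau>"
      using \<tau>(1) by (auto simp: field_simps)
    have "dist (c r) (c (\<tau> * real (k r))) < d"
      by (rule \<delta>(2)) (use k2 \<tau> True r in \<open>auto simp: dist_real_def\<close>)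
    then have "norm (c r - c (\<tau> * real (k r))) \<le> d"
      by (simp add: dist_norm)
    then have "norm (R r (c r - c (\<tau> * real (k r)))) \<le> \<rho> r * d"
      using R_norm[of r "c r - c (\<tau> * real (k r))"] r \<rho>_nonneg[of r] by (meson greaterThan_iff mult_left_mono order_trans)
    then show ?thesis
      using True r u_eq[of r] R_diff[of r] by (simp add: mult.commute)
  qed (use r u_eq[of r] d \<rho>_nonneg in auto)
  moreover have "integral {0<..} (\<lambda>r. d * \<rho> r) < e"
    using d P' by simp
  ultimately show "\<exists>u h. u integrable_on {0<..} \<and> h integrable_on {0<..} \<and>
      (\<forall>r\<in>{0<..}. norm ((if r \<le> real n then R r (c r) else 0) - u r) \<le> h r) \<and> integral {0<..} h < e"
    by (intro exI[of _ u] exI[of _ "\<lambda>r. d * \<rho> r"]) auto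
qed

text \<open>The approximant is \<open>R r (c r)\<close>, cut off beyond \<open>n\<close>. On
  \<open>(0, n]\<close> Young's inequality turns closeness of \<open>c\<close> to \<open>f\<close>
  in \<open>L^p\<close> into smallness in the \<open>\<rho>\<close>-weighted \<open>L^1\<close>
  norm, at the cost \<open>\<eta> * K + C * A 0 * d\<close>; beyond \<open>n\<close> the error is
  the tail of \<open>\<rho> r * norm (f r)\<close>.\<close>

lemma admissible_integrable:
  assumes "admissible f"
  shows "(\<lambda>r. R r (f r)) integrable_on {0<..}"
proof (rule integrable_on_L1_approx)
  have f: "f measurable_on UNIV" and floc: "\<And>a b. Lp_mass p {a..b} f < \<infinity>"
    and ffin: "(\<integral>\<^sup>+r\<in>{0<..}. ennreal (\<rho> r * norm (f r)) \<partial>lebesgue) < \<infinity>"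
    using assms by (auto simp: admissible_def)
  have p0: "0 < p" using p by simp
  fix e :: real assume e: "0 < e"
  have m\<rho>f: "(\<lambda>r. \<rho> r * norm (f r)) \<in> borel_measurable lebesgue"
    using \<rho>_lebesgue measurable_on_norm_borel[OF f] by measurable
  obtain n :: nat where "(\<integral>\<^sup>+r\<in>- {- real n..real n}. ennreal (\<rho> r * norm (f r)) * indicator {0<..} r \<partial>lebesgue) < ennreal (e / 4)"
    using nn_integral_tail_small[OF borel_measurable_times_indicator_lebesgue(1)[OF m\<rho>f] ffin, of "e / 4"] e by auto
  moreover have "(\<integral>\<^sup>+r\<in>- {- real n..real n}. ennreal (\<rho> r * norm (f r)) * indicator {0<..} r \<partial>lebesgue) = (\<integral>\<^sup>+r\<in>{real n<..}. ennreal (\<rho> r * norm (f r)) \<partial>lebesgue)"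
    by (intro nn_integral_cong) (auto simp: indicator_def)
  ultimately have n: "(\<integral>\<^sup>+r\<in>{real n<..}. ennreal (\<rho> r * norm (f r)) \<partial>lebesgue) < ennreal (e / 4)"
    by simp
  obtain \<eta> where \<eta>: "\<eta> > 0" "K * \<eta> \<le> e / 4"
    using exists_pos_mult_le[of "e / 4" K] e K_nonneg by auto
  obtain C where C: "C \<ge> 0" "\<forall>r>0. \<forall>u\<ge>0. \<rho> r * u \<le> \<eta> * \<kappa> r + C * \<sigma> r * u powr p"
    using Young[OF \<eta>(1)] by auto
  obtain d where d: "d > 0" "(C * A 0) * d \<le> e / 4"
    using exists_pos_mult_le[of "e / 4" "C * A 0"] e C(1) A_nonneg[of 0] by auto
  obtain c where c: "continuous_on UNIV c"
    "(\<integral>\<^sup>+x\<in>{0..real n}. ennreal (norm (f x - c x) powr p) \<partial>lebesgue) < ennreal d"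
    using Lp_dense_continuous[OF f p0 floc d(1)] by blast
  have cn: "(\<lambda>r. if r \<in> {..real n} then c r else 0) measurable_on UNIV"
    by (rule measurable_on_restrict[OF continuous_imp_measurable_on[OF c(1)]]) simp
  define h where "h = (\<lambda>r. \<rho> r * norm (f r - (if r \<in> {..real n} then c r else 0)))"
  define u where "u = (\<lambda>r. norm (f r - c r) * indicator {..real n} r)"
  have u: "u \<in> borel_measurable lebesgue"
    unfolding u_def using measurable_on_norm_borel[OF measurable_on_diff[OF f continuous_imp_measurable_on[OF c(1)]]]
    by (intro borel_measurable_times borel_measurable_indicator) auto
  have h: "h \<in> borel_measurable lebesgue" "\<And>r. 0 \<le> h r"
    unfolding h_def using \<rho>_lebesgue measurable_on_norm_borel[OF measurable_on_diff[OF f cn]] \<rho>_nonneg by auto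
  have m\<rho>u: "(\<lambda>r. \<rho> r * u r) \<in> borel_measurable lebesgue"
    using \<rho>_lebesgue u by measurable
  have "(\<integral>\<^sup>+r\<in>{0<..}. ennreal (h r) \<partial>lebesgue) \<le>
    (\<integral>\<^sup>+r. ennreal (\<rho> r * u r) * indicator {0<..} r + ennreal (\<rho> r * norm (f r)) * indicator {real n<..} r \<partial>lebesgue)"
    by (intro nn_integral_mono) (auto simp: h_def u_def indicator_def)
  also have "\<dots> = (\<integral>\<^sup>+r\<in>{0<..}. ennreal (\<rho> r * u r) \<partial>lebesgue) + (\<integral>\<^sup>+r\<in>{real n<..}. ennreal (\<rho> r * norm (f r)) \<partial>lebesgue)"
    by (intro nn_integral_add borel_measurable_times_indicator_lebesgue m\<rho>u m\<rho>f) auto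
  also have "\<dots> \<le> (ennreal (e / 4) + ennreal (e / 4)) + ennreal (e / 4)"
  proof (rule add_mono)
    have "(\<integral>\<^sup>+r\<in>{0<..}. ennreal (\<rho> r * u r) \<partial>lebesgue) \<le>
       ennreal (\<eta> * K) + ennreal C * (\<integral>\<^sup>+r\<in>{0<..}. ennreal (\<sigma> r) * ennreal (u r powr p) \<partial>lebesgue)"
      by (rule nn_integral_\<rho>_le[OF C(2,1)]) (use \<eta> u in \<open>auto simp: u_def\<close>)
    also have "(\<integral>\<^sup>+r\<in>{0<..}. ennreal (\<sigma> r) * ennreal (u r powr p) \<partial>lebesgue) \<le>
      (\<integral>\<^sup>+r. ennreal (A 0) * (ennreal (norm (f r - c r) powr p) * indicator {0..real n} r) \<partial>lebesgue)"
    proof (rule nn_integral_mono)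
      fix r :: real
      have "0 < r \<Longrightarrow> ennreal (\<sigma> r) * ennreal (norm (f r - c r) powr p) \<le> ennreal (A 0) * ennreal (norm (f r - c r) powr p)"
        by (intro mult_right_mono ennreal_leI \<sigma>_le_A) auto
      then show "ennreal (\<sigma> r) * ennreal (u r powr p) * indicator {0<..} r \<le> ennreal (A 0) * (ennreal (norm (f r - c r) powr p) * indicator {0..real n} r)"
        by (auto simp: indicator_def u_def)
    qed
    also have "\<dots> = ennreal (A 0) * (\<integral>\<^sup>+r\<in>{0..real n}. ennreal (norm (f r - c r) powr p) \<partial>lebesgue)"
      by (intro nn_integral_cmult borel_measurable_times_indicator_lebesgue measurable_on_norm_borel measurable_on_diff f continuous_imp_measurable_on c) auto
    also have "ennreal (\<eta> * K) + ennreal C * \<dots> \<le> ennreal (\<eta> * K) + ennreal C * (ennreal (A 0) * ennreal d)"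
      using c(2) by (intro add_left_mono mult_left_mono) auto
    also have "ennreal C * (ennreal (A 0) * ennreal d) = ennreal (C * A 0 * d)"
      using C(1) A_nonneg[of 0] d(1) by (simp add: ennreal_mult mult.assoc)
    also have "ennreal (\<eta> * K) + ennreal (C * A 0 * d) \<le> ennreal (e / 4) + ennreal (e / 4)"
      using \<eta>(2) d(2) by (intro add_mono ennreal_leI) (auto simp: mult.commute)
    finally show "(\<integral>\<^sup>+r\<in>{0<..}. ennreal (\<rho> r * u r) \<partial>lebesgue) \<le> ennreal (e / 4) + ennreal (e / 4)"
      by (simp add: add_left_mono mult_left_mono)
  qed (use n in auto)
  also have "\<dots> = ennreal (3 * e / 4)"
    using e by (simp add: ennreal_plus[symmetric] del: ennreal_plus)
  also have "\<dots> < ennreal e"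
    using e by (intro ennreal_lessI) auto
  finally have lt: "(\<integral>\<^sup>+r\<in>{0<..}. ennreal (h r) \<partial>lebesgue) < ennreal e" .
  have hfin: "(\<integral>\<^sup>+r\<in>{0<..}. ennreal (h r) \<partial>lebesgue) < \<infinity>"
    by (rule less_trans[OF lt]) simp
  note h_HK = nn_integral_HK_integrable[OF h _ hfin]
  have I: "integral {0<..} h < e"
    using h_HK(2) lt by (simp flip: ennreal_less_iff[OF integral_nonneg[OF h_HK(1) h(2)]])
  have "norm (R r (f r) - (if r \<le> real n then R r (c r) else 0)) \<le> h r" if r: "0 < r" for r
    using R_norm[OF r, of "f r - (if r \<in> {..real n} then c r else 0)"] R_norm[OF r, of "f r"] R_diff[OF r] by (auto simp: h_def)
  then show "\<exists>u h. u integrable_on {0<..} \<and> h integrable_on {0<..} \<and>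
      (\<forall>r\<in>{0<..}. norm (R r (f r) - u r) \<le> h r) \<and> integral {0<..} h < e"
    using I h_HK(1) R_continuous_integrable[OF c(1), of n]
    by (intro exI[of _ "\<lambda>r. if r \<le> real n then R r (c r) else 0"] exI[of _ h]) auto
qed

lemma admissible_norm_le:
  assumes "admissible f"
  shows "ennreal (norm (integral {0<..} (\<lambda>r. R r (f r)))) \<le> (\<integral>\<^sup>+r\<in>{0<..}. ennreal (\<rho> r * norm (f r)) \<partial>lebesgue)"
proof (rule norm_integral_le_nn_integral[OF admissible_integrable[OF assms]])
  have f: "f measurable_on UNIV"
    using assms by (simp add: admissible_def)
  show "(\<lambda>r. \<rho> r * norm (f r)) \<in> borel_measurable lebesgue"
    using \<rho>_lebesgue measurable_on_norm_borel[OF f] by measurable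
qed (use R_norm \<rho>_nonneg in auto)

lemma stepanov_interval_finite:
  assumes "stepanov S \<phi>"
  shows "Lp_mass p {s..t} \<phi> < \<infinity>"
proof (cases "s \<le> t")
  case True
  have m: "(\<lambda>x. ennreal (norm (\<phi> x) powr p)) \<in> borel_measurable lebesgue"
  proof -
    have "(\<lambda>x. norm (\<phi> x)) \<in> borel_measurable lebesgue"
      using measurable_on_norm_borel[of \<phi>] assms by (simp add: stepanov_def)
    then show ?thesis by measurable
  qed
  have "Lp_mass p {s..t} \<phi> \<le> ennreal ((t - s + 1) * S)"
    by (rule nn_integral_Icc_le_Stepanov[OF m]) (use assms True in \<open>auto simp: stepanov_def\<close>)
  then show ?thesis
    by (auto intro: le_less_trans)
qed auto

lemma stepanov_bound:
  "\<exists>B>0. \<forall>\<phi> :: real \<Rightarrow> 'a. \<forall>x. stepanov S \<phi> \<longrightarrow> (\<integral>\<^sup>+r\<in>{0<..}. ennreal (\<rho> r * norm (\<phi> (x - r))) \<partial>lebesgue) \<le> ennreal B"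
proof -
  obtain B where B: "B > 0" "\<And>u x. u \<in> borel_measurable lebesgue \<Longrightarrow> (\<forall>r. 0 \<le> u r) \<Longrightarrow>
     (\<forall>t. (\<integral>\<^sup>+x\<in>{t..t+1}. ennreal (u x powr p) \<partial>lebesgue) \<le> ennreal S) \<Longrightarrow>
     (\<integral>\<^sup>+r\<in>{0<..}. ennreal (\<rho> r * u (x - r)) \<partial>lebesgue) \<le> ennreal B"
    using nn_integral_\<rho>_bounded[of S] by blast
  show ?thesis
  proof (intro exI[of _ B] conjI allI impI)
    fix \<phi> :: "real \<Rightarrow> 'a" and x assume "stepanov S \<phi>"
    then show "(\<integral>\<^sup>+r\<in>{0<..}. ennreal (\<rho> r * norm (\<phi> (x - r))) \<partial>lebesgue) \<le> ennreal B"
      using measurable_on_norm_borel[of \<phi>] by (intro B(2)) (auto simp: stepanov_def)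
  qed (rule B(1))
qed

lemma stepanov_admissible:
  assumes "stepanov S \<phi>"
  shows "admissible (\<lambda>r. \<phi> (x - r))"
  unfolding admissible_def
proof (intro conjI allI)
  have m: "\<phi> measurable_on UNIV"
    using assms by (simp add: stepanov_def)
  show "(\<lambda>r. \<phi> (x - r)) measurable_on UNIV"
    by (rule measurable_on_reflect[OF m])
  show "(\<integral>\<^sup>+r\<in>{0<..}. ennreal (\<rho> r * norm (\<phi> (x - r))) \<partial>lebesgue) < \<infinity>"
  proof -
    obtain B where "(\<integral>\<^sup>+r\<in>{0<..}. ennreal (\<rho> r * norm (\<phi> (x - r))) \<partial>lebesgue) \<le> ennreal B"
      using stepanov_bound[of S] assms by blast
    then show ?thesis
      by (rule le_less_trans) simp
  qed
  fix a b
  have "(\<integral>\<^sup>+r\<in>{a..b}. ennreal (norm (\<phi> (x - r)) powr p) \<partial>lebesgue) = (\<integral>\<^sup>+r. ennreal (norm (\<phi> (x - r)) powr p) * indicator {x - b..x - a} (x - r) \<partial>lebesgue)"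
    by (intro nn_integral_cong) (auto simp: indicator_def)
  also have "\<dots> = Lp_mass p {x - b..x - a} \<phi>"
    by (rule nn_integral_lebesgue_reflect[OF borel_measurable_times_indicator_lebesgue(2)[OF measurable_on_norm_borel[OF m]]]) simp
  finally show "(\<integral>\<^sup>+r\<in>{a..b}. ennreal (norm (\<phi> (x - r)) powr p) \<partial>lebesgue) < \<infinity>"
    using stepanov_interval_finite[OF assms] by simp
qed

lemma admissible_diff:
  assumes f: "admissible f" and g: "admissible g"
  shows "admissible (\<lambda>r. f r - g r)"
  unfolding admissible_def
proof (intro conjI allI)
  have fm: "f measurable_on UNIV" and gm: "g measurable_on UNIV"
    using f g by (auto simp: admissible_def)
  show "(\<lambda>r. f r - g r) measurable_on UNIV"
    by (rule measurable_on_diff[OF fm gm])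
  note nf = measurable_on_norm_borel[OF fm] and ng = measurable_on_norm_borel[OF gm]
  have \<rho>f: "(\<lambda>r. \<rho> r * norm (f r)) \<in> borel_measurable lebesgue" and \<rho>g: "(\<lambda>r. \<rho> r * norm (g r)) \<in> borel_measurable lebesgue"
    using \<rho>_lebesgue nf ng by measurable
  have "(\<integral>\<^sup>+r\<in>{0<..}. ennreal (\<rho> r * norm (f r - g r)) \<partial>lebesgue) \<le>
     (\<integral>\<^sup>+r. ennreal (\<rho> r * norm (f r)) * indicator {0<..} r + ennreal (\<rho> r * norm (g r)) * indicator {0<..} r \<partial>lebesgue)"
  proof (rule nn_integral_mono)
    fix r
    have "\<rho> r * norm (f r - g r) \<le> \<rho> r * norm (f r) + \<rho> r * norm (g r)"
      using mult_left_mono[OF norm_triangle_ineq4[of "f r" "g r"] \<rho>_nonneg[of r]] by (simp add: distrib_left)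
    then show "ennreal (\<rho> r * norm (f r - g r)) * indicator {0<..} r \<le>
       ennreal (\<rho> r * norm (f r)) * indicator {0<..} r + ennreal (\<rho> r * norm (g r)) * indicator {0<..} r"
      using \<rho>_nonneg by (auto simp: indicator_def ennreal_plus[symmetric] ennreal_leI simp del: ennreal_plus)
  qed
  also have "\<dots> = (\<integral>\<^sup>+r\<in>{0<..}. ennreal (\<rho> r * norm (f r)) \<partial>lebesgue) + (\<integral>\<^sup>+r\<in>{0<..}. ennreal (\<rho> r * norm (g r)) \<partial>lebesgue)"
    by (intro nn_integral_add borel_measurable_times_indicator_lebesgue \<rho>f \<rho>g) auto
  also have "\<dots> < \<infinity>"
    using f g by (auto simp: admissible_def)
  finally show "(\<integral>\<^sup>+r\<in>{0<..}. ennreal (\<rho> r * norm (f r - g r)) \<partial>lebesgue) < \<infinity>" .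
  fix a b
  have "(\<integral>\<^sup>+x\<in>{a..b}. ennreal (norm (f x - g x) powr p) \<partial>lebesgue) \<le>
    ennreal (2 powr p) * (Lp_mass p {a..b} f + Lp_mass p {a..b} g)"
    using p by (intro nn_integral_powr_diff_le fm gm) auto
  also have "\<dots> < \<infinity>"
    using f g by (auto simp: admissible_def ennreal_mult_less_top)
  finally show "(\<integral>\<^sup>+x\<in>{a..b}. ennreal (norm (f x - g x) powr p) \<partial>lebesgue) < \<infinity>" .
qed

lemma norm_integral_R_diff_le:
  assumes f: "admissible f" and g: "admissible g"
  shows "ennreal (norm (integral {0<..} (\<lambda>r. R r (f r)) - integral {0<..} (\<lambda>r. R r (g r)))) \<le>
     (\<integral>\<^sup>+r\<in>{0<..}. ennreal (\<rho> r * norm (f r - g r)) \<partial>lebesgue)"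
proof -
  have "integral {0<..} (\<lambda>r. R r (f r)) - integral {0<..} (\<lambda>r. R r (g r)) = integral {0<..} (\<lambda>r. R r (f r) - R r (g r))"
    using admissible_integrable[OF f] admissible_integrable[OF g] by (simp add: integral_diff)
  also have "\<dots> = integral {0<..} (\<lambda>r. R r (f r - g r))"
    by (intro integral_cong) (simp add: R_diff)
  finally show ?thesis
    using admissible_norm_le[OF admissible_diff[OF f g]] by simp
qed

definition conv :: "(real \<Rightarrow> 'a) \<Rightarrow> real \<Rightarrow> 'b" where
  "conv \<phi> x = integral {0<..} (\<lambda>r. R r (\<phi> (x - r)))"

text \<open>Two functions and two base points are allowed, so that one estimate covers continuity,
  translates, and the comparison of windows with point values.\<close>

lemma conv_diff_le:
  assumes "stepanov S \<phi>" "stepanov S' \<psi>"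
  shows "ennreal (norm (conv \<phi> x - conv \<psi> y)) \<le> (\<integral>\<^sup>+r\<in>{0<..}. ennreal (\<rho> r * norm (\<phi> (x - r) - \<psi> (y - r))) \<partial>lebesgue)"
  unfolding conv_def by (rule norm_integral_R_diff_le[OF stepanov_admissible[OF assms(1)] stepanov_admissible[OF assms(2)]])

lemma conv_bounded:
  assumes "stepanov S \<phi>"
  shows "\<exists>B>0. \<forall>x. norm (conv \<phi> x) \<le> B"
proof -
  obtain B where B: "B > 0" "\<And>x. (\<integral>\<^sup>+r\<in>{0<..}. ennreal (\<rho> r * norm (\<phi> (x - r))) \<partial>lebesgue) \<le> ennreal B"
    using stepanov_bound[of S] assms by blast
  have "ennreal (norm (conv \<phi> x)) \<le> ennreal B" for x
    unfolding conv_def by (rule order_trans[OF admissible_norm_le[OF stepanov_admissible[OF assms]] B(2)])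
  then show ?thesis
    using B(1) by (intro exI[of _ B]) auto
qed

lemma conv_modulus:
  fixes \<phi> :: "real \<Rightarrow> 'a"
  assumes "stepanov S \<phi>"
  shows "((\<lambda>v. \<integral>\<^sup>+r\<in>{0<..}. ennreal (\<rho> r * norm (\<phi> (x + v - r) - \<phi> (x - r))) \<partial>lebesgue) \<longlongrightarrow> 0) (at 0)"
  by (rule nn_integral_\<rho>_translation) (use assms stepanov_interval_finite[OF assms] in \<open>auto simp: stepanov_def\<close>)

lemma conv_continuous:
  assumes "stepanov S \<phi>"
  shows "continuous_on UNIV (conv \<phi>)"
proof -
  have "isCont (conv \<phi>) x" for x
  proof -
    have "((\<lambda>v. ennreal (norm (conv \<phi> (x + v) - conv \<phi> x))) \<longlongrightarrow> 0) (at 0)"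
      by (rule tendsto_sandwich[OF _ _ tendsto_const conv_modulus[OF assms, of x]])
        (auto intro!: always_eventually conv_diff_le[OF assms assms])
    then have "((\<lambda>v. norm (conv \<phi> (x + v) - conv \<phi> x)) \<longlongrightarrow> 0) (at 0)"
      using tendsto_ennrealD[of _ 0] by fastforce
    then have "((\<lambda>v. conv \<phi> (x + v)) \<longlongrightarrow> conv \<phi> x) (at 0)"
      by (simp add: tendsto_norm_zero_iff LIM_zero_iff)
    then show ?thesis
      by (simp add: isCont_iff)
  qed
  then show ?thesis
    by (simp add: continuous_at_imp_continuous_on)
qed

text \<open>The substitution \<open>s = t - r\<close> gives the integral over \<open>s < t\<close>;
  the endpoint \<open>s = t\<close>, where nothing is assumed about \<open>R 0\<close>, is
  negligible.\<close>

lemma has_integral_conv: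
  assumes "stepanov S \<phi>"
  shows "((\<lambda>s. R (t - s) (\<phi> s)) has_integral conv \<phi> t) {..t}"
proof -
  have "((\<lambda>r. R r (\<phi> (t - r))) has_integral conv \<phi> t) {0<..}"
    unfolding conv_def by (rule integrable_integral[OF admissible_integrable[OF stepanov_admissible[OF assms]]])
  then have "((\<lambda>r. if r \<in> {0<..} then R r (\<phi> (t - r)) else 0) has_integral conv \<phi> t) UNIV"
    by (simp only: has_integral_restrict_UNIV)
  from has_integral_reflect_UNIV[OF this, of t]
  have "((\<lambda>s. if s \<in> {..<t} then R (t - s) (\<phi> s) else 0) has_integral conv \<phi> t) UNIV"
    by (simp add: if_distrib cong: if_cong)
  then have "((\<lambda>s. R (t - s) (\<phi> s)) has_integral conv \<phi> t) {..<t}"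
    by (simp only: has_integral_restrict_UNIV)
  then show ?thesis
    by (rule has_integral_spike_set_eq[THEN iffD1, rotated 2]) (auto intro: negligible_subset[of "{t}"])
qed

end

section \<open>Window integrals and their convolution\<close>

text \<open>The differences in condition (iv) are \<open>window h l x - window h l 0\<close> for the
  rotated function \<open>h\<close>.\<close>

definition window :: "(real \<Rightarrow> 'x::banach) \<Rightarrow> real \<Rightarrow> real \<Rightarrow> 'x" where
  "window h l y = integral {y..y+l} h"

lemma continuous_window:
  fixes h :: "real \<Rightarrow> 'x::banach"
  assumes h: "\<And>s t. h integrable_on {s..t}" and l: "0 \<le> l"
  shows "continuous_on UNIV (window h l)"
proof -
  have "isCont (window h l) y" for y
  proof -
    let ?I = "{y - 1<..<y + 1}"
    have J: "continuous_on {y - 1..y + 1 + l} (\<lambda>t. integral {y - 1..t} h)"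
      by (rule indefinite_integral_continuous_1[OF h])
    have "continuous_on ?I (\<lambda>t. integral {y - 1..t + l} h - integral {y - 1..t} h)"
      by (intro continuous_on_diff continuous_on_compose2[OF J, of _ "\<lambda>t. t + l"] continuous_on_compose2[OF J, of _ "\<lambda>t. t"] continuous_intros) (use l in auto)
    moreover have "integral {y - 1..t + l} h - integral {y - 1..t} h = window h l t" if "t \<in> ?I" for t
      using Henstock_Kurzweil_Integration.integral_combine[of "y - 1" t "t + l" h] h that l by (auto simp: window_def algebra_simps)
    ultimately have "continuous_on ?I (window h l)"
      by (rule continuous_on_eq)
    then show ?thesis
      by (subst (asm) continuous_on_eq_continuous_at) auto
  qed
  then show ?thesis
    by (simp add: continuous_at_imp_continuous_on)
qed

lemma mean_p_powr:
  assumes "0 < t" "\<And>x. 0 \<le> h x" "0 < p"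
  shows "mean_p p h t powr p = 1 / (2 * t) * integral {-t..t} h"
proof -
  \<comment> \<open>\<open>integral\<close> has the default value 0, which settles the
    non-integrable case.\<close>
  have "0 \<le> integral {-t..t} h"
    using assms(2) by (cases "h integrable_on {-t..t}") (auto intro: integral_nonneg simp: not_integrable_integral)
  then have m: "0 \<le> 1 / (2 * t) * integral {-t..t} h"
    using assms(1) by auto
  show ?thesis
    using powr_one[OF m] assms(3) by (simp only: mean_p_def powr_powr) simp
qed

lemma mean_p_lessD:
  assumes "mean_p p h t < D" "0 < t" "\<And>x. 0 \<le> h x" "0 < p" "0 < D"
  shows "1 / (2 * t) * integral {-t..t} h < D powr p"
proof -
  have "mean_p p h t powr p < D powr p"
    using assms by (intro powr_less_mono2) (auto simp: mean_p_def)
  then show ?thesis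
    using mean_p_powr[OF assms(2-4)] by simp
qed

lemma mean_p_leI:
  assumes "1 / (2 * t) * integral {-t..t} h \<le> D powr p" "0 < t" "\<And>x. 0 \<le> h x" "0 < p" "0 \<le> D"
  shows "mean_p p h t \<le> D"
proof (rule ccontr)
  assume "\<not> mean_p p h t \<le> D"
  then have "D powr p < mean_p p h t powr p"
    using assms by (intro powr_less_mono2) auto
  then show False
    using mean_p_powr[OF assms(2-4)] assms(1) by simp
qed

context conv_operator
begin

lemma stepanov_shift:
  assumes "stepanov S \<phi>"
  shows "stepanov S (\<lambda>s. \<phi> (s + v))"
  unfolding stepanov_def
proof (intro conjI allI)
  have m: "\<phi> measurable_on UNIV"
    using assms by (simp add: stepanov_def)
  show "(\<lambda>s. \<phi> (s + v)) measurable_on UNIV"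
    by (rule measurable_on_shift[OF m])
  show "0 \<le> S"
    using assms by (simp add: stepanov_def)
  fix t
  have mp: "(\<lambda>s. ennreal (norm (\<phi> s) powr p)) \<in> borel_measurable lebesgue"
  proof -
    note measurable_on_norm_borel[OF m, measurable]
    show ?thesis by measurable
  qed
  have "(\<integral>\<^sup>+s\<in>{t..t+1}. ennreal (norm (\<phi> (s + v)) powr p) \<partial>lebesgue) = Lp_mass p {t+v..t+v+1} \<phi>"
    using nn_integral_Icc_shift[OF mp, where a=t and b="t + 1" and v=v] by (simp add: add.commute add.left_commute)
  then show "(\<integral>\<^sup>+s\<in>{t..t+1}. ennreal (norm (\<phi> (s + v)) powr p) \<partial>lebesgue) \<le> ennreal S"
    using assms by (simp add: stepanov_def)
qed

lemma stepanov_diff: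
  assumes \<phi>: "stepanov S \<phi>" and \<psi>: "stepanov S' \<psi>"
  shows "stepanov (2 powr p * (S + S')) (\<lambda>s. \<phi> s - \<psi> s)"
  unfolding stepanov_def
proof (intro conjI allI)
  have m: "\<phi> measurable_on UNIV" "\<psi> measurable_on UNIV" and S: "0 \<le> S" "0 \<le> S'"
    using \<phi> \<psi> by (auto simp: stepanov_def)
  show "(\<lambda>s. \<phi> s - \<psi> s) measurable_on UNIV"
    by (rule measurable_on_diff[OF m])
  show "0 \<le> 2 powr p * (S + S')"
    using S by simp
  fix t :: real
  have "(\<integral>\<^sup>+x\<in>{t..t+1}. ennreal (norm (\<phi> x - \<psi> x) powr p) \<partial>lebesgue) \<le>
    ennreal (2 powr p) * (Lp_mass p {t..t+1} \<phi> + Lp_mass p {t..t+1} \<psi>)"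
    using p by (intro nn_integral_powr_diff_le m) auto
  also have "\<dots> \<le> ennreal (2 powr p) * (ennreal S + ennreal S')"
    using \<phi> \<psi> by (intro mult_left_mono add_mono) (auto simp: stepanov_def)
  also have "\<dots> = ennreal (2 powr p * (S + S'))"
    using S by (simp add: ennreal_plus[symmetric] ennreal_mult[symmetric] del: ennreal_plus)
  finally show "(\<integral>\<^sup>+x\<in>{t..t+1}. ennreal (norm (\<phi> x - \<psi> x) powr p) \<partial>lebesgue) \<le> ennreal (2 powr p * (S + S'))" .
qed

lemma stepanov_continuous_bounded:
  assumes c: "continuous_on UNIV f" and b: "\<And>x. norm (f x) \<le> W"
  shows "stepanov (W powr p) f"
  unfolding stepanov_def
proof (intro conjI allI)
  show "f measurable_on UNIV"
    by (rule continuous_imp_measurable_on[OF c])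
  fix t :: real
  have "Lp_mass p {t..t+1} f \<le> (\<integral>\<^sup>+x\<in>{t..t+1}. ennreal (W powr p) \<partial>lebesgue)"
    using p b by (intro nn_integral_mono mult_right_mono ennreal_leI powr_mono2) auto
  also have "\<dots> = ennreal (W powr p)"
    by (subst nn_integral_cmult_indicator) (auto simp: emeasure_lborel_Icc_eq)
  finally show "Lp_mass p {t..t+1} f \<le> ennreal (W powr p)" .
qed simp

lemma stepanov_scaleR:
  assumes "stepanov S \<phi>"
  shows "stepanov (\<bar>l\<bar> powr p * S) (\<lambda>s. l *\<^sub>R \<phi> s)"
  unfolding stepanov_def
proof (intro conjI allI)
  have m: "\<phi> measurable_on UNIV" and S: "0 \<le> S"
    using assms by (auto simp: stepanov_def)
  show "(\<lambda>s. l *\<^sub>R \<phi> s) measurable_on UNIV"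
    by (rule measurable_on_scaleR_const[OF m])
  show "0 \<le> \<bar>l\<bar> powr p * S"
    using S by simp
  fix t :: real
  have "(\<integral>\<^sup>+x\<in>{t..t+1}. ennreal (norm (l *\<^sub>R \<phi> x) powr p) \<partial>lebesgue) =
    (\<integral>\<^sup>+x. ennreal (\<bar>l\<bar> powr p) * (ennreal (norm (\<phi> x) powr p) * indicator {t..t+1} x) \<partial>lebesgue)"
    by (intro nn_integral_cong) (auto simp: indicator_def powr_mult ennreal_mult)
  also have "\<dots> = ennreal (\<bar>l\<bar> powr p) * Lp_mass p {t..t+1} \<phi>"
    by (intro nn_integral_cmult borel_measurable_times_indicator_lebesgue measurable_on_norm_borel m) simp
  also have "\<dots> \<le> ennreal (\<bar>l\<bar> powr p) * ennreal S"
    using assms by (intro mult_left_mono) (auto simp: stepanov_def)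
  finally show "(\<integral>\<^sup>+x\<in>{t..t+1}. ennreal (norm (l *\<^sub>R \<phi> x) powr p) \<partial>lebesgue) \<le> ennreal (\<bar>l\<bar> powr p * S)"
    using S by (simp add: ennreal_mult)
qed

text \<open>A norm above 1 only grows under the power \<open>p \<ge> 1\<close>, and the summand 1
  covers the rest. This gives local integrability without a conjugate exponent, and bounds on
  windows that are linear in \<open>l\<close>.\<close>

lemma stepanov_dominating:
  assumes "stepanov S h"
  defines "w \<equiv> \<lambda>x. 1 + norm (h x) powr p"
  shows "w \<in> borel_measurable lebesgue" "\<And>x. norm (h x) \<le> w x"
    "\<And>s t. s \<le> t \<Longrightarrow> (\<integral>\<^sup>+x\<in>{s..t}. ennreal (w x) \<partial>lebesgue) \<le> ennreal ((t - s + 1) * (1 + S))"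
proof -
  have m: "h measurable_on UNIV" and S: "0 \<le> S"
    using assms by (auto simp: stepanov_def)
  show w: "w \<in> borel_measurable lebesgue"
    unfolding w_def using measurable_on_norm_borel[OF m] by measurable
  show "norm (h x) \<le> w x" for x
  proof (cases "norm (h x) \<le> 1")
    case True
    then show ?thesis
      by (simp add: w_def add_increasing2)
  next
    case False
    then have "norm (h x) powr 1 \<le> norm (h x) powr p"
      using p by (intro powr_mono) auto
    then show ?thesis
      by (simp add: w_def)
  qed
  fix s t :: real
  assume "s \<le> t"
  show "(\<integral>\<^sup>+x\<in>{s..t}. ennreal (w x) \<partial>lebesgue) \<le> ennreal ((t - s + 1) * (1 + S))"
  proof (rule nn_integral_Icc_le_Stepanov)
    show "(\<lambda>x. ennreal (w x)) \<in> borel_measurable lebesgue"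
      using w by measurable
    fix t :: real
    have m1: "(\<lambda>x. ennreal 1 * indicator {t..t+1} x) \<in> borel_measurable (lebesgue :: real measure)"
      by (rule borel_measurable_times_indicator_lebesgue) auto
    have m2: "(\<lambda>x. ennreal (norm (h x) powr p) * indicator {t..t+1} x) \<in> borel_measurable lebesgue"
      by (intro borel_measurable_times_indicator_lebesgue measurable_on_norm_borel m) simp
    have "(\<integral>\<^sup>+x\<in>{t..t+1}. ennreal (w x) \<partial>lebesgue) = (\<integral>\<^sup>+x. ennreal 1 * indicator {t..t+1} x + ennreal (norm (h x) powr p) * indicator {t..t+1} x \<partial>lebesgue)"
      by (intro nn_integral_cong) (auto simp: indicator_def w_def)
    also have "\<dots> = (\<integral>\<^sup>+x\<in>{t..t+1}. ennreal 1 \<partial>lebesgue) + Lp_mass p {t..t+1} h"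
      by (rule nn_integral_add[OF m1 m2])
    also have "\<dots> \<le> ennreal 1 + ennreal S"
      using assms by (intro add_mono) (auto simp: stepanov_def)
    finally show "(\<integral>\<^sup>+x\<in>{t..t+1}. ennreal (w x) \<partial>lebesgue) \<le> ennreal (1 + S)"
      using S by simp
  qed (use S \<open>s \<le> t\<close> in auto)
qed

lemma stepanov_integrable:
  fixes h :: "real \<Rightarrow> 'x::banach"
  assumes "stepanov S h"
  shows "h integrable_on {s..t}"
proof (cases "s \<le> t")
  case True
  show ?thesis
  proof (rule measurable_bounded_by_integrable_banach[OF _ _ stepanov_dominating(1)[OF assms] _ stepanov_dominating(2)[OF assms]])
    have "(\<lambda>x. if x \<in> {s..t} then h x else 0) measurable_on UNIV"
      using assms by (intro measurable_on_restrict) (auto simp: stepanov_def)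
    then show "h measurable_on {s..t}"
      by (simp only: measurable_on_UNIV)
    show "(\<integral>\<^sup>+x\<in>{s..t}. ennreal (1 + norm (h x) powr p) \<partial>lebesgue) < \<infinity>"
      by (rule le_less_trans[OF stepanov_dominating(3)[OF assms True]]) simp
  qed auto
qed auto

lemma norm_window_le:
  fixes h :: "real \<Rightarrow> 'x::banach"
  assumes "stepanov S h" "0 \<le> l"
  shows "norm (window h l y) \<le> (l + 1) * (1 + S)"
proof -
  have "ennreal (norm (window h l y)) \<le> (\<integral>\<^sup>+x\<in>{y..y+l}. ennreal (1 + norm (h x) powr p) \<partial>lebesgue)"
    unfolding window_def
    by (rule norm_integral_le_nn_integral[OF stepanov_integrable[OF assms(1)] _ stepanov_dominating(1)[OF assms(1)] _ stepanov_dominating(2)[OF assms(1)]]) auto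
  also have "\<dots> \<le> ennreal ((y + l - y + 1) * (1 + S))"
    by (rule stepanov_dominating(3)[OF assms(1)]) (use assms in auto)
  finally show ?thesis
    using assms by (subst (asm) ennreal_le_iff) (auto simp: stepanov_def)
qed

lemma stepanov_window:
  fixes h :: "real \<Rightarrow> 'x::banach"
  assumes "stepanov S h" "0 \<le> l"
  shows "stepanov (((l + 1) * (1 + S)) powr p) (window h l)"
  by (intro stepanov_continuous_bounded continuous_window norm_window_le stepanov_integrable[OF assms(1)] assms)

lemma conv_scaleR:
  assumes "stepanov S \<phi>"
  shows "conv (\<lambda>s. l *\<^sub>R \<phi> s) x = l *\<^sub>R conv \<phi> x"
proof -
  have "conv (\<lambda>s. l *\<^sub>R \<phi> s) x = integral {0<..} (\<lambda>r. l *\<^sub>R R r (\<phi> (x - r)))"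
    unfolding conv_def by (intro integral_cong) (simp add: R_lin linear_scale bounded_linear.linear)
  then show ?thesis
    by (simp add: conv_def)
qed

text \<open>The window splits at distance \<open>l\<close> from its base; the second piece, based at
  \<open>x - r + l\<close>, is absorbed by evaluating the convolution at \<open>x + l\<close>. Thus
  \<open>conv (window h l) x\<close> behaves like an integral over \<open>[x, x + l]\<close>, as a
  primitive of \<open>conv h\<close> must.\<close>

lemma conv_window_add:
  assumes h: "stepanov S h" and l: "0 \<le> l" "0 \<le> l'"
  shows "conv (window h (l + l')) x = conv (window h l) x + conv (window h l') (x + l)"
proof -
  have "window h (l + l') y = window h l y + window h l' (y + l)" for y
    using Henstock_Kurzweil_Integration.integral_combine[of y "y + l" "y + l + l'" h] stepanov_integrable[OF h] l by (simp add: window_def add.assoc)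
  then have "conv (window h (l + l')) x = integral {0<..} (\<lambda>r. R r (window h l (x - r)) + R r (window h l' (x + l - r)))"
    unfolding conv_def by (intro integral_cong) (simp add: R_lin linear_add bounded_linear.linear algebra_simps)
  then show ?thesis
    using admissible_integrable[OF stepanov_admissible[OF stepanov_window[OF h l(1)], of x]]
      admissible_integrable[OF stepanov_admissible[OF stepanov_window[OF h l(2)], of "x + l"]]
    by (simp add: conv_def integral_add)
qed

text \<open>Modulus of continuity of translation in the \<open>\<rho>\<close>-weighted
  \<open>L^1\<close> norm of the past of \<open>h\<close> seen from \<open>y\<close>. For Stepanov
  \<open>h\<close> it bounds \<open>norm (conv h (y + v) - conv h y)\<close>.\<close>

definition modulus :: "(real \<Rightarrow> 'a) \<Rightarrow> real \<Rightarrow> real \<Rightarrow> ennreal" where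
  "modulus h y v = (\<integral>\<^sup>+r\<in>{0<..}. ennreal (\<rho> r * norm (h (y + v - r) - h (y - r))) \<partial>lebesgue)"

text \<open>Here \<open>h\<close> enters at two points, \<open>y + v - r\<close> and
  \<open>y - r\<close>, so \<open>nn_integral_Tonelli_convolution\<close> does not fit. Continuous
  approximants of \<open>h\<close> make the integrand Borel. For every \<open>v\<close> they
  converge at almost every \<open>r\<close>; for fixed \<open>r\<close>, convergence at almost every
  \<open>v\<close> is ensured only if \<open>y - r\<close> avoids the exceptional set, hence the
  nested almost everywhere condition.\<close>

lemma Tonelli_modulus:
  assumes h: "h measurable_on UNIV"
  shows "(\<integral>\<^sup>+r. ennreal (\<rho> r) * indicator {0<..} r * (\<integral>\<^sup>+v\<in>{s..t}. ennreal (norm (h (y + v - r) - h (y - r))) \<partial>lebesgue) \<partial>lebesgue)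
    = (\<integral>\<^sup>+v\<in>{s..t}. modulus h y v \<partial>lebesgue)"
proof -
  obtain N g where N: "negligible N" and g: "\<And>n. continuous_on UNIV (g n)"
    and lim: "\<And>x. x \<notin> N \<Longrightarrow> (\<lambda>n. g n x) \<longlonglongrightarrow> h x"
    using h by (auto simp: measurable_on_def)
  have N': "N \<in> null_sets lebesgue"
    using N by (simp add: negligible_iff_null_sets)
  define wt where "wt = (\<lambda>v r. ennreal (\<rho> r) * indicator {0<..} r * indicator {s..t} v :: ennreal)"
  \<comment> \<open>Finiteness is what lets limits in \<open>ennreal\<close> pass through
    multiplication by the weight.\<close>
  have wt_fin: "wt v r < top" for v r
    by (auto simp: wt_def indicator_def)
  let ?k = "\<lambda>v r. wt v r * ennreal (norm (h (y + v - r) - h (y - r)))"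
  have conv_k: "(\<lambda>n. wt v r * ennreal (norm (g n (y + v - r) - g n (y - r)))) \<longlonglongrightarrow> ?k v r"
    if "y + v - r \<notin> N" "y - r \<notin> N" for v r
    using wt_fin[of v r] by (intro ennreal_tendsto_cmult tendsto_ennrealI tendsto_norm tendsto_diff lim that)
  have hr: "(\<lambda>v. ennreal (norm (h (y + v - r) - h (y - r)))) \<in> borel_measurable lebesgue" for r
  proof -
    have eq: "y + v - r = v + (y - r)" for v
      by simp
    have "(\<lambda>v. norm (h (v + (y - r)) - h (y - r))) \<in> borel_measurable lebesgue"
      by (rule measurable_on_norm_borel[OF measurable_on_diff[OF measurable_on_shift[OF h] measurable_on_const_UNIV]])
    then show ?thesis
      unfolding eq by measurable
  qed
  have hv: "(\<lambda>r. ennreal (norm (h (y + v - r) - h (y - r)))) \<in> borel_measurable lebesgue" for v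
  proof -
    have "(\<lambda>r. norm (h (y + v - r) - h (y - r))) \<in> borel_measurable lebesgue"
      by (rule measurable_on_norm_borel[OF measurable_on_diff[OF measurable_on_reflect[OF h] measurable_on_reflect[OF h]]])
    then show ?thesis by measurable
  qed
  have "(\<integral>\<^sup>+v. \<integral>\<^sup>+r. ?k v r \<partial>lebesgue \<partial>lebesgue) = (\<integral>\<^sup>+r. \<integral>\<^sup>+v. ?k v r \<partial>lebesgue \<partial>lebesgue)"
  proof (rule nn_integral_Tonelli_AE_limit)
    fix n
    have "continuous_on UNIV (\<lambda>z::real\<times>real. norm (g n (y + fst z - snd z) - g n (y - snd z)))"
      by (intro continuous_on_norm continuous_on_diff continuous_on_compose2[OF g] continuous_intros) auto
    then have "(\<lambda>z::real\<times>real. norm (g n (y + fst z - snd z) - g n (y - snd z))) \<in> borel_measurable (borel \<Otimes>\<^sub>M borel)"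
      unfolding borel_prod by (rule borel_measurable_continuous_onI)
    moreover have "(\<lambda>z. wt (fst z) (snd z)) \<in> borel_measurable (borel \<Otimes>\<^sub>M borel)"
    proof -
      note \<rho>_meas[measurable]
      show ?thesis
        unfolding wt_def by measurable
    qed
    ultimately show "(\<lambda>(v, r). wt v r * ennreal (norm (g n (y + v - r) - g n (y - r)))) \<in> borel_measurable (borel \<Otimes>\<^sub>M borel)"
      unfolding case_prod_unfold by measurable
  next
    fix v
    have "AE r in lebesgue. r \<notin> {r. (y + v) + (-1) * r \<in> N}" "AE r in lebesgue. r \<notin> {r. y + (-1) * r \<in> N}"
      by (intro AE_not_in null_sets_lebesgue_affine N'; simp)+
    then show "AE r in lebesgue. (\<lambda>n. wt v r * ennreal (norm (g n (y + v - r) - g n (y - r)))) \<longlonglongrightarrow> ?k v r"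
      by eventually_elim (rule conv_k, auto)
  next
    have "AE r in lebesgue. r \<notin> {r. y + (-1) * r \<in> N}"
      by (intro AE_not_in null_sets_lebesgue_affine N') simp
    then show "AE r in lebesgue. AE v in lebesgue. (\<lambda>n. wt v r * ennreal (norm (g n (y + v - r) - g n (y - r)))) \<longlonglongrightarrow> ?k v r"
    proof eventually_elim
      case (elim r)
      have "AE v in lebesgue. v \<notin> {v. (y - r) + 1 * v \<in> N}"
        by (intro AE_not_in null_sets_lebesgue_affine N') simp
      then show ?case
        by eventually_elim (rule conv_k, use elim in \<open>auto simp: algebra_simps\<close>)
    qed
  qed
  moreover have "(\<integral>\<^sup>+r. ?k v r \<partial>lebesgue) = modulus h y v * indicator {s..t} v" for v
  proof -
    have "(\<integral>\<^sup>+r. ?k v r \<partial>lebesgue) = (\<integral>\<^sup>+r. indicator {s..t} v * (ennreal (\<rho> r * norm (h (y + v - r) - h (y - r))) * indicator {0<..} r) \<partial>lebesgue)"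
      using \<rho>_nonneg by (intro nn_integral_cong) (auto simp: wt_def ennreal_mult indicator_def)
    also have "\<dots> = indicator {s..t} v * modulus h y v"
      unfolding modulus_def
    proof (rule nn_integral_cmult)
      have "(\<lambda>r. ennreal (\<rho> r) * ennreal (norm (h (y + v - r) - h (y - r))) * indicator {0<..} r) \<in> borel_measurable lebesgue"
        using hv[of v] \<rho>_lebesgue by (intro borel_measurable_times_ennreal borel_measurable_indicator) auto
      then show "(\<lambda>r. ennreal (\<rho> r * norm (h (y + v - r) - h (y - r))) * indicator {0<..} r) \<in> borel_measurable lebesgue"
        using \<rho>_nonneg by (simp add: ennreal_mult)
    qed
    finally show ?thesis
      by (simp add: mult.commute)
  qed
  moreover have "(\<integral>\<^sup>+v. ?k v r \<partial>lebesgue) = ennreal (\<rho> r) * indicator {0<..} r * (\<integral>\<^sup>+v\<in>{s..t}. ennreal (norm (h (y + v - r) - h (y - r))) \<partial>lebesgue)" for r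
  proof -
    have "(\<integral>\<^sup>+v. ?k v r \<partial>lebesgue) = (\<integral>\<^sup>+v. ennreal (\<rho> r) * indicator {0<..} r * (ennreal (norm (h (y + v - r) - h (y - r))) * indicator {s..t} v) \<partial>lebesgue)"
      by (intro nn_integral_cong) (simp add: wt_def mult_ac)
    also have "\<dots> = ennreal (\<rho> r) * indicator {0<..} r * (\<integral>\<^sup>+v\<in>{s..t}. ennreal (norm (h (y + v - r) - h (y - r))) \<partial>lebesgue)"
      by (intro nn_integral_cmult borel_measurable_times_ennreal hr borel_measurable_indicator) simp
    finally show ?thesis .
  qed
  ultimately show ?thesis
    by simp
qed

text \<open>Subtracting \<open>l\<close> times the point value subtracts a constant under the window
  integral. The substitution \<open>s = v + (y - r)\<close> moves the windows for all delays
  \<open>r\<close> to one common interval of \<open>v\<close>, after which Tonelli leaves an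
  integral of the modulus.\<close>

lemma conv_window_estimate:
  assumes h: "stepanov S h" and l: "0 \<le> l"
  shows "ennreal (norm (conv (window h l) x - l *\<^sub>R conv h y)) \<le> (\<integral>\<^sup>+v\<in>{x - y..x + l - y}. modulus h y v \<partial>lebesgue)"
proof -
  have hm: "h measurable_on UNIV"
    using h by (simp add: stepanov_def)
  have pw: "ennreal (norm (window h l (x - r) - l *\<^sub>R h (y - r))) \<le> (\<integral>\<^sup>+v\<in>{x - y..x + l - y}. ennreal (norm (h (y + v - r) - h (y - r))) \<partial>lebesgue)" for r
  proof -
    let ?I = "{x - r..x - r + l}" and ?c = "h (y - r)"
    have m: "(\<lambda>s. norm (h s - ?c)) \<in> borel_measurable lebesgue"
      by (intro measurable_on_norm_borel measurable_on_diff hm measurable_on_const_UNIV)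
    have "window h l (x - r) - l *\<^sub>R ?c = integral ?I h - integral ?I (\<lambda>_. ?c)"
      using l by (simp add: window_def)
    also have "\<dots> = integral ?I (\<lambda>s. h s - ?c)"
      using stepanov_integrable[OF h] by (intro integral_diff[symmetric]) auto
    also have "ennreal (norm \<dots>) \<le> (\<integral>\<^sup>+s\<in>?I. ennreal (norm (h s - ?c)) \<partial>lebesgue)"
      by (rule norm_integral_le_nn_integral) (use stepanov_integrable[OF h] m in \<open>auto intro: integrable_diff\<close>)
    also have "\<dots> = (\<integral>\<^sup>+v. ennreal (norm (h (v + (y - r)) - ?c)) * indicator ?I (v + (y - r)) \<partial>lebesgue)"
      by (rule nn_integral_lebesgue_shift[symmetric, OF borel_measurable_times_indicator_lebesgue(1)[OF m]]) simp
    also have "\<dots> = (\<integral>\<^sup>+v\<in>{x - y..x + l - y}. ennreal (norm (h (y + v - r) - h (y - r))) \<partial>lebesgue)"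
      by (intro nn_integral_cong) (auto simp: indicator_def algebra_simps)
    finally show ?thesis .
  qed
  have "ennreal (norm (conv (window h l) x - l *\<^sub>R conv h y)) = ennreal (norm (conv (window h l) x - conv (\<lambda>s. l *\<^sub>R h s) y))"
    by (simp add: conv_scaleR[OF h])
  also have "\<dots> \<le> (\<integral>\<^sup>+r\<in>{0<..}. ennreal (\<rho> r * norm (window h l (x - r) - l *\<^sub>R h (y - r))) \<partial>lebesgue)"
    by (rule conv_diff_le[OF stepanov_window[OF h l] stepanov_scaleR[OF h]])
  also have "\<dots> \<le> (\<integral>\<^sup>+r. ennreal (\<rho> r) * indicator {0<..} r * (\<integral>\<^sup>+v\<in>{x - y..x + l - y}. ennreal (norm (h (y + v - r) - h (y - r))) \<partial>lebesgue) \<partial>lebesgue)"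
  proof (rule nn_integral_mono)
    fix r
    show "ennreal (\<rho> r * norm (window h l (x - r) - l *\<^sub>R h (y - r))) * indicator {0<..} r \<le>
      ennreal (\<rho> r) * indicator {0<..} r * (\<integral>\<^sup>+v\<in>{x - y..x + l - y}. ennreal (norm (h (y + v - r) - h (y - r))) \<partial>lebesgue)"
      using mult_left_mono[OF pw[of r], of "ennreal (\<rho> r)"] \<rho>_nonneg[of r] by (auto simp: indicator_def ennreal_mult)
  qed
  also have "\<dots> = (\<integral>\<^sup>+v\<in>{x - y..x + l - y}. modulus h y v \<partial>lebesgue)"
    by (rule Tonelli_modulus[OF hm])
  finally show ?thesis .
qed

text \<open>
  Fubini's theorem for the operator-valued convolution is obtained from the fundamental theorem of
  calculus; this needs Tonelli's theorem only for the scalar modulus of continuity.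
\<close>
lemma conv_window_derivative:
  assumes h: "stepanov S h" and y: "y \<in> {x..b}"
  shows "((\<lambda>z. conv (window h (z - x)) x) has_vector_derivative conv h y) (at y within {x..b})"
  unfolding has_vector_derivative_def has_derivative_within_alt
proof (intro conjI allI impI)
  show "bounded_linear (\<lambda>z. z *\<^sub>R conv h y)"
    by (rule bounded_linear_scaleR_left)
  fix e :: real assume e: "0 < e"
  have "((\<lambda>v. modulus h y v) \<longlongrightarrow> 0) (at 0)"
    unfolding modulus_def by (rule conv_modulus[OF h])
  then have "\<forall>\<^sub>F v in at 0. modulus h y v < ennreal e"
    using e by (intro order_tendstoD) auto
  then obtain d where d: "d > 0" "\<And>v. v \<noteq> 0 \<Longrightarrow> \<bar>v\<bar> < d \<Longrightarrow> modulus h y v < ennreal e"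
    by (auto simp: eventually_at dist_real_def)
  have "modulus h y 0 = 0"
    by (simp add: modulus_def)
  then have d': "modulus h y v \<le> ennreal e" if "\<bar>v\<bar> < d" for v
    using d(2)[of v] that by (cases "v = 0") (auto intro: less_imp_le)
  have bound: "norm (conv (window h l) x' - l *\<^sub>R conv h y) \<le> e * l"
    if "0 \<le> l" "\<bar>x' - y\<bar> < d" "\<bar>x' + l - y\<bar> < d" for l x'
  proof -
    have "ennreal (norm (conv (window h l) x' - l *\<^sub>R conv h y)) \<le> (\<integral>\<^sup>+v\<in>{x' - y..x' + l - y}. modulus h y v \<partial>lebesgue)"
      by (rule conv_window_estimate[OF h that(1)])
    also have "\<dots> \<le> (\<integral>\<^sup>+v\<in>{x' - y..x' + l - y}. ennreal e \<partial>lebesgue)"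
      using that by (intro nn_integral_mono) (auto simp: indicator_def intro!: d')
    also have "\<dots> = ennreal e * ennreal l"
      using that(1) by (subst nn_integral_cmult_indicator) auto
    also have "\<dots> = ennreal (e * l)"
      using e that(1) by (simp add: ennreal_mult)
    finally show ?thesis
      using e that(1) by (subst (asm) ennreal_le_iff) auto
  qed
  show "\<exists>d>0. \<forall>z\<in>{x..b}. norm (z - y) < d \<longrightarrow>
    norm (conv (window h (z - x)) x - conv (window h (y - x)) x - (z - y) *\<^sub>R conv h y) \<le> e * norm (z - y)"
  proof (intro exI[of _ d] conjI ballI impI)
    fix z assume z: "z \<in> {x..b}" "norm (z - y) < d"
    show "norm (conv (window h (z - x)) x - conv (window h (y - x)) x - (z - y) *\<^sub>R conv h y) \<le> e * norm (z - y)"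
    proof (cases "y \<le> z")
      case True
      have "conv (window h (z - x)) x = conv (window h (y - x)) x + conv (window h (z - y)) y"
        using conv_window_add[OF h, of "y - x" "z - y" x] y True by simp
      then show ?thesis
        using bound[of "z - y" y] True z d(1) by simp
    next
      case False
      \<comment> \<open>For \<open>z < y\<close> the extra window starts at \<open>z\<close> and
        ends at \<open>y\<close>; its offsets from \<open>y\<close> are nonpositive, which the
        two-sided bound \<open>d'\<close> covers.\<close>
      have "conv (window h (y - x)) x = conv (window h (z - x)) x + conv (window h (y - z)) z"
        using conv_window_add[OF h, of "z - x" "y - z" x] z False by simp
      moreover have "norm (conv (window h (y - z)) z - (y - z) *\<^sub>R conv h y) \<le> e * (y - z)"
        using bound[of "y - z" z] False z d(1) by simp
      moreover have "conv (window h (z - x)) x - (conv (window h (z - x)) x + conv (window h (y - z)) z) - (z - y) *\<^sub>R conv h y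
          = (y - z) *\<^sub>R conv h y - conv (window h (y - z)) z"
        by (simp add: algebra_simps)
      ultimately show ?thesis
        using False by (simp only: norm_minus_commute) simp
    qed
  qed (rule d(1))
qed

text \<open>Both sides vanish at \<open>l = 0\<close> and have derivative
  \<open>conv h (x + l)\<close> in \<open>l\<close>, the right one by
  \<open>conv_window_derivative\<close>; the fundamental theorem of calculus identifies
  them.\<close>

lemma window_conv:
  assumes h: "stepanov S h" and l: "0 \<le> l"
  shows "window (conv h) l x = conv (window h l) x"
proof -
  have "(conv h has_integral (conv (window h (x + l - x)) x - conv (window h (x - x)) x)) {x..x + l}"
    by (rule fundamental_theorem_of_calculus) (use l conv_window_derivative[OF h] in auto)
  moreover have "conv (window h 0) x = 0"
    unfolding conv_def window_def
    by (subst integral_cong[where g="\<lambda>_. 0"]) (auto simp: R_lin linear_0 bounded_linear.linear)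
  ultimately show ?thesis
    by (simp add: window_def integral_unique)
qed

end

section \<open>Transfer of the Besicovitch-Doss conditions\<close>

lemma Mp_norm_lessD:
  assumes "Mp_norm p f < ereal d"
  shows "\<forall>\<^sub>F t in at_top. mean_p p (\<lambda>s. norm (f s) powr p) t < d"
  using Limsup_lessD[OF assms[unfolded Mp_norm_def]] by simp

lemma Limsup_at_top_leI:
  fixes f :: "real \<Rightarrow> real"
  assumes "\<forall>\<^sub>F t in at_top. f t \<le> e"
  shows "Limsup at_top (\<lambda>t. ereal (f t)) \<le> ereal e"
  by (rule Limsup_bounded) (use assms in simp)

lemma Limsup_at_top_nonneg:
  fixes f :: "real \<Rightarrow> real"
  assumes "\<forall>\<^sub>F t in at_top. 0 \<le> f t"
  shows "0 \<le> Limsup at_top (\<lambda>t. ereal (f t))"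
proof -
  have "0 \<le> Liminf at_top (\<lambda>t. ereal (f t))"
    by (rule Liminf_bounded) (use assms in simp)
  then show ?thesis
    by (rule order_trans) (simp add: Liminf_le_Limsup)
qed

lemma Mp_norm_nonneg: "0 \<le> Mp_norm p f"
  unfolding Mp_norm_def by (rule Limsup_at_top_nonneg) (simp add: mean_p_def)

context conv_operator
begin

text \<open>Convolution commutes with translation, so the translated difference of
  \<open>conv \<phi>\<close> is dominated by \<open>\<rho>\<close> convolved with the norm of that
  of \<open>\<phi>\<close>. The Stepanov bound \<open>S'\<close> is independent of
  \<open>\<tau>\<close>, hence so is \<open>d\<close>, as both (ii) and (iii) require.\<close>

lemma conv_translation_transfer:
  assumes \<phi>: "stepanov S \<phi>" and e: "0 < e"
  shows "\<exists>d>0. \<forall>\<tau>. Mp_norm p (\<lambda>s. \<phi> (s + \<tau>) - \<phi> s) < ereal d \<longrightarrow>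
    Mp_norm p (\<lambda>s. conv \<phi> (s + \<tau>) - conv \<phi> s) \<le> ereal e"
proof -
  have p0: "0 < p" using p by simp
  define S' where "S' = 2 powr p * (S + S)"
  have "0 \<le> S"
    using \<phi> by (simp add: stepanov_def)
  then have S': "0 \<le> S'"
    by (simp add: S'_def)
  obtain d where d: "d > 0" and tr: "\<And>u \<Psi>. \<lbrakk>u \<in> borel_measurable lebesgue; \<forall>x. 0 \<le> u x;
     \<forall>t. (\<integral>\<^sup>+x\<in>{t..t+1}. ennreal (u x powr p) \<partial>lebesgue) \<le> ennreal S';
     \<Psi> \<in> borel_measurable lebesgue; \<forall>x. 0 \<le> \<Psi> x;
     \<forall>x. ennreal (\<Psi> x) \<le> (\<integral>\<^sup>+r\<in>{0<..}. ennreal (\<rho> r * u (x - r)) \<partial>lebesgue);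
     \<forall>\<^sub>F t in at_top. 1 / (2 * t) * integral {-t..t} (\<lambda>x. u x powr p) < d\<rbrakk> \<Longrightarrow>
     \<forall>\<^sub>F t in at_top. 1 / (2 * t) * integral {-t..t} (\<lambda>x. \<Psi> x powr p) \<le> e powr p"
    using mean_transfer[OF S', of "e powr p"] e by auto
  show ?thesis
  proof (intro exI[of _ "d powr (1 / p)"] conjI allI impI)
    show "0 < d powr (1 / p)"
      using d by simp
    fix \<tau> assume "Mp_norm p (\<lambda>s. \<phi> (s + \<tau>) - \<phi> s) < ereal (d powr (1 / p))"
    note ev = Mp_norm_lessD[OF this]
    define u where "u = (\<lambda>s. norm (\<phi> (s + \<tau>) - \<phi> s))"
    define \<Psi> where "\<Psi> = (\<lambda>s. norm (conv \<phi> (s + \<tau>) - conv \<phi> s))"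
    have st: "stepanov S' (\<lambda>s. \<phi> (s + \<tau>) - \<phi> s)"
      unfolding S'_def by (rule stepanov_diff[OF stepanov_shift[OF \<phi>] \<phi>])
    have "\<forall>\<^sub>F t in at_top. 1 / (2 * t) * integral {-t..t} (\<lambda>x. \<Psi> x powr p) \<le> e powr p"
    proof (rule tr[of u])
      show "u \<in> borel_measurable lebesgue"
        unfolding u_def using st by (intro measurable_on_norm_borel) (simp add: stepanov_def)
      show "\<forall>t. (\<integral>\<^sup>+x\<in>{t..t+1}. ennreal (u x powr p) \<partial>lebesgue) \<le> ennreal S'"
        using st by (simp add: stepanov_def u_def)
      have "continuous_on UNIV \<Psi>"
        unfolding \<Psi>_def by (intro continuous_intros continuous_on_compose2[OF conv_continuous[OF \<phi>]] conv_continuous[OF \<phi>]) auto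
      then show "\<Psi> \<in> borel_measurable lebesgue"
        by (intro measurable_on_imp_borel_measurable_lebesgue_UNIV continuous_imp_measurable_on)
      show "\<forall>x. ennreal (\<Psi> x) \<le> (\<integral>\<^sup>+r\<in>{0<..}. ennreal (\<rho> r * u (x - r)) \<partial>lebesgue)"
        using conv_diff_le[OF \<phi> \<phi>] by (simp add: \<Psi>_def u_def algebra_simps)
      show "\<forall>\<^sub>F t in at_top. 1 / (2 * t) * integral {-t..t} (\<lambda>x. u x powr p) < d"
        using ev eventually_gt_at_top[of 0]
      proof eventually_elim
        case (elim t)
        have "1 / (2 * t) * integral {-t..t} (\<lambda>s. norm (\<phi> (s + \<tau>) - \<phi> s) powr p) < (d powr (1 / p)) powr p"
          by (rule mean_p_lessD) (use elim p0 d in auto)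
        then show ?case
          using d p0 by (simp add: u_def powr_powr)
      qed
    qed (auto simp: u_def \<Psi>_def)
    then have "\<forall>\<^sub>F t in at_top. mean_p p (\<lambda>s. norm (conv \<phi> (s + \<tau>) - conv \<phi> s) powr p) t \<le> e"
      using eventually_gt_at_top[of 0]
      by eventually_elim (rule mean_p_leI, use e p0 in \<open>auto simp: \<Psi>_def\<close>)
    then show "Mp_norm p (\<lambda>s. conv \<phi> (s + \<tau>) - conv \<phi> s) \<le> ereal e"
      unfolding Mp_norm_def by (rule Limsup_at_top_leI)
  qed
qed

text \<open>By \<open>window_conv\<close>, the normalised windows of \<open>conv h\<close> are
  convolutions of \<open>H = window h l / l\<close>. Their differences compare
  \<open>H (x - r)\<close> with \<open>H (- r)\<close>, whereas \<open>osc\<close> controls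
  distances to \<open>H 0\<close>; \<open>past\<close> bridges the two. Boundedness of
  \<open>H\<close> uniformly in \<open>l \<ge> 1\<close> lets one threshold of
  \<open>mean_transfer\<close> serve all large \<open>l\<close>.\<close>

lemma conv_window_transfer:
  assumes h: "stepanov S h"
    and osc: "((\<lambda>l. Limsup at_top (\<lambda>t. ereal ((1 / l) *
        mean_p p (\<lambda>x. norm (window h l x - window h l 0) powr p) t))) \<longlongrightarrow> 0) at_top"
    and past: "\<And>\<epsilon>. \<epsilon> > 0 \<Longrightarrow> \<exists>l0>0. \<forall>l\<ge>l0. \<forall>v\<ge>0.
        (1 / l) * norm (window h l 0 - window h l (- v)) powr p < \<epsilon>"
  shows "((\<lambda>l. Limsup at_top (\<lambda>t. ereal ((1 / l) *
        mean_p p (\<lambda>x. norm (window (conv h) l x - window (conv h) l 0) powr p) t))) \<longlongrightarrow> 0) at_top"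
proof (rule order_tendstoI)
  fix y :: ereal assume "y < 0"
  show "\<forall>\<^sub>F l in at_top. y < Limsup at_top (\<lambda>t. ereal ((1 / l) *
        mean_p p (\<lambda>x. norm (window (conv h) l x - window (conv h) l 0) powr p) t))"
    using eventually_gt_at_top[of 0]
  proof eventually_elim
    case (elim l)
    have "0 \<le> Limsup at_top (\<lambda>t. ereal ((1 / l) * mean_p p (\<lambda>x. norm (window (conv h) l x - window (conv h) l 0) powr p) t))"
      by (rule Limsup_at_top_nonneg) (use elim in \<open>simp add: mean_p_def\<close>)
    then show ?case
      using \<open>y < 0\<close> by (rule order.strict_trans2[rotated])
  qed
next
  fix y :: ereal assume "0 < y"
  then obtain e where e: "0 < e" "ereal e < y"
    using ereal_dense2[of 0 y] by auto
  have p0: "0 < p" using p by simp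
  have S0: "0 \<le> S"
    using h by (simp add: stepanov_def)
  \<comment> \<open>For \<open>l \<ge> 1\<close> the norm of \<open>H\<close> is at most
    \<open>2 * (1 + S)\<close>, so \<open>norm (H x - H 0) + c\<close> with \<open>c \<le> 1\<close>
    is at most \<open>W\<close>.\<close>
  define W where "W = 4 * (1 + S) + 1"
  obtain d where d: "d > 0" and tr: "\<And>u \<Psi>. \<lbrakk>u \<in> borel_measurable lebesgue; \<forall>x. 0 \<le> u x;
     \<forall>t. (\<integral>\<^sup>+x\<in>{t..t+1}. ennreal (u x powr p) \<partial>lebesgue) \<le> ennreal (W powr p);
     \<Psi> \<in> borel_measurable lebesgue; \<forall>x. 0 \<le> \<Psi> x;
     \<forall>x. ennreal (\<Psi> x) \<le> (\<integral>\<^sup>+r\<in>{0<..}. ennreal (\<rho> r * u (x - r)) \<partial>lebesgue);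
     \<forall>\<^sub>F t in at_top. 1 / (2 * t) * integral {-t..t} (\<lambda>x. u x powr p) < d\<rbrakk> \<Longrightarrow>
     \<forall>\<^sub>F t in at_top. 1 / (2 * t) * integral {-t..t} (\<lambda>x. \<Psi> x powr p) \<le> e powr p"
    using mean_transfer[of "W powr p" "e powr p"] e by auto
  \<comment> \<open>Makes \<open>2 powr p * (c powr p + c powr p) \<le> d / 2\<close>: one
    \<open>c\<close> is the accuracy taken from \<open>osc\<close>, the other the constant summand
    in \<open>u\<close>.\<close>
  define c where "c = min 1 ((d / (4 * 2 powr p)) powr (1 / p))"
  have c: "0 < c" "c \<le> 1"
    using d by (auto simp: c_def)
  have "c powr p \<le> ((d / (4 * 2 powr p)) powr (1 / p)) powr p"
    using c p0 by (intro powr_mono2) (auto simp: c_def)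
  also have "\<dots> = d / (4 * 2 powr p)"
    using d p0 by (simp add: powr_powr)
  finally have cp: "2 powr p * (c powr p + c powr p) < d"
    using d by (simp add: field_simps)
  obtain l0 where l0: "l0 > 0" "\<And>l v. \<lbrakk>l \<ge> l0; v \<ge> 0\<rbrakk> \<Longrightarrow> (1 / l) * norm (window h l 0 - window h l (- v)) powr p < c powr p"
    using past[of "c powr p"] c by auto
  have "\<forall>\<^sub>F l in at_top. Limsup at_top (\<lambda>t. ereal ((1 / l) * mean_p p (\<lambda>x. norm (window h l x - window h l 0) powr p) t)) < ereal c"
    using osc c(1) by (intro order_tendstoD) auto
  then show "\<forall>\<^sub>F l in at_top. Limsup at_top (\<lambda>t. ereal ((1 / l) *
        mean_p p (\<lambda>x. norm (window (conv h) l x - window (conv h) l 0) powr p) t)) < y"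
    using eventually_ge_at_top[of 1] eventually_ge_at_top[of l0]
  proof eventually_elim
    case (elim l)
    have l: "0 \<le> l" "0 < l" "1 \<le> l"
      using elim by auto
    define H where "H = (\<lambda>x. (1 / l) *\<^sub>R window h l x)"
    \<comment> \<open>the summand \<open>c\<close> absorbs \<open>\<parallel>H 0 - H (-r)\<parallel>\<close>, so that \<open>u (x - r) \<ge> \<parallel>H (x - r) - H (-r)\<parallel>\<close> for all \<open>r > 0\<close>\<close>
    define u where "u = (\<lambda>x. norm (H x - H 0) + c)"
    define \<Psi> where "\<Psi> = (\<lambda>x. norm (conv H x - conv H 0))"
    note wc = continuous_window[OF stepanov_integrable[OF h] l(1)]
    have Hc: "continuous_on UNIV H"
      unfolding H_def by (intro continuous_intros wc)
    have Hn: "norm (H x) \<le> 2 * (1 + S)" for x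
    proof -
      have "norm (window h l x) \<le> (l + 1) * (1 + S)"
        by (rule norm_window_le[OF h l(1)])
      also have "\<dots> \<le> (2 * l) * (1 + S)"
        using l S0 by (intro mult_right_mono) auto
      finally show ?thesis
        using l by (simp add: H_def field_simps)
    qed
    note Hst = stepanov_continuous_bounded[OF Hc Hn]
    have uc: "continuous_on UNIV u"
      unfolding u_def by (intro continuous_intros Hc)
    have u0: "0 \<le> u x" for x
      using c by (simp add: u_def)
    have uW: "norm (u x) \<le> W" for x
      using norm_triangle_ineq4[of "H x" "H 0"] Hn[of x] Hn[of 0] c u0[of x] by (simp add: u_def W_def)
    have convH: "conv H x = (1 / l) *\<^sub>R conv (window h l) x" for x
      unfolding H_def by (rule conv_scaleR[OF stepanov_window[OF h l(1)]])
    have past': "norm (H 0 - H (- v)) \<le> c" if "0 \<le> v" for v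
    proof -
      let ?n = "norm (window h l 0 - window h l (- v))"
      \<comment> \<open>In \<open>past\<close> the factor \<open>1 / l\<close> stands outside the
        \<open>p\<close>-th power; \<open>l \<le> l powr p\<close> for \<open>l \<ge> 1\<close>
        brings it inside.\<close>
      have "?n powr p < c powr p * l"
        using l0(2)[OF elim(3) that] l by (simp add: field_simps)
      also have "\<dots> \<le> c powr p * l powr p"
        using l p powr_mono[of 1 p l] by (intro mult_left_mono) auto
      also have "\<dots> = (c * l) powr p"
        using c l by (simp add: powr_mult)
      finally have lt: "?n powr p < (c * l) powr p" .
      have "?n < c * l"
      proof (rule ccontr)
        assume "\<not> ?n < c * l"
        then have "(c * l) powr p \<le> ?n powr p"
          using c l p0 by (intro powr_mono2) auto
        then show False
          using lt by simp
      qed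
      moreover have "H 0 - H (- v) = (1 / l) *\<^sub>R (window h l 0 - window h l (- v))"
        unfolding H_def by (rule scaleR_diff_right[symmetric])
      then have "norm (H 0 - H (- v)) = ?n / l"
        using l by simp
      ultimately show ?thesis
        using l by (simp add: pos_divide_le_eq)
    qed
    have "\<forall>\<^sub>F t in at_top. 1 / (2 * t) * integral {-t..t} (\<lambda>x. \<Psi> x powr p) \<le> e powr p"
    proof (rule tr[of u])
      show "u \<in> borel_measurable lebesgue"
        by (intro measurable_on_imp_borel_measurable_lebesgue_UNIV continuous_imp_measurable_on uc)
      show "\<forall>t. (\<integral>\<^sup>+x\<in>{t..t+1}. ennreal (u x powr p) \<partial>lebesgue) \<le> ennreal (W powr p)"
        using stepanov_continuous_bounded[OF uc uW] u0 by (simp add: stepanov_def)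
      have "continuous_on UNIV \<Psi>"
        unfolding \<Psi>_def by (intro continuous_intros conv_continuous[OF Hst])
      then show "\<Psi> \<in> borel_measurable lebesgue"
        by (intro measurable_on_imp_borel_measurable_lebesgue_UNIV continuous_imp_measurable_on)
      show "\<forall>x. ennreal (\<Psi> x) \<le> (\<integral>\<^sup>+r\<in>{0<..}. ennreal (\<rho> r * u (x - r)) \<partial>lebesgue)"
      proof
        fix x
        have "ennreal (\<Psi> x) \<le> (\<integral>\<^sup>+r\<in>{0<..}. ennreal (\<rho> r * norm (H (x - r) - H (0 - r))) \<partial>lebesgue)"
          unfolding \<Psi>_def by (rule conv_diff_le[OF Hst Hst])
        also have "\<dots> \<le> (\<integral>\<^sup>+r\<in>{0<..}. ennreal (\<rho> r * u (x - r)) \<partial>lebesgue)"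
        proof (rule nn_integral_mono)
          fix r :: real
          have "norm (H (x - r) - H (0 - r)) \<le> u (x - r)" if "0 < r"
            using norm_triangle_ineq[of "H (x - r) - H 0" "H 0 - H (- r)"] past'[of r] that by (simp add: u_def)
          then show "ennreal (\<rho> r * norm (H (x - r) - H (0 - r))) * indicator {0<..} r \<le> ennreal (\<rho> r * u (x - r)) * indicator {0<..} r"
            using \<rho>_nonneg by (auto simp: indicator_def intro!: ennreal_leI mult_left_mono)
        qed
        finally show "ennreal (\<Psi> x) \<le> (\<integral>\<^sup>+r\<in>{0<..}. ennreal (\<rho> r * u (x - r)) \<partial>lebesgue)" .
      qed
      have "\<forall>\<^sub>F t in at_top. (1 / l) * mean_p p (\<lambda>x. norm (window h l x - window h l 0) powr p) t < c"
        using Limsup_lessD[OF elim(1)] by simp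
      then show "\<forall>\<^sub>F t in at_top. 1 / (2 * t) * integral {-t..t} (\<lambda>x. u x powr p) < d"
        using eventually_gt_at_top[of 0]
      proof eventually_elim
        case (elim t)
        let ?w = "\<lambda>x. norm (window h l x - window h l 0) powr p"
        have "1 / (2 * t) * integral {-t..t} ?w < (c * l) powr p"
          by (rule mean_p_lessD) (use elim l c p0 in \<open>auto simp: field_simps\<close>)
        then have "(1 / l powr p) * (1 / (2 * t) * integral {-t..t} ?w) < (1 / l powr p) * (c * l) powr p"
          using l by (intro mult_strict_left_mono) auto
        also have "\<dots> = c powr p"
          using c l by (simp add: powr_mult)
        finally have w: "(1 / l powr p) * (1 / (2 * t) * integral {-t..t} ?w) < c powr p" .
        have wi: "?w integrable_on {-t..t}"
          using p0 by (intro integrable_continuous_interval continuous_on_powr' continuous_intros continuous_on_subset[OF wc]) auto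
        have ui: "(\<lambda>x. u x powr p) integrable_on {-t..t}"
          using p0 u0 by (intro integrable_continuous_interval continuous_on_powr' continuous_intros continuous_on_subset[OF uc]) auto
        have ri: "(\<lambda>x. 2 powr p * ((1 / l powr p) * ?w x + c powr p)) integrable_on {-t..t}"
          by (intro integrable_on_mult_right integrable_add wi integrable_const_ivl)
        have "integral {-t..t} (\<lambda>x. u x powr p) \<le> integral {-t..t} (\<lambda>x. 2 powr p * ((1 / l powr p) * ?w x + c powr p))"
        proof (rule integral_le[OF ui ri])
          fix x
          have "u x powr p \<le> 2 powr p * (norm (H x - H 0) powr p + c powr p)"
            unfolding u_def using c p by (intro powr_add_le) auto
          also have "H x - H 0 = (1 / l) *\<^sub>R (window h l x - window h l 0)"
            unfolding H_def by (rule scaleR_diff_right[symmetric])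
          also have "norm \<dots> = (1 / l) * norm (window h l x - window h l 0)"
            using l by simp
          also have "\<dots> powr p = (1 / l powr p) * ?w x"
            using l by (simp add: powr_mult powr_divide)
          finally show "u x powr p \<le> 2 powr p * ((1 / l powr p) * ?w x + c powr p)" .
        qed
        also have "\<dots> = 2 powr p * ((1 / l powr p) * integral {-t..t} ?w + c powr p * (2 * t))"
          using wi elim(2) by (simp add: integral_add integrable_on_divide integrable_const_ivl)
        finally have "1 / (2 * t) * integral {-t..t} (\<lambda>x. u x powr p) \<le> 1 / (2 * t) * (2 powr p * ((1 / l powr p) * integral {-t..t} ?w + c powr p * (2 * t)))"
          using elim(2) by (intro mult_left_mono) auto
        also have "\<dots> = 2 powr p * ((1 / l powr p) * (1 / (2 * t) * integral {-t..t} ?w) + c powr p)"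
          using elim(2) by (simp add: field_simps)
        also have "\<dots> \<le> 2 powr p * (c powr p + c powr p)"
          using w by (intro mult_left_mono add_right_mono) auto
        also have "\<dots> < d"
          by (rule cp)
        finally show ?case .
      qed
    qed (auto simp: \<Psi>_def u0)
    then have "\<forall>\<^sub>F t in at_top. (1 / l) * mean_p p (\<lambda>x. norm (window (conv h) l x - window (conv h) l 0) powr p) t \<le> e"
      using eventually_gt_at_top[of 0]
    proof eventually_elim
      case (elim t)
      have eq: "norm (window (conv h) l x - window (conv h) l 0) powr p = l powr p * \<Psi> x powr p" for x
      proof -
        have "\<Psi> x = (1 / l) * norm (window (conv h) l x - window (conv h) l 0)"
          unfolding \<Psi>_def convH window_conv[OF h l(1)] scaleR_diff_right[symmetric] using l by simp
        then have "norm (window (conv h) l x - window (conv h) l 0) = l * \<Psi> x"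
          using l by simp
        then show ?thesis
          using l by (simp add: powr_mult \<Psi>_def)
      qed
      have "mean_p p (\<lambda>x. l powr p * \<Psi> x powr p) t \<le> l * e"
      proof (rule mean_p_leI)
        have "1 / (2 * t) * integral {-t..t} (\<lambda>x. l powr p * \<Psi> x powr p) = l powr p * (1 / (2 * t) * integral {-t..t} (\<lambda>x. \<Psi> x powr p))"
          by simp
        also have "\<dots> \<le> l powr p * e powr p"
          using elim(1) by (intro mult_left_mono) auto
        finally show "1 / (2 * t) * integral {-t..t} (\<lambda>x. l powr p * \<Psi> x powr p) \<le> (l * e) powr p"
          using l e by (simp add: powr_mult)
      qed (use elim p0 l e in auto)
      then show ?case
        unfolding eq using l by (simp add: field_simps)
    qed
    then have "Limsup at_top (\<lambda>t. ereal ((1 / l) * mean_p p (\<lambda>x. norm (window (conv h) l x - window (conv h) l 0) powr p) t)) \<le> ereal e"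
      by (rule Limsup_at_top_leI)
    then show ?case
      using e(2) by (rule order.strict_trans1)
  qed
qed

end

section \<open>Kernels with power bounds and rotations\<close>

lemma measurable_on_UNIV_subset:
  "f measurable_on UNIV \<Longrightarrow> S \<in> sets lebesgue \<Longrightarrow> f measurable_on S"
  using measurable_on_restrict[of f S] by (simp only: measurable_on_UNIV)

text \<open>Split at \<open>u = \<eta> * b powr (q - 1)\<close>. Up to it,
  \<open>b * u \<le> \<eta> * b powr q\<close>. Above it, \<open>(q - 1) * (p - 1) = 1\<close> gives
  \<open>b \<le> (u / \<eta>) powr (p - 1)\<close>, hence
  \<open>b * u \<le> \<eta> powr (1 - p) * u powr p\<close>. In each case one of the two terms
  suffices.\<close>

lemma mult_le_scaled_powr:
  fixes b u \<eta> p q :: real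
  assumes p: "1 < p" and q: "1 / p + 1 / q = 1" and b: "0 \<le> b" and u: "0 \<le> u" and \<eta>: "0 < \<eta>"
  shows "b * u \<le> \<eta> * b powr q + \<eta> powr (1 - p) * u powr p"
proof (cases "b = 0 \<or> u \<le> \<eta> * b powr (q - 1)")
  case True
  then have "b * u \<le> \<eta> * b powr q"
  proof
    assume le: "u \<le> \<eta> * b powr (q - 1)"
    have "b * u \<le> b * (\<eta> * b powr (q - 1))"
      using le b by (rule mult_left_mono)
    also have "\<dots> = \<eta> * b powr q"
      using powr_mult_base[of b "q - 1"] b by (cases "b = 0") (auto simp: algebra_simps)
    finally show ?thesis .
  qed (use \<eta> in auto)
  then show ?thesis
    by (simp add: add_increasing2)
next
  case False
  then have b0: "0 < b" and lt: "\<eta> * b powr (q - 1) < u"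
    using b by auto
  have u0: "0 < u"
    using lt \<eta> b0 by (metis less_trans mult_pos_pos powr_gt_zero order_less_irrefl)
  have pq: "(q - 1) * (p - 1) = 1"
  proof -
    have "q \<noteq> 0"
      using p q by auto
    then have "q + p = p * q"
      using p q by (simp add: field_simps)
    then show ?thesis
      by (simp add: algebra_simps)
  qed
  have "b = (b powr (q - 1)) powr (p - 1)"
    using b0 by (simp add: powr_powr pq)
  also have "\<dots> \<le> (u / \<eta>) powr (p - 1)"
    using lt \<eta> p by (intro powr_mono2) (auto simp: field_simps)
  also have "\<dots> = \<eta> powr (1 - p) * u powr (p - 1)"
    using u0 \<eta> by (simp add: powr_divide powr_diff powr_minus field_simps)
  finally have "b * u \<le> \<eta> powr (1 - p) * u powr (p - 1) * u"
    using u by (rule mult_right_mono)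
  also have "\<dots> = \<eta> powr (1 - p) * u powr p"
    using powr_mult_base[of u "p - 1"] u0 by (simp add: algebra_simps)
  finally show ?thesis
    using \<eta> by (simp add: add_increasing)
qed

text \<open>Compare with \<open>r powr s\<close> on \<open>(0, 1]\<close>, integrable since
  \<open>s > -1\<close>, and with \<open>r powr (- \<gamma>)\<close> beyond 1, where
  \<open>r powr s \<le> 1\<close>.\<close>

lemma nn_integral_resolvent_weight_finite:
  fixes s \<gamma> :: real
  assumes s: "-1 < s" "s \<le> 0" and \<gamma>: "1 < \<gamma>"
  shows "(\<integral>\<^sup>+r\<in>{0<..}. ennreal (r powr s / (1 + r powr \<gamma>)) \<partial>lebesgue) < \<infinity>"
proof -
  have I1: "(\<integral>\<^sup>+r\<in>{0..1}. ennreal (r powr s) \<partial>lborel) = ennreal (1 powr (s + 1) / (s + 1))"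
    by (rule nn_integral_has_integral_lebesgue'[OF _ has_integral_powr_from_0]) (use s in auto)
  have I2: "(\<integral>\<^sup>+r\<in>{1..}. ennreal (r powr (- \<gamma>)) \<partial>lborel) = ennreal (- (1 powr (- \<gamma> + 1)) / (- \<gamma> + 1))"
    by (rule nn_integral_has_integral_lebesgue'[OF _ has_integral_powr_to_inf]) (use \<gamma> in auto)
  have "(\<integral>\<^sup>+r\<in>{0<..}. ennreal (r powr s / (1 + r powr \<gamma>)) \<partial>lebesgue) \<le>
    (\<integral>\<^sup>+r. ennreal (r powr s) * indicator {0..1} r + ennreal (r powr (- \<gamma>)) * indicator {1..} r \<partial>lborel)"
    unfolding nn_integral_completion
  proof (rule nn_integral_mono)
    fix r :: real
    show "ennreal (r powr s / (1 + r powr \<gamma>)) * indicator {0<..} r \<le> ennreal (r powr s) * indicator {0..1} r + ennreal (r powr (- \<gamma>)) * indicator {1..} r"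
    proof (cases "0 < r")
      case r: True
      show ?thesis
      proof (cases "r \<le> 1")
        case True
        have "r powr s / (1 + r powr \<gamma>) \<le> r powr s / 1"
          by (intro divide_left_mono) (auto simp: add_pos_nonneg)
        then have "ennreal (r powr s / (1 + r powr \<gamma>)) \<le> ennreal (r powr s)"
          by (intro ennreal_leI) simp
        then show ?thesis
          using r True by (simp add: add_increasing2)
      next
        case False
        have "r powr s \<le> r powr 0"
          using False s by (intro powr_mono) auto
        then have "r powr s / (1 + r powr \<gamma>) \<le> 1 / r powr \<gamma>"
          using r by (intro frac_le) auto
        then have "ennreal (r powr s / (1 + r powr \<gamma>)) \<le> ennreal (r powr (- \<gamma>))"
          by (intro ennreal_leI) (simp add: powr_minus_divide)
        then show ?thesis
          using r False by simp
      qed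
    qed auto
  qed
  also have "\<dots> = (\<integral>\<^sup>+r\<in>{0..1}. ennreal (r powr s) \<partial>lborel) + (\<integral>\<^sup>+r\<in>{1..}. ennreal (r powr (- \<gamma>)) \<partial>lborel)"
    by (intro nn_integral_add) measurable
  also have "\<dots> < \<infinity>"
    unfolding I1 I2 by simp
  finally show ?thesis .
qed

text \<open>Young's inequality is applied to \<open>M * r powr (\<beta> - 1)\<close> and
  \<open>u\<close> only, and multiplied by \<open>\<sigma>\<close> afterwards, so that both terms
  inherit the decay at infinity. The condition \<open>q * (\<beta> - 1) > -1\<close> is
  integrability of \<open>\<kappa>\<close> at 0.\<close>

lemma resolvent_conv_weight:
  fixes p q \<beta> \<gamma> M :: real
  assumes p: "1 \<le> p" and q: "1 < p \<Longrightarrow> 1 / p + 1 / q = 1" and \<gamma>: "1 < \<gamma>" and \<beta>: "0 < \<beta>" "\<beta> \<le> 1" and M: "0 < M"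
    and pq: "1 < p \<Longrightarrow> q * (\<beta> - 1) > -1" and p1: "p = 1 \<Longrightarrow> \<beta> = 1"
  shows "\<exists>\<kappa> \<sigma> K a. conv_weight p (\<lambda>r. M * r powr (\<beta> - 1) / (1 + r powr \<gamma>)) \<kappa> \<sigma> K a"
proof -
  \<comment> \<open>For \<open>p = 1\<close> also \<open>\<beta> = 1\<close>: the kernel has no
    singularity and equals \<open>M * \<sigma>\<close> for \<open>r > 0\<close>, so
    \<open>C = M\<close> works for every \<open>\<eta>\<close>.\<close>
  define s where "s = (if p = 1 then 0 else q * (\<beta> - 1))"
  have s: "-1 < s" "s \<le> 0"
  proof -
    show "-1 < s"
      using pq p by (auto simp: s_def)
    have "0 \<le> q" if "1 < p"
    proof (rule ccontr)
      assume "\<not> 0 \<le> q"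
      then have "1 / q < 0" "1 / p < 1"
        using that by auto
      then show False
        using q[OF that] by linarith
    qed
    then show "s \<le> 0"
      using p \<beta> by (auto simp: s_def mult_nonneg_nonpos)
  qed
  define \<kappa> where "\<kappa> = (\<lambda>r. r powr s / (1 + r powr \<gamma>))"
  define \<sigma> where "\<sigma> = (\<lambda>r. 1 / (1 + r powr \<gamma>))"
  have pos: "0 < 1 + r powr \<gamma>" for r :: real
    by (simp add: add_pos_nonneg)
  obtain K where K: "0 \<le> K" "(\<integral>\<^sup>+r\<in>{0<..}. ennreal (\<kappa> r) \<partial>lebesgue) = ennreal K"
    using nn_integral_resolvent_weight_finite[OF s \<gamma>] unfolding \<kappa>_def
    by (cases "\<integral>\<^sup>+r\<in>{0<..}. ennreal (r powr s / (1 + r powr \<gamma>)) \<partial>lebesgue") auto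
  have "conv_weight p (\<lambda>r. M * r powr (\<beta> - 1) / (1 + r powr \<gamma>)) \<kappa> \<sigma> K (\<lambda>k. \<sigma> (real k))"
  proof
    show "1 \<le> p"
      by (rule p)
    show "(\<lambda>r. M * r powr (\<beta> - 1) / (1 + r powr \<gamma>)) \<in> borel_measurable borel"
      "\<kappa> \<in> borel_measurable borel" "\<sigma> \<in> borel_measurable borel"
      unfolding \<kappa>_def \<sigma>_def by measurable
    show "0 \<le> M * r powr (\<beta> - 1) / (1 + r powr \<gamma>)" "0 \<le> \<kappa> r" "0 \<le> \<sigma> r" for r
      using M pos[of r] by (auto simp: \<kappa>_def \<sigma>_def)
    show "0 \<le> K" "(\<integral>\<^sup>+r\<in>{0<..}. ennreal (\<kappa> r) \<partial>lebesgue) \<le> ennreal K"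
      using K by auto
    show "0 \<le> \<sigma> (real k)" for k
      by (simp add: \<sigma>_def)
    show "summable (\<lambda>k. \<sigma> (real k))"
    proof (rule summable_comparison_test')
      show "summable (\<lambda>k. real k powr (- \<gamma>))"
        using \<gamma> by (simp add: summable_real_powr_iff)
      fix k :: nat assume "1 \<le> k"
      then have "1 / (1 + real k powr \<gamma>) \<le> 1 / real k powr \<gamma>"
        by (intro frac_le) auto
      then show "norm (\<sigma> (real k)) \<le> real k powr (- \<gamma>)"
        by (simp add: \<sigma>_def powr_minus_divide)
    qed
    show "\<sigma> r \<le> \<sigma> (real k)" if "0 < r" "real k \<le> r" "r \<le> real k + 1" for k r
      using that \<gamma> unfolding \<sigma>_def by (intro frac_le add_left_mono powr_mono2) (auto simp: add_pos_nonneg)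
    fix \<eta> :: real assume \<eta>: "0 < \<eta>"
    have \<sigma>0: "0 \<le> \<sigma> r" for r
      by (simp add: \<sigma>_def)
    show "\<exists>C\<ge>0. \<forall>r>0. \<forall>u\<ge>0. M * r powr (\<beta> - 1) / (1 + r powr \<gamma>) * u \<le> \<eta> * \<kappa> r + C * \<sigma> r * u powr p"
    proof (cases "p = 1")
      case True
      then show ?thesis
        using M p1 \<eta> by (intro exI[of _ M]) (auto simp: \<sigma>_def \<kappa>_def)
    next
      case False
      then have p': "1 < p"
        using p by simp
      \<comment> \<open>Division by \<open>M powr q\<close> cancels the factor that \<open>M\<close>
        contributes to \<open>?b powr q\<close>, leaving exactly
        \<open>\<eta> * r powr s\<close>.\<close>
      define \<eta>' where "\<eta>' = \<eta> / M powr q"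
      have \<eta>': "0 < \<eta>'"
        using \<eta> M by (simp add: \<eta>'_def)
      show ?thesis
      proof (intro exI[of _ "\<eta>' powr (1 - p)"] conjI allI impI)
        fix r u :: real assume r: "0 < r" and u: "0 \<le> u"
        let ?b = "M * r powr (\<beta> - 1)"
        have "?b * u \<le> \<eta>' * ?b powr q + \<eta>' powr (1 - p) * u powr p"
          by (rule mult_le_scaled_powr[OF p' q[OF p']]) (use M u \<eta>' in auto)
        also have "\<eta>' * ?b powr q = \<eta> * r powr s"
          using M False by (simp add: \<eta>'_def powr_mult powr_powr s_def mult.commute)
        finally have "\<sigma> r * (?b * u) \<le> \<sigma> r * (\<eta> * r powr s + \<eta>' powr (1 - p) * u powr p)"
          by (rule mult_left_mono[OF _ \<sigma>0])
        then show "?b / (1 + r powr \<gamma>) * u \<le> \<eta> * \<kappa> r + \<eta>' powr (1 - p) * \<sigma> r * u powr p"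
          by (simp add: \<sigma>_def \<kappa>_def field_simps add_divide_distrib)
      qed simp
    qed
  qed
  then show ?thesis
    by blast
qed

section \<open>Complex structures and rotations\<close>

lemma complex_structure_norm:
  assumes "complex_structure J"
  shows "norm (J x) = norm x" "norm (scaleJ J (cis \<theta>) x) = norm x"
proof -
  have *: "norm (cos th *\<^sub>R x + sin th *\<^sub>R J x) = norm x" for th x
    using assms by (simp add: complex_structure_def)
  show "norm (J x) = norm x"
    using *[of "pi / 2" x] by simp
  show "norm (scaleJ J (cis \<theta>) x) = norm x"
    using *[of \<theta> x] by (simp add: scaleJ_def)
qed

lemma complex_structure_bounded_linear:
  assumes "complex_structure J"
  shows "bounded_linear J"
proof -
  have "linear J"
    using assms by (simp add: complex_structure_def)
  then show ?thesis
    by (intro bounded_linear_intro[of _ 1]) (auto simp: linear_add linear_scale complex_structure_norm[OF assms])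
qed

lemma bounded_linear_scaleJ:
  assumes "complex_structure J"
  shows "bounded_linear (scaleJ J c)"
proof -
  have "bounded_linear (\<lambda>x. Re c *\<^sub>R x + Im c *\<^sub>R J x)"
    by (intro bounded_linear_add bounded_linear_const_scaleR bounded_linear_ident complex_structure_bounded_linear[OF assms])
  then show ?thesis
    by (simp add: scaleJ_def[abs_def])
qed

lemma scaleJ_cis_add:
  assumes "complex_structure J"
  shows "scaleJ J (cis (s + t)) x = scaleJ J (cis s) (scaleJ J (cis t) x)"
proof -
  have "linear J" "\<And>x. J (J x) = - x"
    using assms by (auto simp: complex_structure_def)
  then show ?thesis
    by (simp add: scaleJ_def cos_add sin_add linear_add linear_scale algebra_simps)
qed

lemma measurable_on_rotation:
  assumes J: "complex_structure J" and g: "g measurable_on UNIV"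
  shows "(\<lambda>s::real. scaleJ J (cis (lam * s)) (g s)) measurable_on UNIV"
proof -
  have "continuous_on UNIV J"
    using complex_structure_bounded_linear[OF J] by (simp add: linear_continuous_on)
  from measurable_on_compose_continuous[OF g this] have "(\<lambda>s. J (g s)) measurable_on UNIV"
    by (simp add: o_def)
  then show ?thesis
    unfolding scaleJ_def cis.sel
    by (intro measurable_on_add measurable_on_scaleR[OF continuous_imp_measurable_on] g continuous_intros) auto
qed

lemma bounded_clinear_scaleJ:
  "bounded_clinear_op JX JY T \<Longrightarrow> T (scaleJ JX c x) = scaleJ JY c (T x)"
  by (simp add: bounded_clinear_op_def scaleJ_def linear_add linear_scale bounded_linear.linear)

text \<open>Rotations are isometries, so all weights are unchanged. Strong measurability survives
  because the rotated kernel applied to \<open>x\<close> combines \<open>R r x\<close> and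
  \<open>R r (JX x)\<close> with continuous coefficients.\<close>

lemma conv_operator_rotation:
  assumes op: "conv_operator p \<rho> \<kappa> \<sigma> K a R" and J: "complex_structure JX"
  shows "conv_operator p \<rho> \<kappa> \<sigma> K a (\<lambda>r x. R r (scaleJ JX (cis (lam * r)) x))"
proof -
  interpret conv_operator p \<rho> \<kappa> \<sigma> K a R
    by (rule op)
  show ?thesis
  proof (intro conv_operator.intro conv_operator_axioms.intro conv_weight_axioms)
    show "bounded_linear (\<lambda>x. R r (scaleJ JX (cis (lam * r)) x))" if "0 < r" for r
      by (rule bounded_linear_compose[OF R_lin[OF that] bounded_linear_scaleJ[OF J]])
    show "norm (R r (scaleJ JX (cis (lam * r)) x)) \<le> \<rho> r * norm x" if "0 < r" for r x
      using R_norm[OF that, of "scaleJ JX (cis (lam * r)) x"] complex_structure_norm(2)[OF J] by simp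
    fix x
    have "(\<lambda>r. cos (lam * r) *\<^sub>R R r x + sin (lam * r) *\<^sub>R R r (JX x)) measurable_on {0<..}"
      by (intro measurable_on_add measurable_on_scaleR R_meas measurable_on_UNIV_subset[OF continuous_imp_measurable_on] continuous_intros) auto
    then show "(\<lambda>r. R r (scaleJ JX (cis (lam * r)) x)) measurable_on {0<..}"
      by (rule measurable_on_spike[OF _ negligible_empty])
        (simp add: scaleJ_def R_lin linear_add linear_scale bounded_linear.linear)
  qed
qed

text \<open>The angle splits as \<open>lam * x = lam * r + lam * (x - r)\<close>: the kernel carries
  the first part, the function the second. Complex linearity of \<open>R r\<close> then lets the
  common factor leave the integral.\<close>

lemma conv_rotation:
  assumes op: "conv_operator p \<rho> \<kappa> \<sigma> K a R" and JX: "complex_structure JX" and JY: "complex_structure JY"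
    and R: "\<And>r. 0 < r \<Longrightarrow> bounded_clinear_op JX JY (R r)" and g: "conv_operator.stepanov p S g"
  shows "conv_operator.conv (\<lambda>r x. R r (scaleJ JX (cis (lam * r)) x)) (\<lambda>s. scaleJ JX (cis (lam * s)) (g s)) x
     = scaleJ JY (cis (lam * x)) (conv_operator.conv R g x)"
proof -
  interpret conv_operator p \<rho> \<kappa> \<sigma> K a R
    by (rule op)
  interpret R': conv_operator p \<rho> \<kappa> \<sigma> K a "\<lambda>r x. R r (scaleJ JX (cis (lam * r)) x)"
    by (rule conv_operator_rotation[OF op JX])
  have "R'.conv (\<lambda>s. scaleJ JX (cis (lam * s)) (g s)) x = integral {0<..} (\<lambda>r. scaleJ JY (cis (lam * x)) (R r (g (x - r))))"
    unfolding R'.conv_def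
  proof (rule integral_cong)
    fix r :: real assume r: "r \<in> {0<..}"
    have "scaleJ JX (cis (lam * r)) (scaleJ JX (cis (lam * (x - r))) (g (x - r))) = scaleJ JX (cis (lam * x)) (g (x - r))"
      by (simp add: scaleJ_cis_add[OF JX, symmetric] algebra_simps)
    then show "R r (scaleJ JX (cis (lam * r)) (scaleJ JX (cis (lam * (x - r))) (g (x - r)))) = scaleJ JY (cis (lam * x)) (R r (g (x - r)))"
      using bounded_clinear_scaleJ[OF R] r by simp
  qed
  also have "\<dots> = scaleJ JY (cis (lam * x)) (conv g x)"
    unfolding conv_def
    using integral_linear[OF admissible_integrable[OF stepanov_admissible[OF g, of x]] bounded_linear_scaleJ[OF JY]]
    by (simp add: o_def)
  finally show ?thesis .
qed

section \<open>Almost periodicity of the convolution\<close>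

lemma stepanov_bounded_nn_integral:
  fixes g :: "real \<Rightarrow> 'a::real_normed_vector"
  assumes p: "1 \<le> p" and g: "locLp p g" "stepanov_bounded p g"
  shows "\<exists>S\<ge>0. \<forall>t. Lp_mass p {t..t+1} g \<le> ennreal S"
proof -
  obtain C where C: "\<And>t. (integral {t..t+1} (\<lambda>s. norm (g s) powr p)) powr (1 / p) \<le> C"
    using g(2) by (auto simp: stepanov_bounded_def)
  show ?thesis
  proof (intro exI[of _ "C powr p"] conjI allI)
    fix t
    let ?I = "integral {t..t+1} (\<lambda>s. norm (g s) powr p)"
    have i: "(\<lambda>s. norm (g s) powr p) integrable_on {t..t+1}"
      using g(1) by (simp add: locLp_def)
    then have I0: "0 \<le> ?I"
      by (intro integral_nonneg) auto
    have "(?I powr (1 / p)) powr p \<le> C powr p"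
      using C[of t] p by (intro powr_mono2) auto
    moreover have "(?I powr (1 / p)) powr p = ?I"
      using powr_one[OF I0] p by (simp only: powr_powr) simp
    ultimately have "?I \<le> C powr p"
      by simp
    moreover have "Lp_mass p {t..t+1} g = ennreal ?I"
      unfolding nn_integral_completion
      by (rule nn_integral_has_integral_lebesgue'[OF _ integrable_integral[OF i]]) simp
    ultimately show "Lp_mass p {t..t+1} g \<le> ennreal (C powr p)"
      by (simp add: ennreal_leI)
  qed simp
qed

lemma integrable_norm_powr:
  fixes f :: "real \<Rightarrow> 'a::real_normed_vector"
  assumes "continuous_on UNIV f" "0 < p"
  shows "(\<lambda>s. norm (f s) powr p) integrable_on {a..b}"
  using assms(2) continuous_on_subset[OF assms(1), of "{a..b}"]
  by (intro integrable_continuous_interval continuous_on_powr' continuous_intros) auto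

lemma Mp_norm_bounded_less_infinity:
  fixes f :: "real \<Rightarrow> 'a::real_normed_vector"
  assumes f: "continuous_on UNIV f" and B: "\<And>x. norm (f x) \<le> B" and p: "0 < p"
  shows "Mp_norm p f < \<infinity>"
proof -
  have B0: "0 \<le> B"
    using B norm_ge_zero order_trans by blast
  have "mean_p p (\<lambda>s. norm (f s) powr p) t \<le> B" if t: "0 < t" for t
  proof (rule mean_p_leI)
    have "integral {-t..t} (\<lambda>s. norm (f s) powr p) \<le> integral {-t..t} (\<lambda>_. B powr p)"
      by (rule integral_le) (use p B in \<open>auto intro!: integrable_norm_powr f powr_mono2\<close>)
    then show "1 / (2 * t) * integral {-t..t} (\<lambda>s. norm (f s) powr p) \<le> B powr p"
      using t by (simp add: field_simps)
  qed (use t p B0 in auto)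
  then have "Mp_norm p f \<le> ereal B"
    unfolding Mp_norm_def by (intro Limsup_at_top_leI eventually_mono[OF eventually_gt_at_top[of 0]])
  then show ?thesis
    by (rule le_less_trans) simp
qed

context conv_operator
begin

lemma conv_BD_almost_periodic:
  fixes JX :: "'a \<Rightarrow> 'a" and JY :: "'b \<Rightarrow> 'b"
  assumes JX: "complex_structure JX" and JY: "complex_structure JY"
    and R: "\<And>r. 0 < r \<Longrightarrow> bounded_clinear_op JX JY (R r)"
    and g: "stepanov S g" and BD: "BD_almost_periodic JX p g"
    and past: "\<And>lam \<epsilon>. \<epsilon> > 0 \<Longrightarrow> \<exists>l0>0. \<forall>l\<ge>l0. \<forall>v\<ge>0.
        (1 / l) * norm (integral {0..l} (\<lambda>s. scaleJ JX (cis (lam * s)) (g s))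
                        - integral {-v..l-v} (\<lambda>s. scaleJ JX (cis (lam * s)) (g s))) powr p < \<epsilon>"
  shows "BD_almost_periodic JY p (conv g)"
proof -
  have p0: "0 < p" using p by simp
  note cc = conv_continuous[OF g]
  obtain B where B: "\<And>x. norm (conv g x) \<le> B"
    using conv_bounded[OF g] by blast
  have "locLp p (conv g)"
    unfolding locLp_def using continuous_imp_measurable_on[OF cc] integrable_norm_powr[OF cc p0] by blast
  moreover have "Mp_norm p (conv g) < \<infinity>"
    by (rule Mp_norm_bounded_less_infinity[OF cc B p0])
  moreover have "((\<lambda>\<tau>. Mp_norm p (\<lambda>s. conv g (s + \<tau>) - conv g s)) \<longlongrightarrow> 0) (at 0)"
  proof (rule order_tendstoI)
    fix y :: ereal assume "y < 0"
    then show "\<forall>\<^sub>F \<tau> in at 0. y < Mp_norm p (\<lambda>s. conv g (s + \<tau>) - conv g s)"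
      by (intro always_eventually allI) (rule less_le_trans[OF _ Mp_norm_nonneg])
  next
    fix y :: ereal assume "0 < y"
    then obtain e where e: "0 < e" "ereal e < y"
      using ereal_dense2[of 0 y] by auto
    obtain d where d: "d > 0" "\<And>\<tau>. Mp_norm p (\<lambda>s. g (s + \<tau>) - g s) < ereal d \<Longrightarrow>
        Mp_norm p (\<lambda>s. conv g (s + \<tau>) - conv g s) \<le> ereal e"
      using conv_translation_transfer[OF g e(1)] by blast
    have "((\<lambda>\<tau>. Mp_norm p (\<lambda>s. g (s + \<tau>) - g s)) \<longlongrightarrow> 0) (at 0)"
      using BD by (simp add: BD_almost_periodic_def)
    then have "\<forall>\<^sub>F \<tau> in at 0. Mp_norm p (\<lambda>s. g (s + \<tau>) - g s) < ereal d"
      using d(1) by (intro order_tendstoD) auto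
    then show "\<forall>\<^sub>F \<tau> in at 0. Mp_norm p (\<lambda>s. conv g (s + \<tau>) - conv g s) < y"
      by eventually_elim (rule le_less_trans[OF d(2) e(2)])
  qed
  moreover have "relatively_dense {\<tau>. Mp_norm p (\<lambda>s. conv g (s + \<tau>) - conv g s) < ereal \<epsilon>}" if \<epsilon>: "0 < \<epsilon>" for \<epsilon>
  proof -
    \<comment> \<open>The transfer gives a non-strict bound, hence \<open>\<epsilon> / 2\<close> for
      the strict one.\<close>
    obtain d where d: "d > 0" "\<And>\<tau>. Mp_norm p (\<lambda>s. g (s + \<tau>) - g s) < ereal d \<Longrightarrow>
        Mp_norm p (\<lambda>s. conv g (s + \<tau>) - conv g s) \<le> ereal (\<epsilon> / 2)"
      using conv_translation_transfer[OF g, of "\<epsilon> / 2"] \<epsilon> by auto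
    have "{\<tau>. Mp_norm p (\<lambda>s. g (s + \<tau>) - g s) < ereal d} \<subseteq> {\<tau>. Mp_norm p (\<lambda>s. conv g (s + \<tau>) - conv g s) < ereal \<epsilon>}"
    proof clarify
      fix \<tau> assume "Mp_norm p (\<lambda>s. g (s + \<tau>) - g s) < ereal d"
      from d(2)[OF this] show "Mp_norm p (\<lambda>s. conv g (s + \<tau>) - conv g s) < ereal \<epsilon>"
        by (rule le_less_trans) (use \<epsilon> in simp)
    qed
    moreover have "relatively_dense {\<tau>. Mp_norm p (\<lambda>s. g (s + \<tau>) - g s) < ereal d}"
      using BD d(1) by (simp add: BD_almost_periodic_def)
    ultimately show ?thesis
      unfolding relatively_dense_def by (meson subsetD)
  qed
  moreover have "((\<lambda>l. Limsup at_top (\<lambda>t. ereal ((1 / l) *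
            mean_p p (\<lambda>x. norm (integral {x..x+l} (\<lambda>s. scaleJ JY (cis (lam * s)) (conv g s))
                               - integral {0..l} (\<lambda>s. scaleJ JY (cis (lam * s)) (conv g s))) powr p) t)))
         \<longlongrightarrow> 0) at_top" for lam
  proof -
    \<comment> \<open>With the kernel rotated at frequency \<open>lam\<close>, condition (iv) at
      \<open>lam\<close> becomes a statement about plain windows.\<close>
    interpret R': conv_operator p \<rho> \<kappa> \<sigma> K a "\<lambda>r x. R r (scaleJ JX (cis (lam * r)) x)"
      by (rule conv_operator_rotation[OF conv_operator_axioms JX])
    define h where "h = (\<lambda>s. scaleJ JX (cis (lam * s)) (g s))"
    have h: "stepanov S h"
      using g measurable_on_rotation[OF JX, of g lam]
      by (simp add: stepanov_def h_def complex_structure_norm(2)[OF JX])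
    have conv_h: "R'.conv h = (\<lambda>x. scaleJ JY (cis (lam * x)) (conv g x))"
      unfolding h_def using conv_rotation[OF conv_operator_axioms JX JY R g] by blast
    have "((\<lambda>l. Limsup at_top (\<lambda>t. ereal ((1 / l) *
        mean_p p (\<lambda>x. norm (window (R'.conv h) l x - window (R'.conv h) l 0) powr p) t))) \<longlongrightarrow> 0) at_top"
    proof (rule R'.conv_window_transfer[OF h])
      show "((\<lambda>l. Limsup at_top (\<lambda>t. ereal ((1 / l) *
        mean_p p (\<lambda>x. norm (window h l x - window h l 0) powr p) t))) \<longlongrightarrow> 0) at_top"
        using BD by (simp add: BD_almost_periodic_def window_def h_def)
      show "\<exists>l0>0. \<forall>l\<ge>l0. \<forall>v\<ge>0. (1 / l) * norm (window h l 0 - window h l (- v)) powr p < \<epsilon>" if "0 < \<epsilon>" for \<epsilon>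
        using past[OF that, of lam] by (simp add: window_def h_def)
    qed
    then show ?thesis
      by (simp add: conv_h window_def)
  qed
  ultimately show ?thesis
    unfolding BD_almost_periodic_def by blast
qed

end

text \<open>Integrability is asserted separately because \<open>integral\<close> returns 0 for a
  non-integrable function; only with it do the claims about \<open>G\<close> concern genuine
  integrals.\<close>

theorem theorem2p4:
  fixes JX :: "'a::banach \<Rightarrow> 'a" and JY :: "'b::banach \<Rightarrow> 'b"
    and R :: "real \<Rightarrow> 'a \<Rightarrow> 'b" and g :: "real \<Rightarrow> 'a"
    and p q \<beta> \<gamma> M :: real
  assumes JX: "complex_structure JX" and JY: "complex_structure JY"
    and nontrivX: "\<exists>x::'a. x \<noteq> 0" and nontrivY: "\<exists>y::'b. y \<noteq> 0"
    and p: "1 \<le> p"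
    and q: "1 < p \<Longrightarrow> 1 / p + 1 / q = 1"
    and R_op: "\<And>t. t > 0 \<Longrightarrow> bounded_clinear_op JX JY (R t)"
    and R_meas: "\<And>x. (\<lambda>t. R t x) measurable_on {0<..}"
    and R_bound: "\<And>t. t > 0 \<Longrightarrow> onorm (R t) \<le> M * t powr (\<beta> - 1) / (1 + t powr \<gamma>)"
    and \<gamma>: "\<gamma> > 1" and \<beta>: "0 < \<beta>" "\<beta> \<le> 1" and M: "M > 0"
    and g_BD: "BD_almost_periodic JX p g"
    and g_S: "stepanov_bounded p g"
    and pq: "1 < p \<Longrightarrow> q * (\<beta> - 1) > -1"
    and p1: "p = 1 \<Longrightarrow> \<beta> = 1"
    and extra: "\<And>lam \<epsilon>. \<epsilon> > 0 \<Longrightarrow> \<exists>l0>0. \<forall>l\<ge>l0. \<forall>v\<ge>0.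
        (1 / l) * norm (integral {0..l} (\<lambda>s. scaleJ JX (cis (lam * s)) (g s))
                        - integral {-v..l-v} (\<lambda>s. scaleJ JX (cis (lam * s)) (g s))) powr p < \<epsilon>"
  shows "(\<forall>t. (\<lambda>s. R (t - s) (g s)) integrable_on {..t}) \<and>
         (let G = (\<lambda>t. integral {..t} (\<lambda>s. R (t - s) (g s)))
          in bounded (range G) \<and> continuous_on UNIV G \<and> BD_almost_periodic JY p G)"
proof -
  define \<rho> where "\<rho> = (\<lambda>r. M * r powr (\<beta> - 1) / (1 + r powr \<gamma>))"
  obtain \<kappa> \<sigma> K a where W: "conv_weight p \<rho> \<kappa> \<sigma> K a"
    using resolvent_conv_weight[OF p q \<gamma> \<beta> M pq p1] unfolding \<rho>_def by blast
  interpret conv_operator p \<rho> \<kappa> \<sigma> K a R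
  proof (intro conv_operator.intro conv_operator_axioms.intro W R_meas)
    show bl: "bounded_linear (R r)" if "0 < r" for r
      using R_op[OF that] by (simp add: bounded_clinear_op_def)
    show "norm (R r x) \<le> \<rho> r * norm x" if "0 < r" for r x
      using onorm[OF bl[OF that], of x] mult_right_mono[OF R_bound[OF that] norm_ge_zero[of x]]
      unfolding \<rho>_def by linarith
  qed
  have loc: "locLp p g"
    using g_BD by (simp add: BD_almost_periodic_def)
  obtain S where g: "stepanov S g"
    using stepanov_bounded_nn_integral[OF p loc g_S] loc unfolding stepanov_def locLp_def by blast
  have G: "(\<lambda>t. integral {..t} (\<lambda>s. R (t - s) (g s))) = conv g"
    using has_integral_conv[OF g] by (intro ext integral_unique)
  have "bounded (range (conv g))"
    using conv_bounded[OF g] by (auto simp: bounded_iff)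
  moreover have "BD_almost_periodic JY p (conv g)"
    by (rule conv_BD_almost_periodic[OF JX JY R_op g g_BD extra])
  ultimately show ?thesis
    unfolding Let_def G using conv_continuous[OF g] has_integral_conv[OF g] by (auto simp: integrable_on_def)
qed

end
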